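(* Let $(\omega_\sigma)_{\sigma>0}$ be a sequence of Fock-states, let $\mathbf{O}\subset\mathbb{R}^d$ be a non-empty open bounded region, and let $R_0(\mathbf{O})$ be the closed subspace of functions $f\in L^2(\mathbf{O})$ satisfying $\int d\boldsymbol{x}\, f(\boldsymbol{x}) = 0$. The sequence describes in the limit a homogeneous proper condensate in $\mathbf{O}$ with zero momentum if and only if $$\limsup_{\sigma\to\infty}\,\omega_\sigma(a^*(f)a(f)) < \infty \quad\text{for all } f\in R_0(\mathbf{O}),$$ and, for some (hence any) function $s\in L^2(\mathbf{O})$ with $\int d\boldsymbol{x}\, s(\boldsymbol{x})\neq 0$, $$\limsup_{\sigma\to\infty}\,\omega_\sigma(a^*(s)a(s)) = \infty .$$
   Context: Let $\mathcal{F}$ be the bosonic Fock space over $L^2(\mathbb{R}^d)$, $d\ge1$, with scalar product $\langle\cdot,\cdot\rangle$ antilinear in the first entry. Annihilation operators $a(f)$ (antilinear in $f$) and creation operators $a^*(g)$ (linear in $g$) satisfy $[a(f),a^*(g)] = \langle f,g\rangle 1$, all other commutators vanishing. A Fock-state is a state $\omega(A) = \mathrm{Tr}\,\rho A$ given by a density matrix $\rho$ on $\mathcal{F}$; it is assumed throughout that $\omega(a^*(f)a(f)) < \infty$ for all $f\in L^2(\mathbb{R}^d)$, and the sesquilinear form $\omega(a^*(f)a(g))$ (linear in $f$, antilinear in $g$) is its one-particle density matrix. A "sequence of states" is a family $(\omega_\sigma)_{\sigma>0}$ of such states. For an open bounded set $\mathbf{O}\subset\mathbb{R}^d$, $L^2(\mathbf{O})\subset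 L^2(\mathbb{R}^d)$ is the subspace of functions supported in $\mathbf{O}$, and $|\mathbf{O}|$ is the volume of $\mathbf{O}$. The regular subspace $R(\mathbf{O})$ of the sequence is the set of $f\in L^2(\mathbf{O})$ with $\limsup_{\sigma\to\infty}\omega_\sigma(a^*(f)a(f))<\infty$; functions in $L^2(\mathbf{O})\setminus R(\mathbf{O})$ are called singular. The limit of the sequence contains a proper condensate in $\mathbf{O}$ if $R(\mathbf{O})$ is closed and its orthogonal complement in $L^2(\mathbf{O})$ is one-dimensional, spanned by a singular function $s_C$, $\|s_C\|=1$ (unique up to a phase). Put $n_C(\sigma) = \omega_\sigma(a^*(s_C)a(s_C))$, which is unbounded as $\sigma\to\infty$. The symbol $\lim_\sigma$ is the limit along sequences $\sigma_j\to\infty$ with $n_C(\sigma_j)\to\infty$. The translations are $(T_{\boldsymbol{x}}f)(\boldsymbol{z}) = f(\boldsymbol{z}-\boldsymbol{x})$. Write $\mathbf{O}_0\Subset\mathbf{O}$ if $\mathbf{O}_0$ is open and its closure is contained in $\mathbf{O}$. The sequence describes a homogeneous proper condensate in $\mathbf{O}$ in the limit if its limit contains a proper condensate in $\mathbf{O}$ and $$\lim_\sigma n_C(\sigma)^{-1}\omega_\sigma(a^*(T_{\boldsymbol{x}}f)a(T_{\boldsymbol{x}}g)) = \langle s_C,f\rangle\langle g,s_C\rangle$$ for all $\mathbf{O}_0\Subset\mathbf{O}$, all $f,g\in L^2(\mathbf{O}_0)$ and all $\boldsymbol{x}\in\mathbb{R}^d$ with $\mathbf{O}_0+\boldsymbol{x}\Subset\mathbf{O}$.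 It has momentum $\boldsymbol{p}\in\mathbb{R}^d$ if, up to a constant phase factor, $s_C(\boldsymbol{x}) = |\mathbf{O}|^{-1/2}e^{i\boldsymbol{x}\cdot\boldsymbol{p}}$ for almost every $\boldsymbol{x}\in\mathbf{O}$; zero momentum means $\boldsymbol{p}=0$, i.e. $s_C$ is constant on $\mathbf{O}$. *)

theory Defs
  imports "HOL-Analysis.Analysis"
begin

section \<open>Square-integrable functions\<close>

text \<open>Elements of L2 spaces are represented by Borel functions; equality of elements is
  equality almost everywhere.  The scalar product is antilinear in the first entry.\<close>

definition L2_space :: "'a measure \<Rightarrow> ('a \<Rightarrow> complex) set" where
  "L2_space M = {f \<in> borel_measurable M. integrable M (\<lambda>x. (cmod (f x))\<^sup>2)}"

definition L2_inner :: "'a measure \<Rightarrow> ('a \<Rightarrow> complex) \<Rightarrow> ('a \<Rightarrow> complex) \<Rightarrow> complex" where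
  "L2_inner M f g = (LINT x|M. cnj (f x) * g x)"

definition L2_norm :: "'a measure \<Rightarrow> ('a \<Rightarrow> complex) \<Rightarrow> real" where
  "L2_norm M f = sqrt (LINT x|M. (cmod (f x))\<^sup>2)"

definition L2_closed :: "'a measure \<Rightarrow> ('a \<Rightarrow> complex) set \<Rightarrow> bool" where
  "L2_closed M S \<longleftrightarrow>
     (\<forall>F f. (\<forall>k::nat. F k \<in> S) \<longrightarrow> f \<in> L2_space M \<longrightarrow>
        (\<lambda>k. L2_norm M (\<lambda>x. F k x - f x)) \<longlonglongrightarrow> 0 \<longrightarrow> f \<in> S)"

definition L2_on :: "(real^'d) set \<Rightarrow> (real^'d \<Rightarrow> complex) set" where
  "L2_on \<O> = {f \<in> L2_space lborel. AE x in lborel. x \<notin> \<O> \<longrightarrow> f x = 0}"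

definition L2_mean_zero :: "(real^'d) set \<Rightarrow> (real^'d \<Rightarrow> complex) set" where
  "L2_mean_zero \<O> = {f \<in> L2_on \<O>. (LINT x|lborel. f x) = 0}"


section \<open>Bosonic Fock space\<close>

text \<open>A Fock vector is the sequence of its \<open>n\<close>-particle wave functions; the coordinates
  \<open>x 0, \<dots>, x (n - 1)\<close> of \<open>n\<close> particles form a point of the \<open>n\<close>-fold product of Lebesgue
  measure (a single point of mass 1 for \<open>n = 0\<close>).\<close>

type_synonym 'd fock = "nat \<Rightarrow> (nat \<Rightarrow> real^'d) \<Rightarrow> complex"

type_synonym 'd fock_operator = "'d fock \<Rightarrow> 'd fock"

abbreviation config :: "nat \<Rightarrow> (nat \<Rightarrow> real^'d) measure" where
  "config n \<equiv> PiM {..<n} (\<lambda>_. lborel)"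

definition fock_space :: "('d::finite) fock set" where
  "fock_space = {\<Psi>.
     (\<forall>n. \<Psi> n \<in> L2_space (config n)) \<and>
     (\<forall>n \<pi>. \<pi> permutes {..<n} \<longrightarrow> (AE x in config n. \<Psi> n (x \<circ> \<pi>) = \<Psi> n x)) \<and>
     summable (\<lambda>n. (L2_norm (config n) (\<Psi> n))\<^sup>2)}"

definition fock_eq :: "('d::finite) fock \<Rightarrow> 'd fock \<Rightarrow> bool" where
  "fock_eq \<Psi> \<Phi> \<longleftrightarrow> (\<forall>n. AE x in config n. \<Psi> n x = \<Phi> n x)"

definition fock_inner :: "('d::finite) fock \<Rightarrow> 'd fock \<Rightarrow> complex" where
  "fock_inner \<Psi> \<Phi> = (\<Sum>n. L2_inner (config n) (\<Psi> n) (\<Phi> n))"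

definition fock_norm :: "('d::finite) fock \<Rightarrow> real" where
  "fock_norm \<Psi> = sqrt (\<Sum>n. (L2_norm (config n) (\<Psi> n))\<^sup>2)"

definition fock_sector :: "nat \<Rightarrow> ('d::finite) fock set" where
  "fock_sector n = {\<Psi> \<in> fock_space. \<forall>m x. m \<noteq> n \<longrightarrow> \<Psi> m x = 0}"

text \<open>
  On \<open>n\<close>-particle configurations,
  \<open>(a(f)\<Psi>)\<close> at \<open>(x\<^sub>0,\<dots>,x\<^sub>n\<^sub>-\<^sub>1)\<close> is \<open>sqrt (n+1)\<close> times the integral over \<open>y\<close> of
  \<open>cnj (f y) \<Psi>(x\<^sub>0,\<dots>,x\<^sub>n\<^sub>-\<^sub>1,y)\<close>, and \<open>(a*(g)\<Psi>)\<close> is \<open>1 / sqrt n\<close> times the sum over \<open>j\<close> of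
  \<open>g(x\<^sub>j)\<close> times \<open>\<Psi>\<close> at the configuration without \<open>x\<^sub>j\<close>.  As \<open>\<Psi>\<close> is symmetric, the remaining
  particles may be listed in any order; here the last one takes the place of the \<open>j\<close>-th.
  Both operators are unbounded: as operators in Fock space their domains consist of the vectors
  that are mapped into \<open>fock_space\<close>, and these contain all vectors of \<open>fock_sector n\<close>.\<close>

definition annihilation :: "(real^'d \<Rightarrow> complex) \<Rightarrow> ('d::finite) fock_operator" where
  "annihilation f \<Psi> n x =
     complex_of_real (sqrt (real (Suc n))) *
       (LINT y|lborel. cnj (f y) * \<Psi> (Suc n) (x(n := y)))"

definition creation :: "(real^'d \<Rightarrow> complex) \<Rightarrow> ('d::finite) fock_operator" where
  "creation g \<Psi> n x =
     (\<Sum>j<n. g (x j) * \<Psi> (n - 1) (restrict (x(j := x (n - 1))) {..<n - 1})) /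
       complex_of_real (sqrt (real n))"


section \<open>Density matrices and Fock states\<close>

definition sector_basis :: "nat \<Rightarrow> ('d::finite) fock set \<Rightarrow> bool" where
  "sector_basis n B \<longleftrightarrow>
     B \<subseteq> fock_sector n \<and>
     (\<forall>e\<in>B. \<forall>e'\<in>B. fock_inner e e' = (if e = e' then 1 else 0)) \<and>
     (\<forall>\<Psi>\<in>fock_sector n. (\<forall>e\<in>B. fock_inner e \<Psi> = 0) \<longrightarrow> fock_eq \<Psi> (\<lambda>_ _. 0))"

definition fock_basis :: "nat \<Rightarrow> ('d::finite) fock set" where
  "fock_basis n = (SOME B. sector_basis n B)"

text \<open>The trace is computed in an orthonormal basis of vectors with definite particle number,
  summing first within each \<open>n\<close>-particle space and then over \<open>n\<close>.  For trace class operators this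
  is the usual trace.  It also gives a meaning to the trace of \<open>\<rho> a*(f) a(g)\<close>, for a density
  matrix \<open>\<rho>\<close>, although \<open>a*(f) a(g)\<close> is unbounded: this operator preserves the particle number
  and is bounded on each \<open>n\<close>-particle space, so each inner sum is the trace of a trace class
  operator.  For \<open>f = g\<close> the inner sums are nonnegative, whence \<open>has_fock_trace\<close> holds for some
  finite value iff the expectation of \<open>a*(f) a(f)\<close>, with values in \<open>[0,\<infinity>]\<close>, is finite.\<close>

definition has_fock_trace :: "('d::finite) fock_operator \<Rightarrow> complex \<Rightarrow> bool" where
  "has_fock_trace T t \<longleftrightarrow>
     (\<exists>\<tau>. (\<forall>n. ((\<lambda>e. fock_inner e (T e)) has_sum \<tau> n) (fock_basis n)) \<and> \<tau> sums t)"

definition density_matrix :: "('d::finite) fock_operator \<Rightarrow> bool" where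
  "density_matrix \<rho> \<longleftrightarrow>
     (\<forall>\<Psi>\<in>fock_space. \<rho> \<Psi> \<in> fock_space) \<and>
     (\<forall>\<Psi>\<in>fock_space. \<forall>\<Phi>\<in>fock_space. \<forall>c.
        fock_eq (\<rho> (\<lambda>n x. \<Psi> n x + c * \<Phi> n x)) (\<lambda>n x. \<rho> \<Psi> n x + c * \<rho> \<Phi> n x)) \<and>
     (\<exists>C. \<forall>\<Psi>\<in>fock_space. fock_norm (\<rho> \<Psi>) \<le> C * fock_norm \<Psi>) \<and>
     (\<forall>\<Psi>\<in>fock_space. fock_inner \<Psi> (\<rho> \<Psi>) \<in> \<real>\<^sub>\<ge>\<^sub>0) \<and>
     has_fock_trace \<rho> 1"

text \<open>The second conjunct says that the expectation of \<open>A\<close> is the trace of \<open>\<rho> A\<close> whenever this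
  trace exists; the third one is the standing assumption of a finite one-particle density matrix.\<close>

definition fock_state :: "(('d::finite) fock_operator \<Rightarrow> complex) \<Rightarrow> bool" where
  "fock_state \<omega> \<longleftrightarrow>
     (\<exists>\<rho>. density_matrix \<rho> \<and>
        (\<forall>A t. has_fock_trace (\<rho> \<circ> A) t \<longrightarrow> \<omega> A = t) \<and>
        (\<forall>f\<in>L2_space lborel. \<exists>t. has_fock_trace (\<rho> \<circ> (creation f \<circ> annihilation f)) t))"

definition one_particle :: "(('d::finite) fock_operator \<Rightarrow> complex) \<Rightarrow>
    (real^'d \<Rightarrow> complex) \<Rightarrow> (real^'d \<Rightarrow> complex) \<Rightarrow> complex" where
  "one_particle \<omega> f g = \<omega> (creation f \<circ> annihilation g)"

definition occupation :: "(('d::finite) fock_operator \<Rightarrow> complex) \<Rightarrow>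
    (real^'d \<Rightarrow> complex) \<Rightarrow> real" where
  "occupation \<omega> f = Re (one_particle \<omega> f f)"


section \<open>Condensates\<close>

type_synonym 'd states = "real \<Rightarrow> 'd fock_operator \<Rightarrow> complex"

definition limsup_occupation :: "('d::finite) states \<Rightarrow> (real^'d \<Rightarrow> complex) \<Rightarrow> ereal" where
  "limsup_occupation \<omega> f = Limsup at_top (\<lambda>\<sigma>. ereal (occupation (\<omega> \<sigma>) f))"

definition regular_subspace ::
    "('d::finite) states \<Rightarrow> (real^'d) set \<Rightarrow> (real^'d \<Rightarrow> complex) set" where
  "regular_subspace \<omega> \<O> = {f \<in> L2_on \<O>. limsup_occupation \<omega> f < \<infinity>}"

definition orth_complement_on ::
    "(real^'d) set \<Rightarrow> (real^'d \<Rightarrow> complex) set \<Rightarrow> (real^'d \<Rightarrow> complex) set" where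
  "orth_complement_on \<O> S = {h \<in> L2_on \<O>. \<forall>f\<in>S. L2_inner lborel f h = 0}"

text \<open>The limit contains a proper condensate in \<open>\<O>\<close> iff this holds for some \<open>s\<close>, which is then
  unique up to a phase; all conditions imposed on \<open>s\<close> below are invariant under phase changes.\<close>

definition proper_condensate_wrt ::
    "('d::finite) states \<Rightarrow> (real^'d) set \<Rightarrow> (real^'d \<Rightarrow> complex) \<Rightarrow> bool" where
  "proper_condensate_wrt \<omega> \<O> s \<longleftrightarrow>
     L2_closed lborel (regular_subspace \<omega> \<O>) \<and>
     s \<in> L2_on \<O> - regular_subspace \<omega> \<O> \<and>
     L2_norm lborel s = 1 \<and>
     orth_complement_on \<O> (regular_subspace \<omega> \<O>) =
       {h \<in> L2_on \<O>. \<exists>c. AE x in lborel. h x = c * s x}"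

definition translate :: "real^'d \<Rightarrow> (real^'d \<Rightarrow> complex) \<Rightarrow> real^'d \<Rightarrow> complex" where
  "translate x f z = f (z - x)"

definition inside :: "(real^'d) set \<Rightarrow> (real^'d) set \<Rightarrow> bool" (infix "\<Subset>" 50) where
  "\<O>\<^sub>0 \<Subset> \<O> \<longleftrightarrow> open \<O>\<^sub>0 \<and> closure \<O>\<^sub>0 \<subseteq> \<O>"

definition condensate_lim ::
    "('d::finite) states \<Rightarrow> (real^'d \<Rightarrow> complex) \<Rightarrow> (real \<Rightarrow> complex) \<Rightarrow> complex \<Rightarrow> bool" where
  "condensate_lim \<omega> s F l \<longleftrightarrow>
     (\<forall>\<sigma> :: nat \<Rightarrow> real. (\<forall>j. \<sigma> j > 0) \<longrightarrow> filterlim \<sigma> at_top sequentially \<longrightarrow>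
        filterlim (\<lambda>j. occupation (\<omega> (\<sigma> j)) s) at_top sequentially \<longrightarrow>
        (\<lambda>j. F (\<sigma> j)) \<longlonglongrightarrow> l)"

definition homogeneous_condensate_wrt ::
    "('d::finite) states \<Rightarrow> (real^'d) set \<Rightarrow> (real^'d \<Rightarrow> complex) \<Rightarrow> bool" where
  "homogeneous_condensate_wrt \<omega> \<O> s \<longleftrightarrow>
     proper_condensate_wrt \<omega> \<O> s \<and>
     (\<forall>\<O>\<^sub>0 x. \<forall>f\<in>L2_on \<O>\<^sub>0. \<forall>g\<in>L2_on \<O>\<^sub>0. \<O>\<^sub>0 \<Subset> \<O> \<longrightarrow> (\<lambda>z. z + x) ` \<O>\<^sub>0 \<Subset> \<O> \<longrightarrow>
        condensate_lim \<omega> s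
          (\<lambda>\<sigma>. one_particle (\<omega> \<sigma>) (translate x f) (translate x g)
                 / complex_of_real (occupation (\<omega> \<sigma>) s))
          (L2_inner lborel s f * L2_inner lborel g s))"

definition has_momentum ::
    "(real^'d) set \<Rightarrow> (real^'d \<Rightarrow> complex) \<Rightarrow> real^'d \<Rightarrow> bool" where
  "has_momentum \<O> s p \<longleftrightarrow>
     (\<exists>c. cmod c = 1 \<and>
        (AE x in lborel. x \<in> \<O> \<longrightarrow>
           s x = c * complex_of_real (measure lborel \<O> powr (- 1 / 2)) * cis (x \<bullet> p)))"

definition homogeneous_condensate_with_momentum ::
    "('d::finite) states \<Rightarrow> (real^'d) set \<Rightarrow> real^'d \<Rightarrow> bool" where
  "homogeneous_condensate_with_momentum \<omega> \<O> p \<longleftrightarrow>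
     (\<exists>s. homogeneous_condensate_wrt \<omega> \<O> s \<and> has_momentum \<O> s p)"

end

theory Submission
  imports Defs
begin

text \<open>
  The one-particle density matrix of a Fock state is a positive sesquilinear form, so the regular
  functions form a subspace.  In the limit of a condensate with zero momentum the regular subspace
  is closed and the constants span its orthogonal complement, hence it equals the space of functions
  with mean zero.  Conversely, if all functions with mean zero are regular, then a single singular function
  makes every function with nonzero mean singular, so the regular subspace is exactly the space
  of functions with mean zero; the Cauchy-Schwarz inequality then shows that only the components
  along the constant mode survive after division by its occupation number, and these components
  are translation invariant.

  Positivity of the form is the delicate point, since the trace is a sum over a fixed basis whose
  terms need not be nonnegative.
\<close>

section \<open>Positive forms and square-integrable functions\<close>

text \<open>The usual proof that the trace of \<rho> N is nonnegative rewrites it as the trace of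
  sqrt(\<rho>) N sqrt(\<rho>), which needs operator square roots and cyclicity of the trace;
  \<open>has_fock_trace\<close> offers only unconditional sums of diagonal elements in one fixed
  basis. The detour used here needs finitely many vectors at a time: on a finite set
  \<open>F\<close> of basis vectors the form of \<rho> agrees with a finite sum of rank one forms
  given by vectors \<open>v k\<close>. The partial trace is then a sum of nonnegative numbers
  \<open>t (v k) (v k)\<close>, up to an error that vanishes with the tail of the trace of \<rho>.
  All this happens within one n-particle space, where
  \<open>creation f \<circ> annihilation f\<close> is bounded. Since \<open>fock_state\<close>
  guarantees traces only for equal arguments \<open>f\<close>, the sesquilinearity of the
  one-particle density matrix rests on polarization. Vectors are functions and not classes of
  functions, so subspaces are sets of functions closed under linear combinations, and
  \<open>positive_form\<close> admits degenerate forms. One Cauchy-Schwarz inequality thus serves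
  scalar products, density matrices and occupation numbers.\<close>

locale positive_form =
  fixes V :: "('a \<Rightarrow> complex) set" and q :: "('a \<Rightarrow> complex) \<Rightarrow> ('a \<Rightarrow> complex) \<Rightarrow> complex"
  assumes zero_mem: "(\<lambda>_. 0) \<in> V"
    and lin_mem: "\<And>f g c. f \<in> V \<Longrightarrow> g \<in> V \<Longrightarrow> (\<lambda>x. f x + c * g x) \<in> V"
    and lin_right: "\<And>f g h c. f \<in> V \<Longrightarrow> g \<in> V \<Longrightarrow> h \<in> V \<Longrightarrow>
          q f (\<lambda>x. g x + c * h x) = q f g + c * q f h"
    and hermitian: "\<And>f g. f \<in> V \<Longrightarrow> g \<in> V \<Longrightarrow> q g f = cnj (q f g)"
    and nonneg: "\<And>f. f \<in> V \<Longrightarrow> 0 \<le> Re (q f f)"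
begin

lemma lin_left:
  assumes "f \<in> V" "g \<in> V" "h \<in> V"
  shows "q (\<lambda>x. g x + c * h x) f = q g f + cnj c * q h f"
proof -
  have "q (\<lambda>x. g x + c * h x) f = cnj (q f (\<lambda>x. g x + c * h x))"
    using assms by (intro hermitian lin_mem)
  also have "\<dots> = cnj (q f g) + cnj c * cnj (q f h)"
    using assms by (simp add: lin_right)
  finally show ?thesis using assms hermitian by metis
qed

lemma scale_mem: "f \<in> V \<Longrightarrow> (\<lambda>x. c * f x) \<in> V"
  using lin_mem[OF zero_mem, of f c] by simp

lemma diff_mem: "f \<in> V \<Longrightarrow> g \<in> V \<Longrightarrow> (\<lambda>x. f x - g x) \<in> V"
  using lin_mem[of f g "-1"] by simp

lemma zero_right: "f \<in> V \<Longrightarrow> q f (\<lambda>_. 0) = 0"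
  using lin_right[of f "\<lambda>_. 0" "\<lambda>_. 0" 1] zero_mem by simp

lemma scale_right: "f \<in> V \<Longrightarrow> g \<in> V \<Longrightarrow> q f (\<lambda>x. c * g x) = c * q f g"
  using lin_right[of f "\<lambda>_. 0" g c] zero_mem zero_right by simp

lemma diff_right: "f \<in> V \<Longrightarrow> g \<in> V \<Longrightarrow> h \<in> V \<Longrightarrow> q f (\<lambda>x. g x - h x) = q f g - q f h"
  using lin_right[of f g h "-1"] by simp

lemma scale_left: "f \<in> V \<Longrightarrow> g \<in> V \<Longrightarrow> q (\<lambda>x. c * g x) f = cnj c * q g f"
  using hermitian[of f "\<lambda>x. c * g x"] hermitian[of f g] scale_right[of f g c] scale_mem by simp

lemma diff_left: "f \<in> V \<Longrightarrow> g \<in> V \<Longrightarrow> h \<in> V \<Longrightarrow> q (\<lambda>x. g x - h x) f = q g f - q h f"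
  using lin_left[of f g h "-1"] by simp

lemma sum_mem: "(\<And>k. k \<in> K \<Longrightarrow> v k \<in> V) \<Longrightarrow> (\<lambda>x. \<Sum>k\<in>K. c k * v k x) \<in> V"
proof (induction K rule: infinite_finite_induct)
  case (insert i K)
  then show ?case using lin_mem[of "\<lambda>x. \<Sum>k\<in>K. c k * v k x" "v i" "c i"]
    by (simp add: add.commute)
qed (auto simp: zero_mem)

lemma sum_right:
  "f \<in> V \<Longrightarrow> (\<And>k. k \<in> K \<Longrightarrow> v k \<in> V) \<Longrightarrow>
    q f (\<lambda>x. \<Sum>k\<in>K. c k * v k x) = (\<Sum>k\<in>K. c k * q f (v k))"
proof (induction K rule: infinite_finite_induct)
  case (insert i K)
  then show ?case using lin_right[of f "\<lambda>x. \<Sum>k\<in>K. c k * v k x" "v i" "c i"] sum_mem[of K v c]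
    by (simp add: add.commute)
qed (auto simp: zero_right)

lemma self_real: "f \<in> V \<Longrightarrow> q f f = of_real (Re (q f f))"
  using hermitian[of f f] by (simp add: complex_eq_iff)

lemma scale_self: "f \<in> V \<Longrightarrow> Re (q (\<lambda>x. c * f x) (\<lambda>x. c * f x)) = (cmod c)\<^sup>2 * Re (q f f)"
proof -
  assume f: "f \<in> V"
  have "q (\<lambda>x. c * f x) (\<lambda>x. c * f x) = (c * cnj c) * q f f"
    using f by (simp add: scale_left scale_right scale_mem)
  also have "\<dots> = of_real ((cmod c)\<^sup>2) * q f f" by (simp only: complex_norm_square)
  finally show ?thesis by simp
qed

lemma diff_self:
  assumes "f \<in> V" "g \<in> V"
  shows "Re (q (\<lambda>x. f x - g x) (\<lambda>x. f x - g x)) = Re (q f f) - 2 * Re (q f g) + Re (q g g)"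
proof -
  have "q (\<lambda>x. f x - g x) (\<lambda>x. f x - g x) = (q f f - q f g) - (q g f - q g g)"
    using assms by (simp add: diff_left diff_right diff_mem)
  then show ?thesis using hermitian[OF assms] by simp
qed

lemma diff_scale_self:
  assumes "f \<in> V" "g \<in> V"
  shows "Re (q (\<lambda>x. f x - c * g x) (\<lambda>x. f x - c * g x)) =
           Re (q f f) - 2 * Re (c * q f g) + (cmod c)\<^sup>2 * Re (q g g)"
  using diff_self[OF assms(1) scale_mem[OF assms(2)], of c] assms
  by (simp add: scale_right scale_self)

text \<open>The mixed terms of \<open>f + c g\<close> and \<open>f - c g\<close> cancel, and the
  form is nonnegative at the latter. The estimate takes the place of a triangle inequality.\<close>

lemma lin_self_le:
  assumes "f \<in> V" "g \<in> V"
  shows "Re (q (\<lambda>x. f x + c * g x) (\<lambda>x. f x + c * g x)) \<le> 2 * Re (q f f) + 2 * (cmod c)\<^sup>2 * Re (q g g)"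
  using nonneg[OF lin_mem[OF assms, of "-c"]] diff_scale_self[OF assms, of c] diff_scale_self[OF assms, of "-c"]
  by (simp add: algebra_simps)

text \<open>Along the line of multiples of \<open>g\<close> in a suitable direction the form is a
  nonnegative quadratic polynomial in a real parameter \<open>t\<close>. As \<open>q\<close> may be
  degenerate, the case without quadratic term is treated separately.\<close>

lemma Cauchy_Schwarz:
  assumes f: "f \<in> V" and g: "g \<in> V"
  shows "(cmod (q f g))\<^sup>2 \<le> Re (q f f) * Re (q g g)"
proof -
  let ?z = "q f g" and ?a = "Re (q f f)" and ?b = "Re (q g g)"
  have key: "0 \<le> ?a - 2 * t * (cmod ?z)\<^sup>2 + t\<^sup>2 * (cmod ?z)\<^sup>2 * ?b" for t :: real
  proof -
    \<comment> \<open>The factor \<open>cnj ?z\<close> makes the mixed term real, so a real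
      parameter suffices.\<close>
    let ?c = "of_real t * cnj ?z"
    have "0 \<le> Re (q (\<lambda>x. f x - ?c * g x) (\<lambda>x. f x - ?c * g x))"
      using nonneg[OF lin_mem[OF f g, of "- ?c"]] by simp
    moreover have "?c * ?z = of_real (t * (cmod ?z)\<^sup>2)"
      using complex_norm_square[of ?z] by (simp add: mult.commute mult.left_commute)
    ultimately show ?thesis
      using diff_scale_self[OF f g, of ?c] by (simp add: norm_mult power_mult_distrib)
  qed
  show ?thesis
  proof (cases "?b = 0")
    case True
    have "?z = 0"
    proof (rule ccontr)
      assume "?z \<noteq> 0"
      then have p: "(cmod ?z)\<^sup>2 > 0" by simp
      \<comment> \<open>Without a quadratic term the polynomial is affine in \<open>t\<close>; this
        \<open>t\<close> is chosen to give it the value -1.\<close>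
      have "0 \<le> ?a - 2 * ((?a + 1) / (2 * (cmod ?z)\<^sup>2)) * (cmod ?z)\<^sup>2"
        using key[of "(?a + 1) / (2 * (cmod ?z)\<^sup>2)"] True by simp
      then show False using p by (simp add: field_simps)
    qed
    then show ?thesis using True by simp
  next
    case False
    with nonneg[OF g] have b: "?b > 0" by simp
    \<comment> \<open>The minimum of the polynomial is attained at
      \<open>t = 1 / ?b\<close>.\<close>
    have "0 \<le> ?a - (cmod ?z)\<^sup>2 / ?b"
      using key[of "1 / ?b"] b by (simp add: power2_eq_square field_simps)
    then show ?thesis using b by (simp add: field_simps)
  qed
qed

lemma Cauchy_Schwarz_sqrt:
  assumes "f \<in> V" "g \<in> V"
  shows "cmod (q f g) \<le> sqrt (Re (q f f)) * sqrt (Re (q g g))"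
  using real_le_rsqrt[OF Cauchy_Schwarz[OF assms]] by (simp add: real_sqrt_mult)

lemma subset:
  assumes "W \<subseteq> V" "(\<lambda>_. 0) \<in> W" "\<And>f g c. f \<in> W \<Longrightarrow> g \<in> W \<Longrightarrow> (\<lambda>x. f x + c * g x) \<in> W"
  shows "positive_form W q"
proof
  fix f g assume "f \<in> W" "g \<in> W"
  then show "q g f = cnj (q f g)" using assms(1) by (intro hermitian) auto
qed (use assms lin_right nonneg in \<open>auto simp: subset_iff\<close>)

end

section \<open>Scalar product and norm of square-integrable functions\<close>

lemma L2_space_measurable: "f \<in> L2_space M \<Longrightarrow> f \<in> borel_measurable M"
  by (simp add: L2_space_def)

lemma L2_space_iff_nn_integral:
  "f \<in> L2_space M \<longleftrightarrow> f \<in> borel_measurable M \<and> (\<integral>\<^sup>+x. ennreal ((cmod (f x))\<^sup>2) \<partial>M) < \<infinity>"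
  unfolding L2_space_def by (auto simp: integrable_iff_bounded)

lemma L2_integrable_mult:
  assumes f: "f \<in> L2_space M" and g: "g \<in> L2_space M"
  shows "integrable M (\<lambda>x. f x * g x)"
proof (rule Bochner_Integration.integrable_bound)
  show "integrable M (\<lambda>x. (cmod (f x))\<^sup>2 + (cmod (g x))\<^sup>2)"
    using f g by (simp add: L2_space_def)
  show "(\<lambda>x. f x * g x) \<in> borel_measurable M"
    using f g by (auto simp: L2_space_def)
  have "a * b \<le> a\<^sup>2 + b\<^sup>2" if "a \<ge> 0" "b \<ge> 0" for a b :: real
  proof -
    have "0 \<le> (a - b)\<^sup>2" and "0 \<le> a * b" using that by auto
    then show ?thesis unfolding power2_diff by linarith
  qed
  then show "AE x in M. norm (f x * g x) \<le> norm ((cmod (f x))\<^sup>2 + (cmod (g x))\<^sup>2)"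
    by (simp add: norm_mult)
qed

lemma measurable_cnj[measurable (raw)]:
  assumes "f \<in> borel_measurable M"
  shows "(\<lambda>x. cnj (f x)) \<in> borel_measurable M"
  using assms by (rule measurable_compose) (intro borel_measurable_continuous_onI continuous_intros)

lemma L2_cnj: "f \<in> L2_space M \<Longrightarrow> (\<lambda>x. cnj (f x)) \<in> L2_space M"
  by (auto simp: L2_space_def)

lemma L2_integrable_inner:
  "f \<in> L2_space M \<Longrightarrow> g \<in> L2_space M \<Longrightarrow> integrable M (\<lambda>x. cnj (f x) * g x)"
  by (intro L2_integrable_mult L2_cnj)

lemma L2_lin_mem:
  assumes f: "f \<in> L2_space M" and g: "g \<in> L2_space M"
  shows "(\<lambda>x. f x + c * g x) \<in> L2_space M"
proof -
  have "integrable M (\<lambda>x. (cmod (f x + c * g x))\<^sup>2)"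
  proof (rule Bochner_Integration.integrable_bound)
    show "integrable M (\<lambda>x. 2 * (cmod (f x))\<^sup>2 + 2 * (cmod c)\<^sup>2 * (cmod (g x))\<^sup>2)"
      using f g by (simp add: L2_space_def)
    show "(\<lambda>x. (cmod (f x + c * g x))\<^sup>2) \<in> borel_measurable M"
      using f g by (auto simp: L2_space_def)
    have "(cmod (a + b))\<^sup>2 \<le> 2 * (cmod a)\<^sup>2 + 2 * (cmod b)\<^sup>2" for a b
    proof -
      have "(cmod (a + b))\<^sup>2 \<le> (cmod a + cmod b)\<^sup>2"
        by (intro power_mono norm_triangle_ineq) auto
      moreover have "0 \<le> (cmod a - cmod b)\<^sup>2" by simp
      ultimately show ?thesis unfolding power2_diff power2_sum by linarith
    qed
    from this[of "f _" "c * g _"]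
    show "AE x in M. norm ((cmod (f x + c * g x))\<^sup>2) \<le> norm (2 * (cmod (f x))\<^sup>2 + 2 * (cmod c)\<^sup>2 * (cmod (g x))\<^sup>2)"
      by (simp add: norm_mult power_mult_distrib mult.assoc)
  qed
  then show ?thesis using f g by (auto simp: L2_space_def)
qed

lemma L2_zero_mem: "(\<lambda>_. 0) \<in> L2_space M"
  by (simp add: L2_space_def)

lemma L2_inner_self: "L2_inner M f f = of_real ((L2_norm M f)\<^sup>2)"
proof -
  have "L2_inner M f f = (LINT x|M. complex_of_real ((cmod (f x))\<^sup>2))"
    unfolding L2_inner_def by (intro Bochner_Integration.integral_cong refl)
      (simp only: complex_norm_square mult.commute)
  also have "\<dots> = of_real (LINT x|M. (cmod (f x))\<^sup>2)" by (rule integral_complex_of_real)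
  finally show ?thesis by (simp add: L2_norm_def)
qed

lemma L2_inner_cnj: "L2_inner M g f = cnj (L2_inner M f g)"
proof -
  have "cnj (L2_inner M f g) = (LINT x|M. cnj (cnj (f x) * g x))"
    unfolding L2_inner_def by (simp only: Bochner_Integration.integral_cnj)
  then show ?thesis unfolding L2_inner_def by (simp add: mult.commute)
qed

lemma L2_positive_form: "positive_form (L2_space M) (L2_inner M)"
proof
  fix f g h :: "'a \<Rightarrow> complex" and c
  assume "f \<in> L2_space M" "g \<in> L2_space M" "h \<in> L2_space M"
  then have "integrable M (\<lambda>x. cnj (f x) * g x)" "integrable M (\<lambda>x. cnj (f x) * h x)"
    by (auto intro: L2_integrable_inner)
  then show "L2_inner M f (\<lambda>x. g x + c * h x) = L2_inner M f g + c * L2_inner M f h"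
    unfolding L2_inner_def by (simp add: algebra_simps)
qed (auto simp: L2_zero_mem L2_lin_mem L2_inner_cnj[symmetric] L2_inner_self)

lemma L2_norm_nonneg: "0 \<le> L2_norm M f"
  by (simp add: L2_norm_def)

lemma Re_L2_inner_self: "Re (L2_inner M f f) = (L2_norm M f)\<^sup>2"
  by (simp add: L2_inner_self)

lemma L2_Cauchy_Schwarz:
  assumes "f \<in> L2_space M" "g \<in> L2_space M"
  shows "cmod (L2_inner M f g) \<le> L2_norm M f * L2_norm M g"
  using positive_form.Cauchy_Schwarz_sqrt[OF L2_positive_form assms]
  by (simp add: Re_L2_inner_self L2_norm_nonneg)

lemma nn_integral_L2_norm:
  assumes "f \<in> L2_space M"
  shows "(\<integral>\<^sup>+x. ennreal ((cmod (f x))\<^sup>2) \<partial>M) = ennreal ((L2_norm M f)\<^sup>2)"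
  using assms unfolding L2_norm_def L2_space_def
  by (simp add: nn_integral_eq_integral)

lemma L2_norm_eq_0_iff:
  assumes "f \<in> L2_space M"
  shows "L2_norm M f = 0 \<longleftrightarrow> (AE x in M. f x = 0)"
proof -
  have "L2_norm M f = 0 \<longleftrightarrow> (LINT x|M. (cmod (f x))\<^sup>2) = 0" by (simp add: L2_norm_def)
  also have "\<dots> \<longleftrightarrow> (AE x in M. (cmod (f x))\<^sup>2 = 0)"
    using assms by (intro integral_nonneg_eq_0_iff_AE) (auto simp: L2_space_def)
  finally show ?thesis by simp
qed

lemma L2_inner_AE_cong:
  assumes "f \<in> L2_space M" "f' \<in> L2_space M" "g \<in> L2_space M" "g' \<in> L2_space M"
    and "AE x in M. f x = f' x" "AE x in M. g x = g' x"
  shows "L2_inner M f g = L2_inner M f' g'"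
  unfolding L2_inner_def
proof (rule integral_cong_AE)
  show "AE x in M. cnj (f x) * g x = cnj (f' x) * g' x" using assms(5,6) by eventually_elim simp
qed (use assms in \<open>auto simp: L2_space_def\<close>)

lemma L2_norm_AE_cong:
  assumes "f \<in> L2_space M" "g \<in> L2_space M" "AE x in M. f x = g x"
  shows "L2_norm M f = L2_norm M g"
proof -
  have "L2_inner M f f = L2_inner M g g" using assms by (intro L2_inner_AE_cong)
  then have "(L2_norm M f)\<^sup>2 = (L2_norm M g)\<^sup>2" by (metis Re_L2_inner_self)
  then show ?thesis using L2_norm_nonneg by (meson power2_eq_iff_nonneg)
qed

lemma L2_diff_mem: "f \<in> L2_space M \<Longrightarrow> g \<in> L2_space M \<Longrightarrow> (\<lambda>x. f x - g x) \<in> L2_space M"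
  using L2_positive_form by (rule positive_form.diff_mem)

lemma L2_norm_diff_commute: "L2_norm M (\<lambda>x. f x - g x) = L2_norm M (\<lambda>x. g x - f x)"
  by (simp add: L2_norm_def norm_minus_commute)

lemma L2_norm_le_imp_nn_integral_le:
  assumes "f \<in> L2_space M" "L2_norm M f \<le> e"
  shows "(\<integral>\<^sup>+x. ennreal ((cmod (f x))\<^sup>2) \<partial>M) \<le> ennreal (e\<^sup>2)"
  using assms by (simp add: nn_integral_L2_norm power_mono L2_norm_nonneg)

section \<open>Completeness and orthogonal projection\<close>

text \<open>The measure may be infinite, so bounds on L2 norms do not control the integrals of the
  increments d_k themselves. The weighted sum of 2^k |d_k|^2 has finite integral because 2^k (1/4)^k
  is summable, and 2 |d_k| \<le> (1/2)^k + 2^k |d_k|^2 then gives absolute convergence at almost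
  every point.\<close>

lemma L2_AE_convergent:
  assumes u: "\<And>k. u k \<in> L2_space M"
    and small: "\<And>k. L2_norm M (\<lambda>x. u (Suc k) x - u k x) \<le> (1/2) ^ k"
  shows "AE x in M. convergent (\<lambda>k. u k x)"
proof -
  have [measurable]: "u k \<in> borel_measurable M" for k
    using u by (rule L2_space_measurable)
  let ?a = "\<lambda>k x. ennreal (2 ^ k * (cmod (u (Suc k) x - u k x))\<^sup>2)"
  have "(\<integral>\<^sup>+x. (\<Sum>k. ?a k x) \<partial>M) = (\<Sum>k. \<integral>\<^sup>+x. ?a k x \<partial>M)"
    by (rule nn_integral_suminf) measurable
  also have "\<dots> \<le> (\<Sum>k. ennreal ((1/2) ^ k))"
  proof (intro suminf_le allI)
    fix k
    have "(\<integral>\<^sup>+x. ?a k x \<partial>M) = ennreal (2 ^ k) * (\<integral>\<^sup>+x. ennreal ((cmod (u (Suc k) x - u k x))\<^sup>2) \<partial>M)"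
      by (simp add: ennreal_mult nn_integral_cmult)
    also have "\<dots> \<le> ennreal (2 ^ k) * ennreal (((1/2) ^ k)\<^sup>2)"
      by (intro mult_left_mono L2_norm_le_imp_nn_integral_le L2_diff_mem u small) auto
    also have "\<dots> = ennreal ((1/2) ^ k)"
      by (simp add: ennreal_mult[symmetric] power2_eq_square power_divide)
    finally show "(\<integral>\<^sup>+x. ?a k x \<partial>M) \<le> ennreal ((1/2) ^ k)" .
  qed (rule summableI)+
  also have "\<dots> < \<infinity>"
    by (subst suminf_ennreal2) (auto intro: summable_geometric)
  finally have fin: "(\<integral>\<^sup>+x. (\<Sum>k. ?a k x) \<partial>M) \<noteq> \<infinity>" by simp
  have "AE x in M. (\<Sum>k. ?a k x) \<noteq> \<infinity>"
    by (rule nn_integral_noteq_infinite[OF _ fin]) measurable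
  then show ?thesis
  proof eventually_elim
    case (elim x)
    let ?d = "\<lambda>k. u (Suc k) x - u k x"
    have summ: "summable (\<lambda>k. 2 ^ k * (cmod (?d k))\<^sup>2)"
      using elim by (intro summable_suminf_not_top) auto
    have "summable (\<lambda>k. cmod (?d k))"
    proof (rule summable_comparison_test')
      show "summable (\<lambda>k. (1/2) ^ k + 2 ^ k * (cmod (?d k))\<^sup>2)"
        by (intro summable_add summ) (simp add: summable_geometric)
      fix k :: nat
      have "0 \<le> (2 ^ k * cmod (?d k) - 1)\<^sup>2" by simp
      then have "2 * (2 ^ k * cmod (?d k)) \<le> 1 + 2 ^ k * (2 ^ k * (cmod (?d k))\<^sup>2)"
        unfolding power2_eq_square by (simp add: algebra_simps)
      then have "2 * (2 ^ k * cmod (?d k)) \<le> 2 ^ k * ((1/2) ^ k + 2 ^ k * (cmod (?d k))\<^sup>2)"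
        by (simp add: algebra_simps power_divide)
      then have "2 * cmod (?d k) \<le> (1/2) ^ k + 2 ^ k * (cmod (?d k))\<^sup>2"
        by (simp add: mult.left_commute)
      then show "norm (cmod (?d k)) \<le> (1/2) ^ k + 2 ^ k * (cmod (?d k))\<^sup>2"
        using norm_ge_zero[of "?d k"] unfolding real_norm_def abs_norm_cancel by linarith
    qed
    then have "summable ?d" by (rule summable_norm_cancel)
    then have "convergent (\<lambda>n. \<Sum>k<n. ?d k)" by (simp add: summable_iff_convergent)
    moreover have "(\<Sum>k<n. ?d k) = u n x - u 0 x" for n
      by (rule sum_lessThan_telescope)
    ultimately have "convergent (\<lambda>n. u n x - u 0 x)" by simp
    then have "convergent (\<lambda>n. (u n x - u 0 x) + u 0 x)"
      by (intro convergent_add convergent_const)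
    then show ?case by simp
  qed
qed

text \<open>Riesz-Fischer: the limit is taken pointwise along a rapidly converging subsequence, and
  Fatou's lemma transfers the Cauchy bounds to it.\<close>

theorem L2_complete:
  assumes F: "\<And>k. F k \<in> L2_space M"
    and Cauchy: "\<And>e. e > 0 \<Longrightarrow> \<exists>N. \<forall>k\<ge>N. \<forall>l\<ge>N. L2_norm M (\<lambda>x. F k x - F l x) \<le> e"
  obtains h where "h \<in> L2_space M" "(\<lambda>k. L2_norm M (\<lambda>x. F k x - h x)) \<longlonglongrightarrow> 0"
proof -
  have [measurable]: "F k \<in> borel_measurable M" for k
    using F by (rule L2_space_measurable)
  have "\<forall>j. \<exists>N. \<forall>k\<ge>N. \<forall>l\<ge>N. L2_norm M (\<lambda>x. F k x - F l x) \<le> (1/2) ^ j"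
    by (intro allI Cauchy) simp
  then obtain N where N: "\<And>j k l. k \<ge> N j \<Longrightarrow> l \<ge> N j \<Longrightarrow> L2_norm M (\<lambda>x. F k x - F l x) \<le> (1/2) ^ j"
    by metis
  \<comment> \<open>The sum makes \<open>r\<close> monotone and keeps it above every
    \<open>N j\<close>; the summand \<open>j\<close> makes it tend to infinity.\<close>
  define r where "r j = j + (\<Sum>i\<le>j. N i)" for j
  have rN: "N j \<le> r j" for j
    using member_le_sum[of j "{..j}" N] by (simp add: r_def)
  have rS: "r j \<le> r (Suc j)" and rj: "j \<le> r j" for j by (simp_all add: r_def)
  have "AE x in M. convergent (\<lambda>j. F (r j) x)"
  proof (rule L2_AE_convergent[of "\<lambda>j. F (r j)"])
    show "L2_norm M (\<lambda>x. F (r (Suc j)) x - F (r j) x) \<le> (1/2) ^ j" for j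
      using rN[of j] rS[of j] by (intro N) auto
  qed (rule F)
  moreover define h where "h x = lim (\<lambda>j. F (r j) x)" for x
  ultimately have lim: "AE x in M. (\<lambda>j. F (r j) x) \<longlonglongrightarrow> h x"
    by (simp add: convergent_LIMSEQ_iff)
  have [measurable]: "h \<in> borel_measurable M" unfolding h_def by measurable
  \<comment> \<open>Fatou's lemma along the subsequence. The bound \<open>le\<close> is available
    only from \<open>K\<close> on, hence the index shift by \<open>K\<close>.\<close>
  have bound: "(\<integral>\<^sup>+x. ennreal ((cmod (F k x - h x))\<^sup>2) \<partial>M) \<le> ennreal (e\<^sup>2)"
    if le: "\<And>j. j \<ge> K \<Longrightarrow> L2_norm M (\<lambda>x. F k x - F (r j) x) \<le> e" for k K e
  proof -
    have "(\<integral>\<^sup>+x. ennreal ((cmod (F k x - h x))\<^sup>2) \<partial>M)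
        = (\<integral>\<^sup>+x. liminf (\<lambda>j. ennreal ((cmod (F k x - F (r (j + K)) x))\<^sup>2)) \<partial>M)"
    proof (rule nn_integral_cong_AE, use lim in eventually_elim)
      fix x assume "(\<lambda>j. F (r j) x) \<longlonglongrightarrow> h x"
      then have "(\<lambda>j. F (r (j + K)) x) \<longlonglongrightarrow> h x" by (rule LIMSEQ_ignore_initial_segment)
      then have "(\<lambda>j. ennreal ((cmod (F k x - F (r (j + K)) x))\<^sup>2)) \<longlonglongrightarrow> ennreal ((cmod (F k x - h x))\<^sup>2)"
        by (intro tendsto_ennrealI tendsto_intros)
      then show "ennreal ((cmod (F k x - h x))\<^sup>2) = liminf (\<lambda>j. ennreal ((cmod (F k x - F (r (j + K)) x))\<^sup>2))"
        by (intro lim_imp_Liminf[symmetric]) auto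
    qed
    also have "\<dots> \<le> liminf (\<lambda>j. \<integral>\<^sup>+x. ennreal ((cmod (F k x - F (r (j + K)) x))\<^sup>2) \<partial>M)"
      by (rule nn_integral_liminf) measurable
    also have "\<dots> \<le> liminf (\<lambda>j::nat. ennreal (e\<^sup>2))"
      by (intro Liminf_mono always_eventually allI L2_norm_le_imp_nn_integral_le L2_diff_mem F le) auto
    also have "\<dots> = ennreal (e\<^sup>2)" by (simp add: Liminf_const)
    finally show ?thesis .
  qed
  \<comment> \<open>Square-integrability of \<open>h\<close> itself is obtained from that of its
    distance to one member of the sequence.\<close>
  have diff: "(\<lambda>x. F (r 0) x - h x) \<in> L2_space M"
  proof -
    have "(\<integral>\<^sup>+x. ennreal ((cmod (F (r 0) x - h x))\<^sup>2) \<partial>M) \<le> ennreal (1\<^sup>2)"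
    proof (rule bound[of 0])
      fix j :: nat
      have "r 0 \<ge> N 0" "r j \<ge> N 0" using rN[of 0] lift_Suc_mono_le[of r 0 j, OF rS] by auto
      then show "L2_norm M (\<lambda>x. F (r 0) x - F (r j) x) \<le> 1" using N[of 0 "r 0" "r j"] by simp
    qed
    then show ?thesis by (auto simp: L2_space_iff_nn_integral elim: le_less_trans)
  qed
  have h: "h \<in> L2_space M" using L2_diff_mem[OF F[of "r 0"] diff] by simp
  have "(\<lambda>k. L2_norm M (\<lambda>x. F k x - h x)) \<longlonglongrightarrow> 0"
  proof (rule LIMSEQ_I)
    fix e :: real assume e: "e > 0"
    then obtain K where K: "\<And>k l. k \<ge> K \<Longrightarrow> l \<ge> K \<Longrightarrow> L2_norm M (\<lambda>x. F k x - F l x) \<le> e / 2"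
      using Cauchy[of "e / 2"] by auto
    show "\<exists>K. \<forall>k\<ge>K. norm (L2_norm M (\<lambda>x. F k x - h x) - 0) < e"
    proof (intro exI allI impI)
      fix k assume k: "k \<ge> K"
      have "(\<integral>\<^sup>+x. ennreal ((cmod (F k x - h x))\<^sup>2) \<partial>M) \<le> ennreal ((e/2)\<^sup>2)"
      proof (rule bound[of K])
        fix j assume "K \<le> j"
        then have "K \<le> r j" using rj[of j] by simp
        then show "L2_norm M (\<lambda>x. F k x - F (r j) x) \<le> e / 2" using K k by simp
      qed
      then have "ennreal ((L2_norm M (\<lambda>x. F k x - h x))\<^sup>2) \<le> ennreal ((e/2)\<^sup>2)"
        by (simp add: nn_integral_L2_norm L2_diff_mem F h)
      then have "L2_norm M (\<lambda>x. F k x - h x) \<le> e / 2"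
        using e by (simp add: ennreal_le_iff abs_le_square_iff[symmetric] L2_norm_nonneg)
      then show "norm (L2_norm M (\<lambda>x. F k x - h x) - 0) < e"
        using e L2_norm_nonneg[of M "\<lambda>x. F k x - h x"] by simp
    qed
  qed
  with h show thesis by (rule that)
qed

lemma L2_norm_diff_scale:
  assumes "f \<in> L2_space M" "g \<in> L2_space M"
  shows "(L2_norm M (\<lambda>x. f x - c * g x))\<^sup>2 =
    (L2_norm M f)\<^sup>2 - 2 * Re (c * L2_inner M f g) + (cmod c)\<^sup>2 * (L2_norm M g)\<^sup>2"
  using positive_form.diff_scale_self[OF L2_positive_form assms, of c] by (simp add: Re_L2_inner_self)

text \<open>\<open>S\<close> is a subspace that need not be closed, so the projection
  \<open>h\<close> is delivered as a limit of elements \<open>F k\<close> of \<open>S\<close>. An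
  element whose squared distance to \<open>f\<close> is within 1/(k+1) of the infimum leaves a
  residual that is orthogonal to \<open>S\<close> up to \<open>\<delta> k\<close>; this
  near-orthogonality makes the sequence Cauchy and becomes exact in the limit.\<close>

theorem L2_projection:
  assumes S: "S \<subseteq> L2_space M" "(\<lambda>_. 0) \<in> S"
    and lin: "\<And>f g c. f \<in> S \<Longrightarrow> g \<in> S \<Longrightarrow> (\<lambda>x. f x + c * g x) \<in> S"
    and f: "f \<in> L2_space M"
  obtains F h where "\<And>k::nat. F k \<in> S" "h \<in> L2_space M"
    "(\<lambda>k. L2_norm M (\<lambda>x. F k x - h x)) \<longlonglongrightarrow> 0"
    "\<And>s. s \<in> S \<Longrightarrow> L2_inner M s (\<lambda>x. f x - h x) = 0"
proof -
  interpret L: positive_form "L2_space M" "L2_inner M" by (rule L2_positive_form)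
  let ?D = "(\<lambda>s. (L2_norm M (\<lambda>x. f x - s x))\<^sup>2) ` S"
  define d where "d = Inf ?D"
  have bdd: "bdd_below ?D" by (rule bdd_belowI[of _ 0]) auto
  have d_le: "d \<le> (L2_norm M (\<lambda>x. f x - s x))\<^sup>2" if "s \<in> S" for s
    unfolding d_def using bdd that by (auto intro: cInf_lower)
  have "\<exists>s\<in>S. (L2_norm M (\<lambda>x. f x - s x))\<^sup>2 < d + e" if "e > 0" for e
  proof -
    have "Inf ?D < d + e" using that by (simp add: d_def)
    then show ?thesis using S(2) by (subst (asm) cInf_less_iff[OF _ bdd]) auto
  qed
  then have "\<forall>k. \<exists>s\<in>S. (L2_norm M (\<lambda>x. f x - s x))\<^sup>2 < d + 1 / real (Suc k)" by simp
  then obtain F where F: "\<And>k. F k \<in> S"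
    and Fd: "\<And>k. (L2_norm M (\<lambda>x. f x - F k x))\<^sup>2 < d + 1 / real (Suc k)" by metis
  have FL: "F k \<in> L2_space M" for k using F S(1) by auto
  define \<delta> where "\<delta> k = 1 / sqrt (real (Suc k))" for k
  have almost_orth: "cmod (L2_inner M s (\<lambda>x. f x - F k x)) \<le> L2_norm M s * \<delta> k" if s: "s \<in> S" for s k
  proof -
    let ?r = "\<lambda>x. f x - F k x"
    have sL: "s \<in> L2_space M" and rL: "?r \<in> L2_space M" using s S(1) f FL by (auto intro: L2_diff_mem)
    let ?z = "L2_inner M s ?r" and ?N = "(L2_norm M s)\<^sup>2"
    show ?thesis
    proof (cases "L2_norm M s = 0")
      case True
      then show ?thesis using L2_Cauchy_Schwarz[OF sL rL] by simp
    next
      case False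
      then have N: "?N > 0" by simp
      \<comment> \<open>Moving by \<open>?c * s\<close> is the best correction of \<open>F k\<close>
        in direction \<open>s\<close>. It lowers the squared distance by \<open>|?z|^2 / ?N\<close>,
        which cannot exceed the slack 1/(k+1).\<close>
      let ?c = "?z / of_real ?N"
      have "(\<lambda>x. F k x + ?c * s x) \<in> S" using F s by (rule lin)
      from d_le[OF this] have "d \<le> (L2_norm M (\<lambda>x. ?r x - ?c * s x))\<^sup>2" by (simp add: diff_diff_eq)
      also have "\<dots> = (L2_norm M ?r)\<^sup>2 - 2 * Re (?c * L2_inner M ?r s) + (cmod ?c)\<^sup>2 * ?N"
        by (rule L2_norm_diff_scale[OF rL sL])
      also have "?c * L2_inner M ?r s = of_real ((cmod ?z)\<^sup>2 / ?N)"
        using complex_norm_square[of ?z] L2_inner_cnj[of M ?r s] by simp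
      also have "(cmod ?c)\<^sup>2 * ?N = (cmod ?z)\<^sup>2 / ?N"
      proof -
        have "cmod ?c = cmod ?z / ?N" by (simp only: norm_divide norm_of_real abs_of_nonneg[OF zero_le_power2])
        then have "(cmod ?c)\<^sup>2 * ?N = (cmod ?z)\<^sup>2 / (?N * ?N) * ?N"
          by (simp only: power_divide power2_eq_square[of ?N])
        moreover have "a / (b * b) * b = a / b" for a b :: real by simp
        ultimately show ?thesis by (rule trans)
      qed
      finally have "(cmod ?z)\<^sup>2 / ?N \<le> 1 / real (Suc k)" using Fd[of k] by simp
      then have "(cmod ?z)\<^sup>2 \<le> ?N / real (Suc k)" using N by (simp add: field_simps)
      also have "\<dots> = (L2_norm M s * \<delta> k)\<^sup>2" by (simp add: \<delta>_def power_mult_distrib power_divide)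
      finally show ?thesis
        by (rule power2_le_imp_le) (simp add: \<delta>_def L2_norm_nonneg)
    qed
  qed
  have close: "L2_norm M (\<lambda>x. F k x - F l x) \<le> \<delta> k + \<delta> l" for k l
  proof (cases "L2_norm M (\<lambda>x. F k x - F l x) = 0")
    case True
    then show ?thesis by (simp add: \<delta>_def)
  next
    case False
    let ?s = "\<lambda>x. F k x - F l x"
    have s: "?s \<in> S" using lin[OF F F, of k "-1" l] by simp
    then have sL: "?s \<in> L2_space M" using S(1) by auto
    \<comment> \<open>The difference of two approximants lies in \<open>S\<close> and is also a
      difference of two residuals, each nearly orthogonal to \<open>S\<close>.\<close>
    have "of_real ((L2_norm M ?s)\<^sup>2) = L2_inner M ?s (\<lambda>x. (f x - F l x) - (f x - F k x))"
      by (simp add: L2_inner_self)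
    also have "\<dots> = L2_inner M ?s (\<lambda>x. f x - F l x) - L2_inner M ?s (\<lambda>x. f x - F k x)"
      by (intro L.diff_right sL L2_diff_mem f FL)
    finally have "(L2_norm M ?s)\<^sup>2 = cmod (L2_inner M ?s (\<lambda>x. f x - F l x) - L2_inner M ?s (\<lambda>x. f x - F k x))"
      by (metis norm_of_real abs_of_nonneg zero_le_power2)
    also have "\<dots> \<le> L2_norm M ?s * \<delta> l + L2_norm M ?s * \<delta> k"
      by (rule order_trans[OF norm_triangle_ineq4]) (intro add_mono almost_orth s)
    finally have "L2_norm M ?s * L2_norm M ?s \<le> L2_norm M ?s * (\<delta> k + \<delta> l)"
      by (simp add: power2_eq_square algebra_simps)
    moreover have "L2_norm M ?s > 0" using False L2_norm_nonneg[of M ?s] by simp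
    ultimately show ?thesis by simp
  qed
  have \<delta>0: "\<delta> \<longlonglongrightarrow> 0"
    unfolding \<delta>_def
    by (intro tendsto_divide_0[OF tendsto_const] filterlim_at_top_imp_at_infinity
        filterlim_compose[OF sqrt_at_top] filterlim_compose[OF filterlim_real_sequentially] filterlim_Suc)
  have cau: "\<exists>N. \<forall>k\<ge>N. \<forall>l\<ge>N. L2_norm M (\<lambda>x. F k x - F l x) \<le> e" if e: "e > 0" for e
  proof -
    obtain N where N: "\<And>k. k \<ge> N \<Longrightarrow> norm (\<delta> k - 0) < e / 2"
      using LIMSEQ_D[OF \<delta>0, of "e / 2"] e by auto
    show ?thesis
    proof (intro exI allI impI)
      fix k l assume "k \<ge> N" "l \<ge> N"
      then show "L2_norm M (\<lambda>x. F k x - F l x) \<le> e"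
        using close[of k l] N[of k] N[of l] by (simp add: abs_less_iff)
    qed
  qed
  obtain h where h: "h \<in> L2_space M" and lim: "(\<lambda>k. L2_norm M (\<lambda>x. F k x - h x)) \<longlonglongrightarrow> 0"
    by (rule L2_complete[OF FL cau])
  have "L2_inner M s (\<lambda>x. f x - h x) = 0" if s: "s \<in> S" for s
  proof -
    have sL: "s \<in> L2_space M" using s S(1) by auto
    have "cmod (L2_inner M s (\<lambda>x. f x - h x)) \<le> L2_norm M s * \<delta> k + L2_norm M s * L2_norm M (\<lambda>x. F k x - h x)" for k
    proof -
      have "L2_inner M s (\<lambda>x. f x - h x) = L2_inner M s (\<lambda>x. (f x - F k x) + 1 * (F k x - h x))" by simp
      also have "\<dots> = L2_inner M s (\<lambda>x. f x - F k x) + 1 * L2_inner M s (\<lambda>x. F k x - h x)"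
        by (intro L.lin_right sL L2_diff_mem f FL h)
      finally show ?thesis
        using norm_triangle_ineq[of "L2_inner M s (\<lambda>x. f x - F k x)" "L2_inner M s (\<lambda>x. F k x - h x)"]
          almost_orth[OF s, of k] L2_Cauchy_Schwarz[OF sL L2_diff_mem[OF FL[of k] h]] by simp
    qed
    moreover have "(\<lambda>k. L2_norm M s * \<delta> k + L2_norm M s * L2_norm M (\<lambda>x. F k x - h x)) \<longlonglongrightarrow> L2_norm M s * 0 + L2_norm M s * 0"
      by (intro tendsto_intros \<delta>0 lim)
    ultimately have "cmod (L2_inner M s (\<lambda>x. f x - h x)) \<le> L2_norm M s * 0 + L2_norm M s * 0"
      by (intro LIMSEQ_le_const) auto
    then show ?thesis by simp
  qed
  from that[OF F h lim this] show thesis .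
qed

section \<open>Positivity of the trace of a product\<close>

text \<open>The form \<open>b\<close> minus \<open>\<Sum>k. |v k\<rangle>\<langle>v k|\<close> is still positive and vanishes on \<open>F\<close>, as in a
  Cholesky factorisation.\<close>

lemma Cholesky:
  assumes b: "positive_form V b" and V: "V \<subseteq> L2_space M"
    and repr: "\<And>y. y \<in> V \<Longrightarrow> \<exists>r\<in>V. \<forall>x\<in>V. b x y = L2_inner M x r"
    and F: "finite F" "F \<subseteq> V"
  shows "\<exists>(v :: nat \<Rightarrow> _) N. (\<forall>k<N. v k \<in> V) \<and>
     (\<forall>x\<in>V. (\<Sum>k<N. (cmod (L2_inner M (v k) x))\<^sup>2) \<le> Re (b x x)) \<and>
     (\<forall>e\<in>F. \<forall>x\<in>V. b x e = (\<Sum>k<N. L2_inner M x (v k) * L2_inner M (v k) e))"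
  using F
proof (induction F rule: finite_induct)
  case empty
  show ?case
    by (rule exI[of _ "\<lambda>_ _. 0"], rule exI[of _ 0]) (use positive_form.nonneg[OF b] in auto)
next
  case (insert e F)
  interpret b: positive_form V b by (rule b)
  interpret L: positive_form V "L2_inner M"
    using L2_positive_form V b.zero_mem b.lin_mem by (rule positive_form.subset)
  have e: "e \<in> V" and FV: "F \<subseteq> V" using insert.prems by auto
  obtain v :: "nat \<Rightarrow> _" and N where v: "\<And>k. k < N \<Longrightarrow> v k \<in> V"
    and le: "\<And>x. x \<in> V \<Longrightarrow> (\<Sum>k<N. (cmod (L2_inner M (v k) x))\<^sup>2) \<le> Re (b x x)"
    and eq: "\<And>e x. e \<in> F \<Longrightarrow> x \<in> V \<Longrightarrow> b x e = (\<Sum>k<N. L2_inner M x (v k) * L2_inner M (v k) e)"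
    using insert.IH[OF FV] by blast
  define d where "d x y = b x y - (\<Sum>k<N. L2_inner M x (v k) * L2_inner M (v k) y)" for x y
  have d_self: "Re (d x x) = Re (b x x) - (\<Sum>k<N. (cmod (L2_inner M (v k) x))\<^sup>2)" if "x \<in> V" for x
  proof -
    have "L2_inner M x (v k) * L2_inner M (v k) x = of_real ((cmod (L2_inner M (v k) x))\<^sup>2)" for k
      using L2_inner_cnj[of M x "v k"] by (simp only: complex_norm_square mult.commute)
    then show ?thesis by (simp add: d_def)
  qed
  interpret d: positive_form V d
  proof
    fix f g h :: "'a \<Rightarrow> complex" and c assume fgh: "f \<in> V" "g \<in> V" "h \<in> V"
    have "L2_inner M f (v k) * L2_inner M (v k) (\<lambda>x. g x + c * h x) =
        L2_inner M f (v k) * L2_inner M (v k) g + c * (L2_inner M f (v k) * L2_inner M (v k) h)"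
      if "k < N" for k
      using v[OF that] fgh by (subst L.lin_right) (auto simp: algebra_simps)
    then have "(\<Sum>k<N. L2_inner M f (v k) * L2_inner M (v k) (\<lambda>x. g x + c * h x)) =
       (\<Sum>k<N. L2_inner M f (v k) * L2_inner M (v k) g) + c * (\<Sum>k<N. L2_inner M f (v k) * L2_inner M (v k) h)"
      by (simp add: sum.distrib sum_distrib_left)
    then show "d f (\<lambda>x. g x + c * h x) = d f g + c * d f h"
      using fgh by (simp add: d_def b.lin_right algebra_simps)
  next
    fix f g assume fg: "f \<in> V" "g \<in> V"
    show "d g f = cnj (d f g)"
      unfolding d_def complex_cnj_diff cnj_sum complex_cnj_mult
      using b.hermitian[OF fg] L2_inner_cnj[of M, symmetric] by (simp add: mult.commute)
  qed (use b.zero_mem b.lin_mem le in \<open>auto simp: d_self\<close>)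
  have d_F: "d x e' = 0" if "e' \<in> F" "x \<in> V" for x e'
    using eq[OF that] by (simp add: d_def)
  show ?case
  proof (cases "Re (d e e) = 0")
    case True
    \<comment> \<open>A vanishing pivot forces its whole column to vanish, by Cauchy-Schwarz for the
      remainder \<open>d\<close>; no new vector is needed.\<close>
    have "d x e = 0" if "x \<in> V" for x
      using d.Cauchy_Schwarz[OF that e] True by simp
    then have "b x e' = (\<Sum>k<N. L2_inner M x (v k) * L2_inner M (v k) e')"
      if "e' \<in> insert e F" "x \<in> V" for x e'
      using that d_F by (auto simp: d_def)
    with v le show ?thesis by blast
  next
    case False
    then have pos: "Re (d e e) > 0" using d.nonneg[OF e] by simp
    let ?s = "complex_of_real (sqrt (Re (d e e)))"
    have s: "?s \<noteq> 0" "?s * ?s = of_real (Re (d e e))" "cnj ?s = ?s"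
      using pos by (auto simp flip: of_real_mult)
    obtain r where r: "r \<in> V" "\<And>x. x \<in> V \<Longrightarrow> b x e = L2_inner M x r" using repr[OF e] by blast
    \<comment> \<open>The new Cholesky column: \<open>r\<close> represents \<open>b\<close> in its
      second argument \<open>e\<close>, so \<open>w\<close> represents the remainder column
      \<open>d x e\<close> divided by the square root of the pivot.\<close>
    define w where "w = (\<lambda>x. (1 / ?s) * (r x - (\<Sum>k<N. L2_inner M (v k) e * v k x)))"
    have sumV: "(\<lambda>x. \<Sum>k<N. L2_inner M (v k) e * v k x) \<in> V" using v by (intro b.sum_mem) auto
    have w: "w \<in> V" unfolding w_def by (intro b.scale_mem b.diff_mem r sumV)
    have xw: "L2_inner M x w = d x e / ?s" if x: "x \<in> V" for x
    proof -
      have "L2_inner M x w = (1 / ?s) * L2_inner M x (\<lambda>x. r x - (\<Sum>k<N. L2_inner M (v k) e * v k x))"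
        unfolding w_def using x by (intro L.scale_right b.diff_mem r sumV)
      also have "L2_inner M x (\<lambda>x. r x - (\<Sum>k<N. L2_inner M (v k) e * v k x))
          = b x e - (\<Sum>k<N. L2_inner M (v k) e * L2_inner M x (v k))"
      proof -
        have "L2_inner M x (\<lambda>x. \<Sum>k<N. L2_inner M (v k) e * v k x) = (\<Sum>k<N. L2_inner M (v k) e * L2_inner M x (v k))"
          using x v by (intro L.sum_right) auto
        then show ?thesis by (simp only: L.diff_right[OF x r(1) sumV] r(2)[OF x])
      qed
      finally show ?thesis by (simp add: d_def mult.commute)
    qed
    have wx: "L2_inner M w x = d e x / ?s" if x: "x \<in> V" for x
      using L2_inner_cnj[of M w x] xw[OF x] d.hermitian[OF x e] s(3) by simp
    let ?v = "v(N := w)"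
    have "?v k \<in> V" if "k < Suc N" for k using that v w by (auto simp: less_Suc_eq)
    moreover have "(\<Sum>k<Suc N. (cmod (L2_inner M (?v k) x))\<^sup>2) \<le> Re (b x x)" if x: "x \<in> V" for x
    proof -
      have "(cmod (L2_inner M w x))\<^sup>2 = (cmod (d e x))\<^sup>2 / Re (d e e)"
        using pos by (simp add: wx[OF x] norm_divide power_divide)
      also have "\<dots> \<le> Re (d x x)"
        using d.Cauchy_Schwarz[OF e x] pos by (simp add: field_simps)
      finally show ?thesis using d_self[OF x] by simp
    qed
    moreover have "b x e' = (\<Sum>k<Suc N. L2_inner M x (?v k) * L2_inner M (?v k) e')"
      if e': "e' \<in> insert e F" and x: "x \<in> V" for x e'
    proof -
      have e'V: "e' \<in> V" using e' e FV by auto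
      \<comment> \<open>At \<open>e' = e\<close> the new rank one term removes the remainder
        exactly. At the older vectors of \<open>F\<close> both sides vanish, so what was already
        matched stays matched.\<close>
      have "L2_inner M x w * L2_inner M w e' = d x e * d e e' / (?s * ?s)"
        by (simp add: xw[OF x] wx[OF e'V])
      also have "\<dots> = d x e'"
      proof (cases "e' = e")
        case True
        have "d e e \<noteq> 0" using pos by auto
        moreover have "?s * ?s = d e e" using s(2) d.self_real[OF e] by metis
        ultimately show ?thesis using True by simp
      next
        case False
        then have "e' \<in> F" using e' by simp
        then show ?thesis using d_F e x by simp
      qed
      finally show ?thesis by (simp add: d_def)
    qed
    ultimately show ?thesis by blast
  qed
qed

section \<open>Orthonormal bases and partial traces\<close>

text \<open>Totality has the form used in \<open>sector_basis\<close>: only null functions of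
  \<open>V\<close> are orthogonal to \<open>B\<close>. Closedness of \<open>V\<close> is what turns
  this into approximation by finite combinations. No countability of \<open>B\<close> enters, hence
  the later use of \<open>has_sum\<close>.\<close>

locale L2_basis =
  fixes M :: "'a measure" and V and B :: "('a \<Rightarrow> complex) set"
  assumes V_sub: "V \<subseteq> L2_space M" and V_zero: "(\<lambda>_. 0) \<in> V"
    and V_lin: "\<And>f g c. f \<in> V \<Longrightarrow> g \<in> V \<Longrightarrow> (\<lambda>x. f x + c * g x) \<in> V"
    and V_closed: "L2_closed M V"
    and B_sub: "B \<subseteq> V"
    and orthonormal: "\<And>e e'. e \<in> B \<Longrightarrow> e' \<in> B \<Longrightarrow> L2_inner M e e' = (if e = e' then 1 else 0)"
    and total: "\<And>f. f \<in> V \<Longrightarrow> (\<And>e. e \<in> B \<Longrightarrow> L2_inner M e f = 0) \<Longrightarrow> L2_norm M f = 0"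
begin

sublocale L: positive_form V "L2_inner M"
  using L2_positive_form V_sub V_zero V_lin by (rule positive_form.subset)

definition proj where "proj F v = (\<lambda>x. \<Sum>e\<in>F. L2_inner M e v * e x)"

lemma proj_mem: "F \<subseteq> B \<Longrightarrow> proj F v \<in> V"
  unfolding proj_def using B_sub by (intro L.sum_mem) auto

lemma orthonormal_sum:
  assumes "finite F" "F \<subseteq> B" "e \<in> F"
  shows "L2_inner M e (\<lambda>x. \<Sum>e'\<in>F. c e' * e' x) = c e"
proof -
  have "L2_inner M e (\<lambda>x. \<Sum>e'\<in>F. c e' * e' x) = (\<Sum>e'\<in>F. c e' * L2_inner M e e')"
    using assms B_sub by (intro L.sum_right) auto
  also have "\<dots> = (\<Sum>e'\<in>F. if e' = e then c e' else 0)"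
    using assms by (intro sum.cong) (auto simp: orthonormal subset_iff)
  finally show ?thesis using assms by simp
qed

text \<open>Completing the square in each coefficient. The Fourier coefficients annihilate the last
  sum, which gives both the norm of \<open>v - proj F v\<close> and its minimality among all
  combinations over \<open>F\<close>.\<close>

lemma norm_diff_sum:
  assumes F: "finite F" "F \<subseteq> B" and v: "v \<in> V"
  shows "(L2_norm M (\<lambda>x. v x - (\<Sum>e\<in>F. c e * e x)))\<^sup>2 =
    (L2_norm M v)\<^sup>2 - (\<Sum>e\<in>F. (cmod (L2_inner M e v))\<^sup>2) + (\<Sum>e\<in>F. (cmod (c e - L2_inner M e v))\<^sup>2)"
proof -
  let ?s = "\<lambda>x. \<Sum>e\<in>F. c e * e x"
  have s: "?s \<in> V" using F B_sub by (intro L.sum_mem) auto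
  have vs: "L2_inner M v ?s = (\<Sum>e\<in>F. c e * L2_inner M v e)"
    using F B_sub v by (intro L.sum_right) auto
  have "L2_inner M ?s ?s = (\<Sum>e\<in>F. c e * L2_inner M ?s e)"
    using F B_sub s by (intro L.sum_right) auto
  also have "\<dots> = (\<Sum>e\<in>F. of_real ((cmod (c e))\<^sup>2))"
  proof (intro sum.cong refl)
    fix e assume "e \<in> F"
    then have "L2_inner M ?s e = cnj (c e)"
      using orthonormal_sum[OF F] L2_inner_cnj[of M ?s e] by simp
    then show "c e * L2_inner M ?s e = of_real ((cmod (c e))\<^sup>2)" by (simp only: complex_norm_square)
  qed
  finally have ss: "Re (L2_inner M ?s ?s) = (\<Sum>e\<in>F. (cmod (c e))\<^sup>2)" by simp
  have "(cmod (a - b))\<^sup>2 = (cmod a)\<^sup>2 - 2 * Re (a * cnj b) + (cmod b)\<^sup>2" for a b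
    unfolding cmod_power2 by (simp add: power2_eq_square algebra_simps)
  then have "(cmod (c e - L2_inner M e v))\<^sup>2 = (cmod (c e))\<^sup>2 - 2 * Re (c e * L2_inner M v e) + (cmod (L2_inner M e v))\<^sup>2" for e
    by (metis L2_inner_cnj)
  then have "(\<Sum>e\<in>F. (cmod (c e - L2_inner M e v))\<^sup>2) =
      (\<Sum>e\<in>F. (cmod (c e))\<^sup>2) - 2 * Re (\<Sum>e\<in>F. c e * L2_inner M v e) + (\<Sum>e\<in>F. (cmod (L2_inner M e v))\<^sup>2)"
    by (simp only: sum.distrib sum_subtractf sum_distrib_left Re_sum)
  then show ?thesis
    using L.diff_self[OF v s] unfolding Re_L2_inner_self[of M v] Re_L2_inner_self[of M "\<lambda>x. v x - ?s x"] ss vs by simp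
qed

lemma norm_diff_proj:
  assumes "finite F" "F \<subseteq> B" "v \<in> V"
  shows "(L2_norm M (\<lambda>x. v x - proj F v x))\<^sup>2 = (L2_norm M v)\<^sup>2 - (\<Sum>e\<in>F. (cmod (L2_inner M e v))\<^sup>2)"
  using norm_diff_sum[OF assms, of "\<lambda>e. L2_inner M e v"] by (simp add: proj_def)

text \<open>The residual of the projection of \<open>v\<close> to the finite combinations of
  \<open>B\<close> is orthogonal to \<open>B\<close>, hence null by totality. So some finite
  combination is close to \<open>v\<close>, and the Fourier coefficients over the same finite set do
  at least as well.\<close>

lemma Parseval_approx:
  assumes v: "v \<in> V" and \<epsilon>: "\<epsilon> > 0"
  obtains F where "finite F" "F \<subseteq> B" "(L2_norm M v)\<^sup>2 \<le> (\<Sum>e\<in>F. (cmod (L2_inner M e v))\<^sup>2) + \<epsilon>"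
proof -
  define S where "S = {\<lambda>x. \<Sum>e\<in>F. c e * e x |F c. finite F \<and> F \<subseteq> B}"
  have vL: "v \<in> L2_space M" using v V_sub by auto
  have SV: "S \<subseteq> V" unfolding S_def using B_sub by (auto intro!: L.sum_mem)
  have BS: "e \<in> S" if "e \<in> B" for e
    unfolding S_def using that by (auto intro!: exI[of _ "{e}"] exI[of _ "\<lambda>_. 1"])
  have Slin: "(\<lambda>x. f x + c * g x) \<in> S" if fg: "f \<in> S" "g \<in> S" for f g c
  proof -
    obtain F a G b where F: "finite F" "F \<subseteq> B" "f = (\<lambda>x. \<Sum>e\<in>F. a e * e x)"
      and G: "finite G" "G \<subseteq> B" "g = (\<lambda>x. \<Sum>e\<in>G. b e * e x)"
      using fg unfolding S_def by blast
    let ?k = "\<lambda>e. (if e \<in> F then a e else 0) + c * (if e \<in> G then b e else 0)"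
    have "f x = (\<Sum>e\<in>F \<union> G. (if e \<in> F then a e else 0) * e x)"
      and "g x = (\<Sum>e\<in>F \<union> G. (if e \<in> G then b e else 0) * e x)" for x
      unfolding F(3) G(3) using F(1) G(1) by (auto intro!: sum.mono_neutral_cong_left)
    then have "(\<lambda>x. f x + c * g x) = (\<lambda>x. \<Sum>e\<in>F \<union> G. ?k e * e x)"
      by (simp add: sum_distrib_left sum.distrib[symmetric] algebra_simps)
    then show ?thesis unfolding S_def using F(1,2) G(1,2)
      by (intro CollectI exI[of _ "F \<union> G"] exI[of _ ?k]) auto
  qed
  have S0: "(\<lambda>_. 0) \<in> S" unfolding S_def by (auto intro!: exI[of _ "{}"])
  obtain P h where P: "\<And>k::nat. P k \<in> S" and h: "h \<in> L2_space M"
    and lim: "(\<lambda>k. L2_norm M (\<lambda>x. P k x - h x)) \<longlonglongrightarrow> 0"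
    and orth: "\<And>s. s \<in> S \<Longrightarrow> L2_inner M s (\<lambda>x. v x - h x) = 0"
    by (rule L2_projection[OF order_trans[OF SV V_sub] S0 _ vL]) (erule (1) Slin, blast)
  have hV: "h \<in> V" using V_closed P SV h lim unfolding L2_closed_def by blast
  have vh: "L2_norm M (\<lambda>x. v x - h x) = 0"
    by (intro total L.diff_mem v hV orth BS)
  \<comment> \<open>The projection agrees with \<open>v\<close> only almost everywhere, which is
    enough for the norms of the differences.\<close>
  have "AE x in M. v x - h x = 0"
    using vh L2_norm_eq_0_iff[OF L2_diff_mem[OF vL h]] by simp
  then have AE: "AE x in M. P k x - h x = P k x - v x" for k by eventually_elim simp
  have PL: "P k \<in> L2_space M" for k using P SV V_sub by blast
  have "L2_norm M (\<lambda>x. P k x - h x) = L2_norm M (\<lambda>x. v x - P k x)" for k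
    using L2_norm_AE_cong[OF _ _ AE[of k]] L2_diff_mem PL h vL L2_norm_diff_commute by metis
  with lim have "(\<lambda>k. L2_norm M (\<lambda>x. v x - P k x)) \<longlonglongrightarrow> 0" by simp
  then have "eventually (\<lambda>k. L2_norm M (\<lambda>x. v x - P k x) < sqrt \<epsilon>) sequentially"
    using \<epsilon> by (intro order_tendstoD) auto
  then obtain k where k: "L2_norm M (\<lambda>x. v x - P k x) < sqrt \<epsilon>"
    by (auto simp: eventually_sequentially)
  obtain F c where F: "finite F" "F \<subseteq> B" "P k = (\<lambda>x. \<Sum>e\<in>F. c e * e x)"
    using P[of k] unfolding S_def by blast
  have "(L2_norm M (\<lambda>x. v x - P k x))\<^sup>2 \<le> \<epsilon>"
    using power_mono[OF less_imp_le[OF k] L2_norm_nonneg, of 2] \<epsilon> by simp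
  moreover have "(L2_norm M v)\<^sup>2 - (\<Sum>e\<in>F. (cmod (L2_inner M e v))\<^sup>2) \<le> (L2_norm M (\<lambda>x. v x - P k x))\<^sup>2"
    unfolding F(3) norm_diff_sum[OF F(1,2) v] by (simp add: sum_nonneg)
  ultimately show thesis using that[OF F(1,2)] by simp
qed

text \<open>The matrix elements of \<open>b\<close> on \<open>F\<close> coincide with those of \<open>\<Sum>k. |v k\<rangle>\<langle>v k|\<close>.  Up to
  replacing \<open>v k\<close> by its projection to the span of \<open>F\<close>, the partial trace of \<open>b\<close> composed with
  the form \<open>t\<close> is therefore \<open>\<Sum>k. t (v k) (v k)\<close>, and this replacement costs at most the tail of
  the trace of \<open>b\<close>.\<close>

lemma partial_trace_product:
  assumes b: "positive_form V b"
    and repr: "\<And>y. y \<in> V \<Longrightarrow> \<exists>r\<in>V. \<forall>x\<in>V. b x y = L2_inner M x r"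
    and trace: "\<And>F. finite F \<Longrightarrow> F \<subseteq> B \<Longrightarrow> (\<Sum>e\<in>F. Re (b e e)) \<le> \<tau>"
    and t: "positive_form V t"
    and T: "\<And>y. y \<in> V \<Longrightarrow> T y \<in> V" "\<And>x y. x \<in> V \<Longrightarrow> y \<in> V \<Longrightarrow> t x y = L2_inner M x (T y)"
    and t_le: "\<And>x. x \<in> V \<Longrightarrow> Re (t x x) \<le> C\<^sup>2 * (L2_norm M x)\<^sup>2"
    and F: "finite F" "F \<subseteq> B"
  shows "\<exists>p\<ge>0. cmod ((\<Sum>e\<in>F. b e (T e)) - complex_of_real p) \<le> C\<^sup>2 * sqrt (\<tau> * (\<tau> - (\<Sum>e\<in>F. Re (b e e))))"
proof -
  interpret b: positive_form V b by (rule b)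
  interpret t: positive_form V t by (rule t)
  let ?tail = "\<tau> - (\<Sum>e\<in>F. Re (b e e))"
  have FV: "F \<subseteq> V" using F B_sub by auto
  obtain v :: "nat \<Rightarrow> _" and N where v: "\<And>k. k < N \<Longrightarrow> v k \<in> V"
    and le: "\<And>x. x \<in> V \<Longrightarrow> (\<Sum>k<N. (cmod (L2_inner M (v k) x))\<^sup>2) \<le> Re (b x x)"
    and eq: "\<And>e x. e \<in> F \<Longrightarrow> x \<in> V \<Longrightarrow> b x e = (\<Sum>k<N. L2_inner M x (v k) * L2_inner M (v k) e)"
    using Cholesky[OF b V_sub repr F(1) FV] by blast
  have swap: "cmod (L2_inner M e (v k)) = cmod (L2_inner M (v k) e)" for e k
    using L2_inner_cnj[of M e "v k"] by simp
  \<comment> \<open>The left side is the total squared norm of the parts of the \<open>v k\<close>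
    orthogonal to \<open>F\<close>. Measured on basis vectors outside \<open>F\<close>, it is
    dominated by the diagonal of \<open>b\<close> there, that is, by the tail of its trace.\<close>
  have norms: "(\<Sum>k<N. (L2_norm M (v k))\<^sup>2) - (\<Sum>k<N. \<Sum>e\<in>F. (cmod (L2_inner M e (v k)))\<^sup>2) \<le> ?tail"
  proof (rule field_le_epsilon)
    fix \<epsilon> :: real assume \<epsilon>: "\<epsilon> > 0"
    have "\<forall>k. \<exists>G. k < N \<longrightarrow> finite G \<and> G \<subseteq> B \<and>
        (L2_norm M (v k))\<^sup>2 \<le> (\<Sum>e\<in>G. (cmod (L2_inner M e (v k)))\<^sup>2) + \<epsilon> / (real N + 1)"
    proof (intro allI)
      fix k
      show "\<exists>G. k < N \<longrightarrow> finite G \<and> G \<subseteq> B \<and>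
        (L2_norm M (v k))\<^sup>2 \<le> (\<Sum>e\<in>G. (cmod (L2_inner M e (v k)))\<^sup>2) + \<epsilon> / (real N + 1)"
        using Parseval_approx[OF v, of k "\<epsilon> / (real N + 1)"] \<epsilon> by (metis add_pos_nonneg divide_pos_pos of_nat_0_le_iff zero_less_one add.commute)
    qed
    then obtain G where G: "\<And>k. k < N \<Longrightarrow> finite (G k)" "\<And>k. k < N \<Longrightarrow> G k \<subseteq> B"
      "\<And>k. k < N \<Longrightarrow> (L2_norm M (v k))\<^sup>2 \<le> (\<Sum>e\<in>G k. (cmod (L2_inner M e (v k)))\<^sup>2) + \<epsilon> / (real N + 1)"
      by metis
    \<comment> \<open>A finite set that contains \<open>F\<close> and captures all \<open>N\<close>
      norms up to a total error \<epsilon>. The denominator \<open>N + 1\<close> in the individual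
      tolerances also covers \<open>N = 0\<close>.\<close>
    define H where "H = F \<union> (\<Union>k<N. G k)"
    have H: "finite H" "H \<subseteq> B" "F \<subseteq> H" unfolding H_def using F G by auto
    have "(\<Sum>k<N. (L2_norm M (v k))\<^sup>2) \<le> (\<Sum>k<N. (\<Sum>e\<in>H. (cmod (L2_inner M e (v k)))\<^sup>2) + \<epsilon> / (real N + 1))"
    proof (rule sum_mono)
      fix k assume "k \<in> {..<N}"
      then have k: "k < N" by simp
      have "(\<Sum>e\<in>G k. (cmod (L2_inner M e (v k)))\<^sup>2) \<le> (\<Sum>e\<in>H. (cmod (L2_inner M e (v k)))\<^sup>2)"
        by (rule sum_mono2[OF H(1)]) (use k in \<open>auto simp: H_def\<close>)
      then show "(L2_norm M (v k))\<^sup>2 \<le> (\<Sum>e\<in>H. (cmod (L2_inner M e (v k)))\<^sup>2) + \<epsilon> / (real N + 1)"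
        using G(3)[OF k] by simp
    qed
    also have "\<dots> = (\<Sum>k<N. \<Sum>e\<in>H. (cmod (L2_inner M e (v k)))\<^sup>2) + N * (\<epsilon> / (real N + 1))"
      by (simp add: sum.distrib)
    also have "N * (\<epsilon> / (real N + 1)) \<le> \<epsilon>" using \<epsilon> by (simp add: field_simps)
    also have "(\<Sum>k<N. \<Sum>e\<in>H. (cmod (L2_inner M e (v k)))\<^sup>2)
        = (\<Sum>k<N. \<Sum>e\<in>F. (cmod (L2_inner M e (v k)))\<^sup>2) + (\<Sum>e\<in>H - F. \<Sum>k<N. (cmod (L2_inner M e (v k)))\<^sup>2)"
      by (subst sum.swap, subst sum.subset_diff[OF H(3,1)], subst (2) sum.swap) simp
    also have "(\<Sum>e\<in>H - F. \<Sum>k<N. (cmod (L2_inner M e (v k)))\<^sup>2) \<le> (\<Sum>e\<in>H - F. Re (b e e))"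
      unfolding swap using H B_sub by (intro sum_mono le) auto
    also have "(\<Sum>e\<in>H - F. Re (b e e)) = (\<Sum>e\<in>H. Re (b e e)) - (\<Sum>e\<in>F. Re (b e e))"
      using H by (simp add: sum_diff)
    also have "\<dots> \<le> ?tail" using trace[OF H(1,2)] by simp
    finally show "(\<Sum>k<N. (L2_norm M (v k))\<^sup>2) - (\<Sum>k<N. \<Sum>e\<in>F. (cmod (L2_inner M e (v k)))\<^sup>2) \<le> ?tail + \<epsilon>"
      by simp
  qed
  have "(\<Sum>k<N. \<Sum>e\<in>F. (cmod (L2_inner M e (v k)))\<^sup>2) \<le> (\<Sum>e\<in>F. Re (b e e))"
    unfolding swap using FV by (subst sum.swap) (intro sum_mono le, auto)
  with norms have total_le: "(\<Sum>k<N. (L2_norm M (v k))\<^sup>2) \<le> \<tau>" by simp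
  define w where "w k = (\<lambda>x. v k x - proj F (v k) x)" for k
  have w: "w k \<in> V" if "k < N" for k
    unfolding w_def using v[OF that] F by (intro L.diff_mem proj_mem)
  have w_le: "(\<Sum>k<N. (L2_norm M (w k))\<^sup>2) \<le> ?tail"
    using norms v F by (simp add: w_def norm_diff_proj sum_subtractf)
  have "(\<Sum>e\<in>F. b e (T e)) = (\<Sum>e\<in>F. \<Sum>k<N. L2_inner M e (v k) * t (v k) e)"
  proof (intro sum.cong refl)
    fix e assume e: "e \<in> F"
    then have eV: "e \<in> V" using FV by auto
    \<comment> \<open>The factorisation is exact only if the second argument of \<open>b\<close>
      lies in \<open>F\<close>; hermiticity puts \<open>e\<close> there and leaves the arbitrary
      vector \<open>T e\<close> in the first.\<close>
    have "b e (T e) = cnj (b (T e) e)" using b.hermitian[OF T(1)[OF eV] eV] .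
    also have "\<dots> = (\<Sum>k<N. cnj (L2_inner M (T e) (v k) * L2_inner M (v k) e))"
      using eq[OF e T(1)[OF eV]] by simp
    also have "\<dots> = (\<Sum>k<N. L2_inner M e (v k) * t (v k) e)"
    proof (intro sum.cong refl)
      fix k assume "k \<in> {..<N}"
      then have "t (v k) e = L2_inner M (v k) (T e)" using T(2)[OF v eV] by simp
      then show "cnj (L2_inner M (T e) (v k) * L2_inner M (v k) e) = L2_inner M e (v k) * t (v k) e"
        unfolding complex_cnj_mult L2_inner_cnj[of M "T e", symmetric] L2_inner_cnj[of M "v k" e, symmetric]
        by (simp add: L2_inner_cnj[symmetric] mult.commute)
    qed
    finally show "b e (T e) = (\<Sum>k<N. L2_inner M e (v k) * t (v k) e)" .
  qed
  also have "\<dots> = (\<Sum>k<N. \<Sum>e\<in>F. L2_inner M e (v k) * t (v k) e)" by (rule sum.swap)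
  also have "\<dots> = (\<Sum>k<N. t (v k) (proj F (v k)))"
  proof (intro sum.cong refl)
    fix k assume "k \<in> {..<N}"
    then show "(\<Sum>e\<in>F. L2_inner M e (v k) * t (v k) e) = t (v k) (proj F (v k))"
      unfolding proj_def using v FV by (subst t.sum_right) auto
  qed
  also have "\<dots> = (\<Sum>k<N. t (v k) (v k) - t (v k) (w k))"
  proof (intro sum.cong refl)
    fix k assume k: "k \<in> {..<N}"
    then have "t (v k) (w k) = t (v k) (v k) - t (v k) (proj F (v k))"
      unfolding w_def using v F by (intro t.diff_right proj_mem) auto
    then show "t (v k) (proj F (v k)) = t (v k) (v k) - t (v k) (w k)" by simp
  qed
  also have "\<dots> = complex_of_real (\<Sum>k<N. Re (t (v k) (v k))) - (\<Sum>k<N. t (v k) (w k))"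
  proof -
    have "(\<Sum>k<N. t (v k) (v k)) = (\<Sum>k<N. of_real (Re (t (v k) (v k))))"
      by (intro sum.cong refl t.self_real v) auto
    then show ?thesis by (simp add: sum_subtractf)
  qed
  finally have "cmod ((\<Sum>e\<in>F. b e (T e)) - complex_of_real (\<Sum>k<N. Re (t (v k) (v k)))) = cmod (\<Sum>k<N. t (v k) (w k))"
    by simp
  also have "\<dots> \<le> (\<Sum>k<N. \<bar>C * L2_norm M (v k)\<bar> * \<bar>C * L2_norm M (w k)\<bar>)"
  proof (rule sum_norm_le)
    fix k assume "k \<in> {..<N}"
    then have k: "v k \<in> V" "w k \<in> V" using v w by auto
    have "cmod (t (v k) (w k)) \<le> sqrt (Re (t (v k) (v k))) * sqrt (Re (t (w k) (w k)))"
      using k by (rule t.Cauchy_Schwarz_sqrt)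
    also have "\<dots> \<le> sqrt ((C * L2_norm M (v k))\<^sup>2) * sqrt ((C * L2_norm M (w k))\<^sup>2)"
      using t_le[OF k(1)] t_le[OF k(2)] t.nonneg[OF k(2)]
      by (intro mult_mono) (auto simp: power_mult_distrib)
    finally show "norm (t (v k) (w k)) \<le> \<bar>C * L2_norm M (v k)\<bar> * \<bar>C * L2_norm M (w k)\<bar>"
      by simp
  qed
  \<comment> \<open>Cauchy-Schwarz over \<open>k\<close>: the squared norms of the
    \<open>v k\<close> add up to at most \<open>\<tau>\<close>, those of the defects
    \<open>w k\<close> to at most the tail.\<close>
  also have "\<dots> \<le> L2_set (\<lambda>k. C * L2_norm M (v k)) {..<N} * L2_set (\<lambda>k. C * L2_norm M (w k)) {..<N}"
    by (rule L2_set_mult_ineq)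
  also have "\<dots> = C\<^sup>2 * (sqrt (\<Sum>k<N. (L2_norm M (v k))\<^sup>2) * sqrt (\<Sum>k<N. (L2_norm M (w k))\<^sup>2))"
    unfolding L2_set_def power_mult_distrib sum_distrib_left[symmetric] real_sqrt_mult
    by (simp add: power2_eq_square)
  also have "\<dots> \<le> C\<^sup>2 * (sqrt \<tau> * sqrt ?tail)"
  proof (intro mult_left_mono mult_mono real_sqrt_le_mono total_le w_le real_sqrt_ge_zero sum_nonneg)
    have "0 \<le> (\<Sum>k<N. (L2_norm M (v k))\<^sup>2)" by (intro sum_nonneg) simp
    then show "0 \<le> \<tau>" using total_le by simp
  qed auto
  finally have "cmod ((\<Sum>e\<in>F. b e (T e)) - complex_of_real (\<Sum>k<N. Re (t (v k) (v k)))) \<le> C\<^sup>2 * sqrt (\<tau> * ?tail)"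
    by (simp only: real_sqrt_mult)
  then show ?thesis
    by (intro exI[of _ "\<Sum>k<N. Re (t (v k) (v k))"] conjI sum_nonneg t.nonneg v) auto
qed

text \<open>Along the finite subsets of \<open>B\<close> the partial sums come arbitrarily close to
  nonnegative reals \<open>p F\<close>, since the tail of the trace of \<open>b\<close> tends to 0;
  the nonnegative reals are closed. The single terms \<open>b e (T e)\<close> may well be
  complex.\<close>

theorem trace_product_nonneg:
  assumes b: "positive_form V b"
    and repr: "\<And>y. y \<in> V \<Longrightarrow> \<exists>r\<in>V. \<forall>x\<in>V. b x y = L2_inner M x r"
    and trace: "((\<lambda>e. b e e) has_sum \<tau>) B"
    and t: "positive_form V t"
    and T: "\<And>y. y \<in> V \<Longrightarrow> T y \<in> V" "\<And>x y. x \<in> V \<Longrightarrow> y \<in> V \<Longrightarrow> t x y = L2_inner M x (T y)"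
    and t_le: "\<And>x. x \<in> V \<Longrightarrow> Re (t x x) \<le> C\<^sup>2 * (L2_norm M x)\<^sup>2"
    and z: "((\<lambda>e. b e (T e)) has_sum z) B"
  shows "z \<in> \<real>\<^sub>\<ge>\<^sub>0"
proof -
  interpret b: positive_form V b by (rule b)
  have re: "((\<lambda>e. Re (b e e)) has_sum Re \<tau>) B" using trace by (rule has_sum_Re)
  have le: "(\<Sum>e\<in>F. Re (b e e)) \<le> Re \<tau>" if "finite F" "F \<subseteq> B" for F
    using that B_sub
    by (intro has_sum_mono2[OF has_sum_finite[OF that(1)] re]) (auto intro!: b.nonneg)
  have "\<forall>F. \<exists>p. finite F \<and> F \<subseteq> B \<longrightarrow> p \<ge> 0 \<and>
      cmod ((\<Sum>e\<in>F. b e (T e)) - complex_of_real p) \<le> C\<^sup>2 * sqrt (Re \<tau> * (Re \<tau> - (\<Sum>e\<in>F. Re (b e e))))"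
    using partial_trace_product[OF b repr le t T t_le] by meson
  from choice[OF this] obtain p where p: "\<And>F. finite F \<Longrightarrow> F \<subseteq> B \<Longrightarrow> p F \<ge> 0"
    "\<And>F. finite F \<Longrightarrow> F \<subseteq> B \<Longrightarrow>
       cmod ((\<Sum>e\<in>F. b e (T e)) - complex_of_real (p F)) \<le> C\<^sup>2 * sqrt (Re \<tau> * (Re \<tau> - (\<Sum>e\<in>F. Re (b e e))))"
    by blast
  let ?\<F> = "finite_subsets_at_top B"
  have ev: "eventually (\<lambda>F. finite F \<and> F \<subseteq> B) ?\<F>"
    by (rule eventually_finite_subsets_at_top_weakI) auto
  have "((\<lambda>F. C\<^sup>2 * sqrt (Re \<tau> * (Re \<tau> - (\<Sum>e\<in>F. Re (b e e))))) \<longlongrightarrow> C\<^sup>2 * sqrt (Re \<tau> * (Re \<tau> - Re \<tau>))) ?\<F>"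
    using re unfolding has_sum_def by (intro tendsto_intros)
  then have "((\<lambda>F. C\<^sup>2 * sqrt (Re \<tau> * (Re \<tau> - (\<Sum>e\<in>F. Re (b e e))))) \<longlongrightarrow> 0) ?\<F>" by simp
  then have "((\<lambda>F. (\<Sum>e\<in>F. b e (T e)) - complex_of_real (p F)) \<longlongrightarrow> 0) ?\<F>"
    by (rule Lim_null_comparison[rotated]) (use ev in eventually_elim, use p(2) in auto)
  with z[unfolded has_sum_def]
  have "((\<lambda>F. (\<Sum>e\<in>F. b e (T e)) - ((\<Sum>e\<in>F. b e (T e)) - complex_of_real (p F))) \<longlongrightarrow> z - 0) ?\<F>"
    by (rule tendsto_diff)
  then have "((\<lambda>F. complex_of_real (p F)) \<longlongrightarrow> z) ?\<F>" by simp
  moreover have "eventually (\<lambda>F. complex_of_real (p F) \<in> \<real>\<^sub>\<ge>\<^sub>0) ?\<F>"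
    using ev by eventually_elim (use p(1) in auto)
  ultimately show ?thesis
    by (intro Lim_in_closed_set[OF closed_nonneg_Reals_complex]) (auto simp: finite_subsets_at_top_neq_bot)
qed

end

section \<open>Operators on n-particle wave functions\<close>

interpretation config: product_sigma_finite "\<lambda>_::nat. lborel :: (real^'d::finite) measure"
  by standard

lemma sigma_finite_config: "sigma_finite_measure (config n :: (nat \<Rightarrow> real^'d::finite) measure)"
  by (rule config.sigma_finite) simp

lemma pair_sigma_finite_config:
  "pair_sigma_finite (config m :: (nat \<Rightarrow> real^'d::finite) measure) (lborel :: (real^'d) measure)"
  by (intro pair_sigma_finite.intro sigma_finite_config lborel.sigma_finite_measure_axioms)

section \<open>Permutations of the particles\<close>

lemma comp_permutes_space:
  assumes "\<pi> permutes {..<n}" "x \<in> space (config n)"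
  shows "x \<circ> \<pi> \<in> space (config n)"
  using assms by (auto simp: space_PiM PiE_def extensional_def permutes_not_in)

lemma measurable_comp_permutes:
  assumes \<pi>: "\<pi> permutes {..<n}"
  shows "(\<lambda>x. x \<circ> \<pi>) \<in> measurable (config n) (config n :: (nat \<Rightarrow> real^'d::finite) measure)"
proof -
  have "(\<lambda>x. \<lambda>i\<in>{..<n}. x (\<pi> i)) \<in> measurable (config n) (config n :: (nat \<Rightarrow> real^'d) measure)"
    using permutes_in_image[OF \<pi>] by (intro measurable_restrict measurable_component_singleton) auto
  moreover have "x \<circ> \<pi> = (\<lambda>i\<in>{..<n}. x (\<pi> i))" if "x \<in> space (config n)" for x :: "nat \<Rightarrow> real^'d"
    using comp_permutes_space[OF \<pi> that] by (auto simp: space_PiM PiE_def extensional_def restrict_def)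
  ultimately show ?thesis by (subst measurable_cong) auto
qed

text \<open>The product measure is determined by its values on rectangles. A permutation turns a
  rectangle into one with permuted sides, and the product of the side measures does not depend on
  their order.\<close>

lemma distr_comp_permutes:
  assumes \<pi>: "\<pi> permutes {..<n}"
  shows "distr (config n) (config n) (\<lambda>x. x \<circ> \<pi>) = (config n :: (nat \<Rightarrow> real^'d::finite) measure)"
proof (rule config.PiM_eqI)
  fix A :: "nat \<Rightarrow> (real^'d) set" assume A: "\<And>i. i \<in> {..<n} \<Longrightarrow> A i \<in> sets lborel"
  have vimage: "(\<lambda>x. x \<circ> \<pi>) -` Pi\<^sub>E {..<n} A \<inter> space (config n) = Pi\<^sub>E {..<n} (\<lambda>i. A (inv \<pi> i))"
  proof (intro set_eqI iffI)
    fix x assume "x \<in> (\<lambda>x. x \<circ> \<pi>) -` Pi\<^sub>E {..<n} A \<inter> space (config n)"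
    then have x: "\<And>i. i < n \<Longrightarrow> x (\<pi> i) \<in> A i" "x \<in> extensional {..<n}"
      by (auto simp: space_PiM PiE_def)
    have "x i \<in> A (inv \<pi> i)" if "i < n" for i
      using x(1)[of "inv \<pi> i"] that permutes_in_image[OF permutes_inv[OF \<pi>], of i] permutes_inverses(1)[OF \<pi>, of i] by simp
    with x(2) show "x \<in> Pi\<^sub>E {..<n} (\<lambda>i. A (inv \<pi> i))" by (simp add: PiE_iff)
  next
    fix x assume "x \<in> Pi\<^sub>E {..<n} (\<lambda>i. A (inv \<pi> i))"
    then have x: "\<And>i. i < n \<Longrightarrow> x i \<in> A (inv \<pi> i)" "x \<in> extensional {..<n}"
      by (simp_all add: PiE_iff)
    then have sp: "x \<in> space (config n)" by (simp add: space_PiM PiE_iff)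
    have "x (\<pi> i) \<in> A i" if "i < n" for i
      using x(1)[of "\<pi> i"] that permutes_in_image[OF \<pi>, of i] permutes_inverses(2)[OF \<pi>, of i] by simp
    then show "x \<in> (\<lambda>x. x \<circ> \<pi>) -` Pi\<^sub>E {..<n} A \<inter> space (config n)"
      using sp comp_permutes_space[OF \<pi> sp] by (auto simp: space_PiM PiE_def)
  qed
  have A': "A (inv \<pi> i) \<in> sets lborel" if "i < n" for i
    using A[of "inv \<pi> i"] that permutes_in_image[OF permutes_inv[OF \<pi>], of i] by simp
  have "emeasure (distr (config n) (config n) (\<lambda>x. x \<circ> \<pi>)) (Pi\<^sub>E {..<n} A)
      = emeasure (config n) (Pi\<^sub>E {..<n} (\<lambda>i. A (inv \<pi> i)))"
    using A by (subst emeasure_distr) (auto intro!: measurable_comp_permutes[OF \<pi>] sets_PiM_I_finite simp: vimage)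
  also have "\<dots> = (\<Prod>i<n. emeasure lborel (A (inv \<pi> i)))"
    using A' by (intro config.emeasure_PiM) auto
  also have "\<dots> = (\<Prod>i<n. emeasure lborel (A i))"
    by (rule prod.permute[OF permutes_inv[OF \<pi>], of "\<lambda>i. emeasure lborel (A i)", symmetric, unfolded comp_def])
  finally show "emeasure (distr (config n) (config n) (\<lambda>x. x \<circ> \<pi>)) (Pi\<^sub>E {..<n} A) = (\<Prod>i<n. emeasure lborel (A i))" .
qed auto

lemma AE_comp_permutes:
  fixes P :: "(nat \<Rightarrow> real^'d::finite) \<Rightarrow> bool"
  assumes "\<pi> permutes {..<n}" "AE x in config n. P x"
  shows "AE x in config n. P (x \<circ> \<pi>)"
  by (rule AE_distrD[OF measurable_comp_permutes[OF assms(1)]]) (simp only: distr_comp_permutes[OF assms(1)] assms(2))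

lemma L2_comp_permutes:
  fixes \<phi> :: "(nat \<Rightarrow> real^'d::finite) \<Rightarrow> complex"
  assumes \<pi>: "\<pi> permutes {..<n}" and \<phi>: "\<phi> \<in> L2_space (config n)"
  shows "(\<lambda>x. \<phi> (x \<circ> \<pi>)) \<in> L2_space (config n)"
proof -
  have [measurable]: "\<phi> \<in> borel_measurable (config n)" using \<phi> by (rule L2_space_measurable)
  note m = measurable_comp_permutes[OF \<pi>, where 'd='d]
  have "(\<integral>\<^sup>+x. ennreal ((cmod (\<phi> (x \<circ> \<pi>)))\<^sup>2) \<partial>config n)
      = (\<integral>\<^sup>+x. ennreal ((cmod (\<phi> x))\<^sup>2) \<partial>distr (config n) (config n) (\<lambda>x. x \<circ> \<pi>))"
    by (subst nn_integral_distr[OF m]) auto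
  then show ?thesis
    using \<phi> measurable_compose[OF m, of \<phi> borel]
    by (simp add: L2_space_iff_nn_integral distr_comp_permutes[OF \<pi>])
qed

lemma integral_comp_permutes:
  fixes h :: "(nat \<Rightarrow> real^'d::finite) \<Rightarrow> 'b::{banach, second_countable_topology}"
  assumes \<pi>: "\<pi> permutes {..<n}" and h: "h \<in> borel_measurable (config n)"
  shows "(LINT x|config n. h (x \<circ> \<pi>)) = (LINT x|config n. h x)"
  using integral_distr[OF measurable_comp_permutes[OF \<pi>] h] by (simp add: distr_comp_permutes[OF \<pi>])

lemma L2_inner_comp_permutes:
  fixes \<phi> \<psi> :: "(nat \<Rightarrow> real^'d::finite) \<Rightarrow> complex"
  assumes "\<pi> permutes {..<n}" "\<phi> \<in> L2_space (config n)" "\<psi> \<in> L2_space (config n)"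
  shows "L2_inner (config n) (\<lambda>x. \<phi> (x \<circ> \<pi>)) (\<lambda>x. \<psi> (x \<circ> \<pi>)) = L2_inner (config n) \<phi> \<psi>"
  unfolding L2_inner_def using assms(2,3)
  by (intro integral_comp_permutes[OF assms(1), of "\<lambda>x. cnj (\<phi> x) * \<psi> x"]) (auto dest!: L2_space_measurable)

lemma L2_norm_comp_permutes:
  fixes \<phi> :: "(nat \<Rightarrow> real^'d::finite) \<Rightarrow> complex"
  assumes "\<pi> permutes {..<n}" "\<phi> \<in> L2_space (config n)"
  shows "L2_norm (config n) (\<lambda>x. \<phi> (x \<circ> \<pi>)) = L2_norm (config n) \<phi>"
  unfolding L2_norm_def using assms(2)
  by (subst integral_comp_permutes[OF assms(1), of "\<lambda>x. (cmod (\<phi> x))\<^sup>2"]) (auto dest!: L2_space_measurable)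

section \<open>Splitting off the last particle\<close>

lemma measurable_append:
  "(\<lambda>(x, y). x(m := y)) \<in> measurable (config m \<Otimes>\<^sub>M lborel) (config (Suc m) :: (nat \<Rightarrow> real^'d::finite) measure)"
  unfolding lessThan_Suc by (rule measurable_add_dim)

text \<open>Both measures of a set are the same iterated integral of its indicator. Through this
  identification, Fubini's theorem for pairs applies to configurations.\<close>

lemma config_Suc_distr:
  "distr (config m \<Otimes>\<^sub>M lborel) (config (Suc m)) (\<lambda>(x, y). x(m := y)) = (config (Suc m) :: (nat \<Rightarrow> real^'d::finite) measure)"
proof (rule measure_eqI)
  fix A :: "(nat \<Rightarrow> real^'d) set"
  assume "A \<in> sets (distr (config m \<Otimes>\<^sub>M lborel) (config (Suc m)) (\<lambda>(x, y). x(m := y)))"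
  then have A[measurable]: "A \<in> sets (config (Suc m))" by simp
  note [measurable] = measurable_append[of m, where 'd='d]
  have "emeasure (distr (config m \<Otimes>\<^sub>M lborel) (config (Suc m)) (\<lambda>(x, y). x(m := y))) A =
    (\<integral>\<^sup>+z. indicator A z \<partial>distr (config m \<Otimes>\<^sub>M lborel) (config (Suc m)) (\<lambda>(x, y). x(m := y)))"
    by simp
  also have "\<dots> = (\<integral>\<^sup>+p. indicator A (case p of (x, y) \<Rightarrow> x(m := y)) \<partial>(config m \<Otimes>\<^sub>M lborel))"
    by (rule nn_integral_distr[OF measurable_append]) simp
  also have "\<dots> = (\<integral>\<^sup>+x. \<integral>\<^sup>+y. indicator A (x(m := y)) \<partial>lborel \<partial>config m)"
    using lborel.nn_integral_fst[of "\<lambda>p. indicator A (case p of (x, y) \<Rightarrow> x(m := y))" "config m", symmetric]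
    by simp
  also have "\<dots> = (\<integral>\<^sup>+z. indicator A z \<partial>config (Suc m))"
    unfolding lessThan_Suc using A
    by (intro config.product_nn_integral_insert[symmetric]) (auto simp: lessThan_Suc)
  also have "\<dots> = emeasure (config (Suc m)) A" by simp
  finally show "emeasure (distr (config m \<Otimes>\<^sub>M lborel) (config (Suc m)) (\<lambda>(x, y). x(m := y))) A = emeasure (config (Suc m)) A" .
qed simp

lemma nn_integral_config_Suc:
  assumes "F \<in> borel_measurable (config (Suc m) :: (nat \<Rightarrow> real^'d::finite) measure)"
  shows "(\<integral>\<^sup>+z. F z \<partial>config (Suc m)) = (\<integral>\<^sup>+x. \<integral>\<^sup>+y. F (x(m := y)) \<partial>lborel \<partial>config m)"
  using assms unfolding lessThan_Suc by (intro config.product_nn_integral_insert) auto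

lemma AE_config_SucD:
  fixes P :: "(nat \<Rightarrow> real^'d::finite) \<Rightarrow> bool"
  assumes "AE z in config (Suc m). P z"
  shows "AE x in config m. AE y in lborel. P (x(m := y))"
proof -
  have "AE p in config m \<Otimes>\<^sub>M lborel. P (case p of (x, y) \<Rightarrow> x(m := y))"
    by (rule AE_distrD[OF measurable_append]) (simp only: config_Suc_distr assms)
  from pair_sigma_finite.AE_pair[OF pair_sigma_finite_config this] show ?thesis by simp
qed

lemma restrict_space_config:
  "x \<in> space (config (Suc m)) \<Longrightarrow> restrict x {..<m} \<in> space (config m :: (nat \<Rightarrow> real^'d::finite) measure)"
  by (auto simp: space_PiM)

text \<open>The cylinder over a null set is null: the integral over the last coordinate is infinity
  times 0 for almost every \<open>x\<close>, which is 0. The restriction is required because points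
  of \<open>config m\<close> are \<open>undefined\<close> outside \<open>{..<m}\<close>.\<close>

lemma AE_config_SucI:
  fixes P :: "(nat \<Rightarrow> real^'d::finite) \<Rightarrow> bool"
  assumes "AE x in config m. P x"
  shows "AE z in config (Suc m). P (restrict z {..<m})"
proof -
  obtain N where N: "N \<in> null_sets (config m)" "\<And>x. x \<in> space (config m) \<Longrightarrow> x \<notin> N \<Longrightarrow> P x"
    using assms by (auto elim!: AE_E3)
  have [measurable]: "N \<in> sets (config m)" using N(1) by auto
  have m[measurable]: "(\<lambda>z. restrict z {..<m}) \<in> measurable (config (Suc m)) (config m :: (nat \<Rightarrow> real^'d) measure)"
    by (intro measurable_restrict_subset) auto
  have "(\<integral>\<^sup>+z. indicator N (restrict z {..<m}) \<partial>(config (Suc m) :: (nat \<Rightarrow> real^'d) measure))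
     = (\<integral>\<^sup>+x. \<integral>\<^sup>+y. indicator N (restrict (x(m := y)) {..<m}) \<partial>(lborel :: (real^'d) measure) \<partial>config m)"
    by (rule nn_integral_config_Suc) simp
  also have "\<dots> = (\<integral>\<^sup>+x. \<integral>\<^sup>+y. indicator N x \<partial>(lborel :: (real^'d) measure) \<partial>config m)"
  proof (intro nn_integral_cong)
    fix x y assume "x \<in> space (config m :: (nat \<Rightarrow> real^'d) measure)"
    then have "restrict (x(m := y)) {..<m} = x" by (auto simp: space_PiM PiE_def extensional_def restrict_def)
    then show "indicator N (restrict (x(m := y)) {..<m}) = (indicator N x :: ennreal)" by simp
  qed
  also have "\<dots> = 0"
  proof (subst nn_integral_0_iff_AE)
    show "(\<lambda>x. \<integral>\<^sup>+y. indicator N x \<partial>(lborel :: (real^'d) measure)) \<in> borel_measurable (config m)"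
      by measurable
    show "AE x in config m. (\<integral>\<^sup>+y. indicator N x \<partial>(lborel :: (real^'d) measure)) = 0"
      using AE_not_in[OF N(1)] by eventually_elim simp
  qed
  finally have "AE z in config (Suc m). (indicator N (restrict z {..<m}) :: ennreal) = 0"
    by (subst (asm) nn_integral_0_iff_AE) auto
  then show ?thesis
  proof (rule AE_mp, intro AE_I2 impI)
    fix z assume z: "z \<in> space (config (Suc m) :: (nat \<Rightarrow> real^'d) measure)" "(indicator N (restrict z {..<m}) :: ennreal) = 0"
    show "P (restrict z {..<m})" using N(2)[OF restrict_space_config[OF z(1)]] z(2) by (auto simp: indicator_def)
  qed
qed

lemma integral_config_Suc:
  fixes F :: "(nat \<Rightarrow> real^'d::finite) \<Rightarrow> complex"
  assumes F: "integrable (config (Suc m)) F"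
  shows "(LINT z|config (Suc m). F z) = (LINT x|config m. LINT y|lborel. F (x(m := y)))"
proof -
  have Fm: "F \<in> borel_measurable (config (Suc m))" using F by simp
  have "integrable (distr (config m \<Otimes>\<^sub>M lborel) (config (Suc m)) (\<lambda>(x, y). x(m := y))) F"
    by (simp only: config_Suc_distr F)
  then have i: "integrable (config m \<Otimes>\<^sub>M lborel) (\<lambda>p. F (case p of (x, y) \<Rightarrow> x(m := y)))"
    by (subst (asm) integrable_distr_eq[OF measurable_append Fm])
  have "(LINT z|config (Suc m). F z) = (LINT p|(config m \<Otimes>\<^sub>M lborel). F (case p of (x, y) \<Rightarrow> x(m := y)))"
    using integral_distr[OF measurable_append Fm] by (simp only: config_Suc_distr)
  also have "\<dots> = (LINT x|config m. LINT y|lborel. F (x(m := y)))"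
    using pair_sigma_finite.integral_fst'[OF pair_sigma_finite_config i] by simp
  finally show ?thesis .
qed

lemma restrict_append: "(restrict x {..<m})(m := y) = (x::nat \<Rightarrow> 'b)(m := y)" if "x \<in> extensional {..<Suc m}"
  using that by (auto simp: fun_eq_iff extensional_def restrict_def)

subsection \<open>Contraction of the last particle\<close>

text \<open>The annihilation operator from \<open>Suc m\<close> to \<open>m\<close> particles
  without its factor \<open>sqrt (Suc m)\<close>. The value does not depend on \<open>x m\<close>,
  so \<open>x\<close> may be a point of \<open>config m\<close> or of \<open>config (Suc m)\<close>;
  \<open>hop\<close> needs the latter.\<close>

definition contract :: "nat \<Rightarrow> (real^'d::finite \<Rightarrow> complex) \<Rightarrow> ((nat \<Rightarrow> real^'d) \<Rightarrow> complex) \<Rightarrow> (nat \<Rightarrow> real^'d) \<Rightarrow> complex" where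
  "contract m g \<phi> x = (LINT y|lborel. cnj (g y) * \<phi> (x(m := y)))"

lemma contract_update: "contract m g \<phi> (x(m := y)) = contract m g \<phi> x"
  by (simp add: contract_def)

lemma contract_restrict:
  "x \<in> space (config (Suc m)) \<Longrightarrow> contract m g \<phi> (restrict x {..<m}) = contract m g \<phi> x"
proof -
  assume "x \<in> space (config (Suc m))"
  then have "x \<in> extensional {..<Suc m}" by (simp add: space_PiM PiE_def)
  then show ?thesis by (simp only: contract_def restrict_append)
qed

lemma measurable_contract:
  assumes [measurable]: "g \<in> borel_measurable lborel" "\<phi> \<in> borel_measurable (config (Suc m))"
  shows "contract m g \<phi> \<in> borel_measurable (config m :: (nat \<Rightarrow> real^'d::finite) measure)"
proof -
  have [measurable]: "(\<lambda>p. \<phi> (case p of (x, y) \<Rightarrow> x(m := y))) \<in> borel_measurable (config m \<Otimes>\<^sub>M lborel)"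
    by (rule measurable_compose[OF measurable_append assms(2)])
  have "(\<lambda>p. cnj (g (snd p)) * \<phi> (case p of (x, y) \<Rightarrow> x(m := y))) \<in> borel_measurable (config m \<Otimes>\<^sub>M lborel)"
    by measurable
  then show ?thesis unfolding contract_def
    by (intro lborel.borel_measurable_lebesgue_integral) (simp add: case_prod_beta')
qed

lemma measurable_contract_Suc:
  assumes "g \<in> borel_measurable lborel" "\<phi> \<in> borel_measurable (config (Suc m))"
  shows "contract m g \<phi> \<in> borel_measurable (config (Suc m) :: (nat \<Rightarrow> real^'d::finite) measure)"
proof -
  have "(\<lambda>z. contract m g \<phi> (restrict z {..<m})) \<in> borel_measurable (config (Suc m))"
    by (rule measurable_compose[OF _ measurable_contract[OF assms]]) (intro measurable_restrict_subset, auto)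
  then show ?thesis by (subst (asm) measurable_cong[OF contract_restrict])
qed

text \<open>By Tonelli the squared norms of the sections have a finite integral, so almost all of
  them are finite.\<close>

lemma L2_section:
  fixes \<phi> :: "(nat \<Rightarrow> real^'d::finite) \<Rightarrow> complex"
  assumes \<phi>: "\<phi> \<in> L2_space (config (Suc m))"
  shows "AE x in config m. (\<lambda>y. \<phi> (x(m := y))) \<in> L2_space lborel"
proof -
  have [measurable]: "\<phi> \<in> borel_measurable (config (Suc m))" using \<phi> by (rule L2_space_measurable)
  have m: "(\<lambda>p. \<phi> (case p of (x, y) \<Rightarrow> x(m := y))) \<in> borel_measurable (config m \<Otimes>\<^sub>M lborel)"
    by (rule measurable_compose[OF measurable_append]) simp
  have m2: "(\<lambda>x. \<integral>\<^sup>+y. ennreal ((cmod (\<phi> (x(m := y))))\<^sup>2) \<partial>lborel) \<in> borel_measurable (config m)"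
    using m by (intro lborel.borel_measurable_nn_integral) (simp add: case_prod_beta')
  have "(\<integral>\<^sup>+x. \<integral>\<^sup>+y. ennreal ((cmod (\<phi> (x(m := y))))\<^sup>2) \<partial>lborel \<partial>config m) < \<infinity>"
    using \<phi> by (subst nn_integral_config_Suc[symmetric]) (auto simp: L2_space_iff_nn_integral)
  then have "AE x in config m. (\<integral>\<^sup>+y. ennreal ((cmod (\<phi> (x(m := y))))\<^sup>2) \<partial>lborel) \<noteq> \<infinity>"
    by (intro nn_integral_noteq_infinite m2) auto
  then show ?thesis
  proof (rule AE_mp, intro AE_I2 impI)
    fix x assume x: "x \<in> space (config m :: (nat \<Rightarrow> real^'d) measure)"
      and fin: "(\<integral>\<^sup>+y. ennreal ((cmod (\<phi> (x(m := y))))\<^sup>2) \<partial>lborel) \<noteq> \<infinity>"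
    have "(\<lambda>y. \<phi> (x(m := y))) \<in> borel_measurable lborel"
      using measurable_compose[OF measurable_Pair1'[OF x] m] by simp
    with fin show "(\<lambda>y. \<phi> (x(m := y))) \<in> L2_space lborel"
      by (auto simp: L2_space_iff_nn_integral top.not_eq_extremum)
  qed
qed

text \<open>Cauchy-Schwarz in the last coordinate for almost every position of the others, followed
  by integration over these positions.\<close>

lemma nn_integral_contract_le:
  fixes \<phi> :: "(nat \<Rightarrow> real^'d::finite) \<Rightarrow> complex"
  assumes g: "g \<in> L2_space lborel" and \<phi>: "\<phi> \<in> L2_space (config (Suc m))"
  shows "(\<integral>\<^sup>+x. ennreal ((cmod (contract m g \<phi> x))\<^sup>2) \<partial>config m)
    \<le> ennreal ((L2_norm lborel g)\<^sup>2 * (L2_norm (config (Suc m)) \<phi>)\<^sup>2)"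
proof -
  have [measurable]: "\<phi> \<in> borel_measurable (config (Suc m))" using \<phi> by (rule L2_space_measurable)
  have m: "(\<lambda>p. \<phi> (case p of (x, y) \<Rightarrow> x(m := y))) \<in> borel_measurable (config m \<Otimes>\<^sub>M lborel)"
    by (rule measurable_compose[OF measurable_append]) simp
  have m2: "(\<lambda>x. \<integral>\<^sup>+y. ennreal ((cmod (\<phi> (x(m := y))))\<^sup>2) \<partial>lborel) \<in> borel_measurable (config m)"
    using m by (intro lborel.borel_measurable_nn_integral) (simp add: case_prod_beta')
  have "(\<integral>\<^sup>+x. ennreal ((cmod (contract m g \<phi> x))\<^sup>2) \<partial>config m)
     \<le> (\<integral>\<^sup>+x. ennreal ((L2_norm lborel g)\<^sup>2) * (\<integral>\<^sup>+y. ennreal ((cmod (\<phi> (x(m := y))))\<^sup>2) \<partial>lborel) \<partial>config m)"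
  proof (rule nn_integral_mono_AE, use L2_section[OF \<phi>] in eventually_elim)
    fix x assume x: "(\<lambda>y. \<phi> (x(m := y))) \<in> L2_space lborel"
    have "cmod (contract m g \<phi> x) \<le> L2_norm lborel g * L2_norm lborel (\<lambda>y. \<phi> (x(m := y)))"
      using L2_Cauchy_Schwarz[OF g x] by (simp add: contract_def L2_inner_def)
    then have "(cmod (contract m g \<phi> x))\<^sup>2 \<le> (L2_norm lborel g)\<^sup>2 * (L2_norm lborel (\<lambda>y. \<phi> (x(m := y))))\<^sup>2"
      by (metis power_mono power_mult_distrib norm_ge_zero)
    then show "ennreal ((cmod (contract m g \<phi> x))\<^sup>2)
        \<le> ennreal ((L2_norm lborel g)\<^sup>2) * (\<integral>\<^sup>+y. ennreal ((cmod (\<phi> (x(m := y))))\<^sup>2) \<partial>lborel)"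
      by (simp add: nn_integral_L2_norm[OF x] ennreal_mult[symmetric] ennreal_leI)
  qed
  also have "\<dots> = ennreal ((L2_norm lborel g)\<^sup>2) * (\<integral>\<^sup>+x. \<integral>\<^sup>+y. ennreal ((cmod (\<phi> (x(m := y))))\<^sup>2) \<partial>lborel \<partial>config m)"
    by (rule nn_integral_cmult[OF m2])
  also have "(\<integral>\<^sup>+x. \<integral>\<^sup>+y. ennreal ((cmod (\<phi> (x(m := y))))\<^sup>2) \<partial>lborel \<partial>config m) = ennreal ((L2_norm (config (Suc m)) \<phi>)\<^sup>2)"
    by (subst nn_integral_config_Suc[symmetric]) (auto simp: nn_integral_L2_norm[OF \<phi>])
  finally show ?thesis by (simp add: ennreal_mult)
qed

lemma L2_contract:
  fixes \<phi> :: "(nat \<Rightarrow> real^'d::finite) \<Rightarrow> complex"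
  assumes g: "g \<in> L2_space lborel" and \<phi>: "\<phi> \<in> L2_space (config (Suc m))"
  shows "contract m g \<phi> \<in> L2_space (config m)"
    and "(L2_norm (config m) (contract m g \<phi>))\<^sup>2 \<le> (L2_norm lborel g)\<^sup>2 * (L2_norm (config (Suc m)) \<phi>)\<^sup>2"
proof -
  show 1: "contract m g \<phi> \<in> L2_space (config m)"
    unfolding L2_space_iff_nn_integral
    using nn_integral_contract_le[OF assms] measurable_contract[OF g[THEN L2_space_measurable] \<phi>[THEN L2_space_measurable]]
    by (auto elim: le_less_trans)
  show "(L2_norm (config m) (contract m g \<phi>))\<^sup>2 \<le> (L2_norm lborel g)\<^sup>2 * (L2_norm (config (Suc m)) \<phi>)\<^sup>2"
    using nn_integral_contract_le[OF assms] by (simp add: nn_integral_L2_norm[OF 1])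
qed

text \<open>Linearity can fail at exceptional points: where a section is not integrable, the
  integral takes its default value 0. The same holds in the argument \<open>g\<close> below.\<close>

lemma contract_lin_right:
  fixes \<phi> \<psi> :: "(nat \<Rightarrow> real^'d::finite) \<Rightarrow> complex"
  assumes g: "g \<in> L2_space lborel" and \<phi>: "\<phi> \<in> L2_space (config (Suc m))" and \<psi>: "\<psi> \<in> L2_space (config (Suc m))"
  shows "AE x in config m. contract m g (\<lambda>z. \<phi> z + c * \<psi> z) x = contract m g \<phi> x + c * contract m g \<psi> x"
  using L2_section[OF \<phi>] L2_section[OF \<psi>]
proof eventually_elim
  case (elim x)
  then show ?case
    using positive_form.lin_right[OF L2_positive_form g, of "\<lambda>y. \<phi> (x(m := y))" "\<lambda>y. \<psi> (x(m := y))" c]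
    by (simp add: contract_def L2_inner_def)
qed

lemma contract_lin_left:
  fixes \<phi> :: "(nat \<Rightarrow> real^'d::finite) \<Rightarrow> complex"
  assumes g: "g \<in> L2_space lborel" and h: "h \<in> L2_space lborel" and \<phi>: "\<phi> \<in> L2_space (config (Suc m))"
  shows "AE x in config m. contract m (\<lambda>y. g y + c * h y) \<phi> x = contract m g \<phi> x + cnj c * contract m h \<phi> x"
  using L2_section[OF \<phi>]
proof eventually_elim
  case (elim x)
  then show ?case
    using positive_form.lin_left[OF L2_positive_form elim g h, of c]
    by (simp add: contract_def L2_inner_def)
qed

text \<open>\<open>hop m f g\<close> is the rank one operator \<open>|f\<rangle>\<langle>g|\<close> acting on the last particle.\<close>

definition hop :: "nat \<Rightarrow> (real^'d::finite \<Rightarrow> complex) \<Rightarrow> (real^'d \<Rightarrow> complex) \<Rightarrow> ((nat \<Rightarrow> real^'d) \<Rightarrow> complex) \<Rightarrow> (nat \<Rightarrow> real^'d) \<Rightarrow> complex" where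
  "hop m f g \<phi> x = f (x m) * contract m g \<phi> x"

lemma L2_hop:
  fixes \<phi> :: "(nat \<Rightarrow> real^'d::finite) \<Rightarrow> complex"
  assumes f: "f \<in> L2_space lborel" and g: "g \<in> L2_space lborel" and \<phi>: "\<phi> \<in> L2_space (config (Suc m))"
  shows "hop m f g \<phi> \<in> L2_space (config (Suc m))"
proof -
  have [measurable]: "f \<in> borel_measurable lborel" using f by (rule L2_space_measurable)
  have c[measurable]: "contract m g \<phi> \<in> borel_measurable (config (Suc m))"
    using g \<phi> by (intro measurable_contract_Suc L2_space_measurable)
  have fm[measurable]: "(\<lambda>z. f (z m)) \<in> borel_measurable (config (Suc m))"
    by (rule measurable_compose[OF measurable_component_singleton]) auto
  have "(\<integral>\<^sup>+z. ennreal ((cmod (hop m f g \<phi> z))\<^sup>2) \<partial>config (Suc m)) =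
    (\<integral>\<^sup>+x. \<integral>\<^sup>+y. ennreal ((cmod (hop m f g \<phi> (x(m := y))))\<^sup>2) \<partial>lborel \<partial>config m)"
    by (rule nn_integral_config_Suc) (auto simp: hop_def[abs_def])
  also have "\<dots> = (\<integral>\<^sup>+x. ennreal ((cmod (contract m g \<phi> x))\<^sup>2) * ennreal ((L2_norm lborel f)\<^sup>2) \<partial>config m)"
  proof (intro nn_integral_cong)
    fix x
    have "(\<integral>\<^sup>+y. ennreal ((cmod (hop m f g \<phi> (x(m := y))))\<^sup>2) \<partial>lborel) =
      (\<integral>\<^sup>+y. ennreal ((cmod (contract m g \<phi> x))\<^sup>2) * ennreal ((cmod (f y))\<^sup>2) \<partial>lborel)"
      by (intro nn_integral_cong) (simp add: hop_def contract_update norm_mult power_mult_distrib ennreal_mult mult.commute)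
    then show "(\<integral>\<^sup>+y. ennreal ((cmod (hop m f g \<phi> (x(m := y))))\<^sup>2) \<partial>lborel) =
        ennreal ((cmod (contract m g \<phi> x))\<^sup>2) * ennreal ((L2_norm lborel f)\<^sup>2)"
      by (simp add: nn_integral_cmult nn_integral_L2_norm[OF f])
  qed
  also have "\<dots> = (\<integral>\<^sup>+x. ennreal ((cmod (contract m g \<phi> x))\<^sup>2) \<partial>config m) * ennreal ((L2_norm lborel f)\<^sup>2)"
    by (rule nn_integral_multc) (use L2_contract(1)[OF g \<phi>] in \<open>auto dest!: L2_space_measurable\<close>)
  also have "\<dots> < \<infinity>"
    using L2_contract(1)[OF g \<phi>] by (simp add: L2_space_iff_nn_integral ennreal_mult_less_top)
  finally show ?thesis
    unfolding L2_space_iff_nn_integral by (simp add: hop_def[abs_def])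
qed

text \<open>For fixed positions of the other particles the contraction with \<open>g\<close> is
  constant in the last coordinate, so integrating that coordinate contracts \<phi> with
  \<open>f\<close>.\<close>

lemma inner_hop:
  fixes \<phi> \<psi> :: "(nat \<Rightarrow> real^'d::finite) \<Rightarrow> complex"
  assumes f: "f \<in> L2_space lborel" and g: "g \<in> L2_space lborel"
    and \<phi>: "\<phi> \<in> L2_space (config (Suc m))" and \<psi>: "\<psi> \<in> L2_space (config (Suc m))"
  shows "L2_inner (config (Suc m)) \<phi> (hop m f g \<psi>) = L2_inner (config m) (contract m f \<phi>) (contract m g \<psi>)"
proof -
  have "L2_inner (config (Suc m)) \<phi> (hop m f g \<psi>) =
      (LINT x|config m. LINT y|lborel. cnj (\<phi> (x(m := y))) * hop m f g \<psi> (x(m := y)))"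
    unfolding L2_inner_def by (intro integral_config_Suc L2_integrable_inner \<phi> L2_hop f g \<psi>)
  also have "\<dots> = (LINT x|config m. cnj (contract m f \<phi> x) * contract m g \<psi> x)"
  proof (intro Bochner_Integration.integral_cong refl)
    fix x
    have "cnj (contract m f \<phi> x) = (LINT y|lborel. cnj (cnj (f y) * \<phi> (x(m := y))))"
      unfolding contract_def by (rule Bochner_Integration.integral_cnj[symmetric])
    then have "cnj (contract m f \<phi> x) * contract m g \<psi> x = (LINT y|lborel. cnj (cnj (f y) * \<phi> (x(m := y))) * contract m g \<psi> x)"
      by (simp only: integral_mult_left_zero)
    then show "(LINT y|lborel. cnj (\<phi> (x(m := y))) * hop m f g \<psi> (x(m := y))) = cnj (contract m f \<phi> x) * contract m g \<psi> x"
      by (simp only: hop_def contract_update fun_upd_same complex_cnj_mult complex_cnj_cnj mult.commute mult.left_commute mult.assoc)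
  qed
  finally show ?thesis by (simp only: L2_inner_def)
qed

lemma L2_space_cong:
  assumes "\<And>x. x \<in> space M \<Longrightarrow> f x = g x"
  shows "f \<in> L2_space M \<longleftrightarrow> g \<in> L2_space M"
proof -
  have "f \<in> borel_measurable M \<longleftrightarrow> g \<in> borel_measurable M"
    using assms by (rule measurable_cong)
  moreover have "integrable M (\<lambda>x. (cmod (f x))\<^sup>2) \<longleftrightarrow> integrable M (\<lambda>x. (cmod (g x))\<^sup>2)"
    using assms by (intro Bochner_Integration.integrable_cong refl) simp
  ultimately show ?thesis by (simp add: L2_space_def)
qed

lemma L2_inner_cong:
  assumes "\<And>x. x \<in> space M \<Longrightarrow> f x = f' x" "\<And>x. x \<in> space M \<Longrightarrow> g x = g' x"
  shows "L2_inner M f g = L2_inner M f' g'"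
  unfolding L2_inner_def using assms by (intro Bochner_Integration.integral_cong refl) simp

text \<open>Hermiticity comes for free: the values at \<open>f + c g\<close> are real, and the
  choices \<open>c = 1\<close> and \<open>c = \<i>\<close> determine both parts of
  \<open>q g f\<close>. Density matrices and states are known only through such diagonal
  values.\<close>

lemma positive_form_polarization:
  fixes V :: "('a \<Rightarrow> complex) set"
  assumes zero: "(\<lambda>_. 0) \<in> V"
    and mem: "\<And>f g c. f \<in> V \<Longrightarrow> g \<in> V \<Longrightarrow> (\<lambda>x. f x + c * g x) \<in> V"
    and right: "\<And>f g h c. f \<in> V \<Longrightarrow> g \<in> V \<Longrightarrow> h \<in> V \<Longrightarrow> q f (\<lambda>x. g x + c * h x) = q f g + c * q f h"
    and left: "\<And>f g h c. f \<in> V \<Longrightarrow> g \<in> V \<Longrightarrow> h \<in> V \<Longrightarrow> q (\<lambda>x. g x + c * h x) f = q g f + cnj c * q h f"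
    and nonneg: "\<And>f. f \<in> V \<Longrightarrow> q f f \<in> \<real>\<^sub>\<ge>\<^sub>0"
  shows "positive_form V q"
proof
  fix f g assume fg: "f \<in> V" "g \<in> V"
  have im: "Im (q h h) = 0" if "h \<in> V" for h
    using nonneg[OF that] by (simp add: complex_nonneg_Reals_iff)
  have "Im (q (\<lambda>x. f x + c * g x) (\<lambda>x. f x + c * g x)) = 0" for c
    using fg by (intro im mem)
  moreover have "q (\<lambda>x. f x + c * g x) (\<lambda>x. f x + c * g x) = q f f + c * q f g + cnj c * (q g f + c * q g g)" for c
    using fg mem by (simp add: left right)
  ultimately have key: "Im (q f f + c * q f g + cnj c * (q g f + c * q g g)) = 0" for c by simp
  show "q g f = cnj (q f g)"
    using key[of 1] key[of \<i>] im[OF fg(1)] im[OF fg(2)]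
    by (simp add: complex_eq_iff)
qed (use assms in \<open>auto simp: complex_nonneg_Reals_iff\<close>)

subsection \<open>Symmetric wave functions\<close>

definition sym_L2 :: "nat \<Rightarrow> ((nat \<Rightarrow> real^'d::finite) \<Rightarrow> complex) set" where
  "sym_L2 n = {\<phi> \<in> L2_space (config n). \<forall>\<pi>. \<pi> permutes {..<n} \<longrightarrow> (AE x in config n. \<phi> (x \<circ> \<pi>) = \<phi> x)}"

lemma sym_L2_subset: "sym_L2 n \<subseteq> L2_space (config n)"
  by (auto simp: sym_L2_def)

lemma sym_L2_D: "\<phi> \<in> sym_L2 n \<Longrightarrow> \<pi> permutes {..<n} \<Longrightarrow> AE x in config n. \<phi> (x \<circ> \<pi>) = \<phi> x"
  by (auto simp: sym_L2_def)

lemma zero_sym_L2: "(\<lambda>_. 0) \<in> sym_L2 n"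
  by (auto simp: sym_L2_def L2_zero_mem)

lemma lin_sym_L2:
  assumes "\<phi> \<in> sym_L2 n" "\<psi> \<in> sym_L2 n"
  shows "(\<lambda>x. \<phi> x + c * \<psi> x) \<in> sym_L2 n"
proof -
  have "AE x in config n. \<phi> (x \<circ> \<pi>) + c * \<psi> (x \<circ> \<pi>) = \<phi> x + c * \<psi> x" if "\<pi> permutes {..<n}" for \<pi>
    using sym_L2_D[OF assms(1) that] sym_L2_D[OF assms(2) that] by eventually_elim simp
  then show ?thesis using assms by (auto simp: sym_L2_def intro: L2_lin_mem)
qed

text \<open>Permutations act isometrically and fix each \<open>F k\<close> almost everywhere, so
  \<open>f \<circ> \<pi>\<close> is as close to \<open>F k\<close> as \<open>f\<close> is. The
  factor 4 stems from \<open>lin_self_le\<close>.\<close>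

lemma sym_L2_closed: "L2_closed (config n) (sym_L2 n :: ((nat \<Rightarrow> real^'d::finite) \<Rightarrow> complex) set)"
  unfolding L2_closed_def
proof (intro allI impI)
  fix F :: "nat \<Rightarrow> (nat \<Rightarrow> real^'d) \<Rightarrow> complex" and f
  assume F: "\<forall>k. F k \<in> sym_L2 n" and f: "f \<in> L2_space (config n)"
    and lim: "(\<lambda>k. L2_norm (config n) (\<lambda>x. F k x - f x)) \<longlonglongrightarrow> 0"
  have FL: "F k \<in> L2_space (config n)" for k using F sym_L2_subset by blast
  have "AE x in config n. f (x \<circ> \<pi>) = f x" if \<pi>: "\<pi> permutes {..<n}" for \<pi>
  proof -
    have f\<pi>: "(\<lambda>x. f (x \<circ> \<pi>)) \<in> L2_space (config n)" by (rule L2_comp_permutes[OF \<pi> f])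
    have le: "(L2_norm (config n) (\<lambda>x. f (x \<circ> \<pi>) - f x))\<^sup>2 \<le> 4 * (L2_norm (config n) (\<lambda>x. F k x - f x))\<^sup>2" for k
    proof -
      have "L2_norm (config n) (\<lambda>x. f (x \<circ> \<pi>) - F k x) = L2_norm (config n) (\<lambda>x. f (x \<circ> \<pi>) - F k (x \<circ> \<pi>))"
      proof (rule L2_norm_AE_cong)
        have "AE x in config n. F k (x \<circ> \<pi>) = F k x" using F by (intro sym_L2_D \<pi>) auto
        then show "AE x in config n. f (x \<circ> \<pi>) - F k x = f (x \<circ> \<pi>) - F k (x \<circ> \<pi>)" by eventually_elim simp
      qed (intro L2_diff_mem f\<pi> FL L2_comp_permutes[OF \<pi>])+
      also have "\<dots> = L2_norm (config n) (\<lambda>x. f x - F k x)"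
        by (rule L2_norm_comp_permutes[OF \<pi> L2_diff_mem[OF f FL]])
      also have "\<dots> = L2_norm (config n) (\<lambda>x. F k x - f x)" by (rule L2_norm_diff_commute)
      finally have "L2_norm (config n) (\<lambda>x. f (x \<circ> \<pi>) - F k x) = L2_norm (config n) (\<lambda>x. F k x - f x)" .
      then show ?thesis
        using positive_form.lin_self_le[OF L2_positive_form L2_diff_mem[OF f\<pi> FL[of k]] L2_diff_mem[OF FL[of k] f], of 1]
        by (simp add: Re_L2_inner_self)
    qed
    have "(\<lambda>k. 4 * (L2_norm (config n) (\<lambda>x. F k x - f x))\<^sup>2) \<longlonglongrightarrow> 4 * 0\<^sup>2"
      by (intro tendsto_intros lim)
    then have "(L2_norm (config n) (\<lambda>x. f (x \<circ> \<pi>) - f x))\<^sup>2 \<le> 4 * 0\<^sup>2"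
      by (rule LIMSEQ_le_const) (use le in blast)
    then have "L2_norm (config n) (\<lambda>x. f (x \<circ> \<pi>) - f x) = 0" by simp
    then have "AE x in config n. f (x \<circ> \<pi>) - f x = 0"
      by (simp only: L2_norm_eq_0_iff[OF L2_diff_mem[OF f\<pi> f]])
    then show ?thesis by simp
  qed
  with f show "f \<in> sym_L2 n" by (simp add: sym_L2_def)
qed

section \<open>Particle number blocks of creation and annihilation operators\<close>

definition embed :: "nat \<Rightarrow> ((nat \<Rightarrow> real^'d::finite) \<Rightarrow> complex) \<Rightarrow> 'd fock" where
  "embed n \<phi> = (\<lambda>k x. if k = n then \<phi> x else 0)"

lemma embed_same [simp]: "embed n \<phi> n = \<phi>"
  by (simp add: embed_def)

lemma embed_lin: "embed n (\<lambda>x. \<phi> x + c * \<psi> x) = (\<lambda>k x. embed n \<phi> k x + c * embed n \<psi> k x)"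
  by (auto simp: embed_def fun_eq_iff)

text \<open>The n-particle block of \<open>creation f \<circ> annihilation g\<close>, the second
  quantization of the rank one operator |f><g|.\<close>

definition number_op :: "nat \<Rightarrow> (real^'d::finite \<Rightarrow> complex) \<Rightarrow> (real^'d \<Rightarrow> complex) \<Rightarrow> ((nat \<Rightarrow> real^'d) \<Rightarrow> complex) \<Rightarrow> (nat \<Rightarrow> real^'d) \<Rightarrow> complex" where
  "number_op n f g \<phi> = creation f (annihilation g (embed n \<phi>)) n"

text \<open>Particle number is preserved at every point and not merely almost everywhere. For
  \<open>k = 0\<close> the truncated \<open>k - 1\<close> does no harm, as the sum in
  \<open>creation\<close> is empty.\<close>

lemma creation_annihilation_embed:
  "creation f (annihilation g (embed n \<phi>)) = embed n (number_op n f g \<phi>)"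
  by (auto simp: fun_eq_iff embed_def number_op_def creation_def annihilation_def)

lemma number_op_0: "number_op 0 f g \<phi> = (\<lambda>_. 0)"
  by (simp add: number_op_def creation_def fun_eq_iff)

abbreviation exchange :: "nat \<Rightarrow> nat \<Rightarrow> nat \<Rightarrow> nat" where
  "exchange m j \<equiv> Transposition.transpose j m"

lemma exchange_permutes: "j < Suc m \<Longrightarrow> exchange m j permutes {..<Suc m}"
  by (intro permutes_swap_id) auto

text \<open>The two factors \<open>sqrt (Suc m)\<close> cancel. Removing particle \<open>j\<close>
  and filling its place with the last one is the same, away from the overwritten position
  \<open>m\<close>, as exchanging \<open>j\<close> and \<open>m\<close>.\<close>

lemma number_op_Suc:
  fixes x :: "nat \<Rightarrow> real^'d::finite"
  assumes "x \<in> space (config (Suc m))"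
  shows "number_op (Suc m) f g \<phi> x = (\<Sum>j<Suc m. hop m f g \<phi> (x \<circ> exchange m j))"
proof -
  have x: "x \<in> extensional {..<Suc m}" using assms by (simp add: space_PiM PiE_def)
  have upd: "(restrict (x(j := x m)) {..<m})(m := y) = (x \<circ> exchange m j)(m := y)" if "j < Suc m" for j y
    using x that by (auto simp: fun_eq_iff extensional_def restrict_def Transposition.transpose_def)
  have "number_op (Suc m) f g \<phi> x =
      (\<Sum>j<Suc m. f (x j) * (complex_of_real (sqrt (real (Suc m))) * contract m g \<phi> (restrict (x(j := x m)) {..<m}))) /
        complex_of_real (sqrt (real (Suc m)))"
    by (simp add: number_op_def creation_def annihilation_def contract_def)
  also have "\<dots> = (\<Sum>j<Suc m. f (x j) * contract m g \<phi> (restrict (x(j := x m)) {..<m}))"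
    unfolding sum_divide_distrib by (intro sum.cong refl) simp
  also have "\<dots> = (\<Sum>j<Suc m. hop m f g \<phi> (x \<circ> exchange m j))"
  proof (intro sum.cong refl)
    fix j assume "j \<in> {..<Suc m}"
    then have "contract m g \<phi> (restrict (x(j := x m)) {..<m}) = contract m g \<phi> (x \<circ> exchange m j)"
      by (simp only: contract_def upd lessThan_iff)
    then show "f (x j) * contract m g \<phi> (restrict (x(j := x m)) {..<m}) = hop m f g \<phi> (x \<circ> exchange m j)"
      by (simp add: hop_def)
  qed
  finally show ?thesis .
qed

lemma AE_config_Suc_exchange:
  fixes P :: "(nat \<Rightarrow> real^'d::finite) \<Rightarrow> bool"
  assumes "AE x in config m. P x"
  shows "AE z in config (Suc m). \<forall>j\<in>{..<Suc m}. P (restrict (z \<circ> exchange m j) {..<m})"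
  by (intro eventually_ball_finite finite_lessThan ballI AE_comp_permutes[OF exchange_permutes AE_config_SucI[OF assms]]) simp

text \<open>Carries an almost everywhere relation between contractions to all summands of
  \<open>number_op_Suc\<close> simultaneously. Three values fit the linearity relation: the
  contraction of a combination and those of its two constituents.\<close>

lemma contract_AE_exchange:
  fixes P :: "complex \<Rightarrow> complex \<Rightarrow> complex \<Rightarrow> bool"
  assumes "AE x in config m. P (contract m g \<phi> x) (contract m g' \<phi>' x) (contract m g'' \<phi>'' x)"
  shows "AE z in (config (Suc m) :: (nat \<Rightarrow> real^'d::finite) measure). \<forall>j\<in>{..<Suc m}.
     P (contract m g \<phi> (z \<circ> exchange m j)) (contract m g' \<phi>' (z \<circ> exchange m j)) (contract m g'' \<phi>'' (z \<circ> exchange m j))"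
  using AE_config_Suc_exchange[OF assms]
proof (rule AE_mp, intro AE_I2 impI ballI)
  fix z :: "nat \<Rightarrow> real^'d" and j
  assume z: "z \<in> space (config (Suc m))" and j: "j \<in> {..<Suc m}"
    and P: "\<forall>j\<in>{..<Suc m}. P (contract m g \<phi> (restrict (z \<circ> exchange m j) {..<m}))
      (contract m g' \<phi>' (restrict (z \<circ> exchange m j) {..<m})) (contract m g'' \<phi>'' (restrict (z \<circ> exchange m j) {..<m}))"
  have "z \<circ> exchange m j \<in> space (config (Suc m))"
    using j by (intro comp_permutes_space exchange_permutes z) auto
  with bspec[OF P j]
  show "P (contract m g \<phi> (z \<circ> exchange m j)) (contract m g' \<phi>' (z \<circ> exchange m j)) (contract m g'' \<phi>'' (z \<circ> exchange m j))"
    by (simp only: contract_restrict)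
qed

lemma L2_number_op:
  fixes f g :: "real^'d::finite \<Rightarrow> complex"
  assumes "f \<in> L2_space lborel" "g \<in> L2_space lborel" "\<phi> \<in> L2_space (config n)"
  shows "number_op n f g \<phi> \<in> L2_space (config n)"
proof (cases n)
  case 0
  then show ?thesis by (simp add: number_op_0 L2_zero_mem)
next
  case (Suc m)
  have "(\<lambda>x. \<Sum>j<Suc m. 1 * hop m f g \<phi> (x \<circ> exchange m j)) \<in> L2_space (config (Suc m))"
    by (rule positive_form.sum_mem[OF L2_positive_form])
      (use assms Suc in \<open>auto intro!: L2_comp_permutes[OF exchange_permutes] L2_hop\<close>)
  then show ?thesis unfolding Suc
    by (subst L2_space_cong[OF number_op_Suc]) simp_all
qed

text \<open>A permutation of the first \<open>m\<close> particles fixes position \<open>m\<close>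
  and therefore commutes with inserting the integration variable there.\<close>

lemma contract_symmetric:
  fixes \<phi> :: "(nat \<Rightarrow> real^'d::finite) \<Rightarrow> complex"
  assumes g: "g \<in> L2_space lborel" and \<phi>: "\<phi> \<in> sym_L2 (Suc m)" and \<sigma>: "\<sigma> permutes {..<m}"
  shows "AE z in config (Suc m). contract m g \<phi> (z \<circ> \<sigma>) = contract m g \<phi> z"
proof -
  have \<sigma>': "\<sigma> permutes {..<Suc m}" using \<sigma> by (rule permutes_subset) auto
  have \<phi>L: "\<phi> \<in> L2_space (config (Suc m))" using \<phi> sym_L2_subset by blast
  note AE_config_SucD[OF sym_L2_D[OF \<phi> \<sigma>']]
  moreover note L2_section[OF \<phi>L]
  moreover note AE_comp_permutes[OF \<sigma> L2_section[OF \<phi>L]]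
  ultimately have "AE x in config m. contract m g \<phi> (x \<circ> \<sigma>) = contract m g \<phi> x"
  proof eventually_elim
    case (elim x)
    have upd: "x(m := y) \<circ> \<sigma> = (x \<circ> \<sigma>)(m := y)" for y
    proof (rule ext)
      fix i
      have "\<sigma> m = m" using permutes_not_in[OF \<sigma>, of m] by simp
      then have "\<sigma> i = m \<longleftrightarrow> i = m" using inj_eq[OF permutes_inj[OF \<sigma>], of i m] by simp
      then show "(x(m := y) \<circ> \<sigma>) i = ((x \<circ> \<sigma>)(m := y)) i" by simp
    qed
    show ?case unfolding contract_def
    proof (rule integral_cong_AE)
      show "AE y in lborel. cnj (g y) * \<phi> ((x \<circ> \<sigma>)(m := y)) = cnj (g y) * \<phi> (x(m := y))"
        using elim(1) unfolding upd by eventually_elim simp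
    qed (use g elim(2,3) in \<open>auto dest!: L2_space_measurable\<close>)
  qed
  from AE_config_SucI[OF this] show ?thesis
  proof (rule AE_mp, intro AE_I2 impI)
    fix z :: "nat \<Rightarrow> real^'d"
    assume z: "z \<in> space (config (Suc m))"
      and eq: "contract m g \<phi> (restrict z {..<m} \<circ> \<sigma>) = contract m g \<phi> (restrict z {..<m})"
    have "restrict z {..<m} \<circ> \<sigma> = restrict (z \<circ> \<sigma>) {..<m}"
      using permutes_in_image[OF \<sigma>] by (auto simp: fun_eq_iff restrict_def)
    with eq show "contract m g \<phi> (z \<circ> \<sigma>) = contract m g \<phi> z"
      by (simp only: contract_restrict z comp_permutes_space[OF \<sigma>'])
  qed
qed

text \<open>A permutation \<pi> carries the summand of particle \<open>j\<close> to that of particle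
  \<open>\<pi> j\<close>, up to reordering the particles that are not contracted, which symmetry of
  \<phi> makes invisible.\<close>

lemma sym_L2_number_op:
  fixes f g :: "real^'d::finite \<Rightarrow> complex"
  assumes f: "f \<in> L2_space lborel" and g: "g \<in> L2_space lborel" and \<phi>: "\<phi> \<in> sym_L2 n"
  shows "number_op n f g \<phi> \<in> sym_L2 n"
proof (cases n)
  case 0
  then show ?thesis by (simp add: number_op_0 zero_sym_L2)
next
  case (Suc m)
  have "AE x in config (Suc m). number_op (Suc m) f g \<phi> (x \<circ> \<pi>) = number_op (Suc m) f g \<phi> x"
    if \<pi>: "\<pi> permutes {..<Suc m}" for \<pi>
  proof -
    have \<pi>j: "\<pi> j < Suc m" if "j < Suc m" for j using permutes_in_image[OF \<pi>, of j] that by simp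
    \<comment> \<open>The reordering that remains: it sends \<open>m\<close> to \<open>j\<close>,
      then to \<open>\<pi> j\<close>, then back to \<open>m\<close>, so it permutes only the first
      \<open>m\<close> particles.\<close>
    define \<sigma> where "\<sigma> j = exchange m (\<pi> j) \<circ> \<pi> \<circ> exchange m j" for j
    have \<sigma>: "\<sigma> j permutes {..<m}" if j: "j < Suc m" for j
    proof (rule permutes_superset)
      show "\<sigma> j permutes {..<Suc m}"
        unfolding \<sigma>_def using j \<pi>j by (intro permutes_compose exchange_permutes \<pi>)
      show "\<And>x. x \<in> {..<Suc m} - {..<m} \<Longrightarrow> \<sigma> j x = x"
        by (auto simp: \<sigma>_def less_Suc_eq)
    qed
    have "AE x in config (Suc m). contract m g \<phi> (x \<circ> \<pi> \<circ> exchange m j) = contract m g \<phi> (x \<circ> exchange m (\<pi> j))"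
      if "j \<in> {..<Suc m}" for j
    proof -
      have j: "j < Suc m" using that by simp
      have "AE x in config (Suc m). contract m g \<phi> (x \<circ> exchange m (\<pi> j) \<circ> \<sigma> j) = contract m g \<phi> (x \<circ> exchange m (\<pi> j))"
        using AE_comp_permutes[OF exchange_permutes[OF \<pi>j[OF j]] contract_symmetric[OF g \<phi>[unfolded Suc] \<sigma>[OF j]]] .
      moreover have "x \<circ> exchange m (\<pi> j) \<circ> \<sigma> j = x \<circ> \<pi> \<circ> exchange m j" for x :: "nat \<Rightarrow> real^'d"
        by (auto simp: \<sigma>_def fun_eq_iff)
      ultimately show ?thesis by simp
    qed
    then have "AE x in config (Suc m). \<forall>j\<in>{..<Suc m}.
        contract m g \<phi> (x \<circ> \<pi> \<circ> exchange m j) = contract m g \<phi> (x \<circ> exchange m (\<pi> j))"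
      by (intro eventually_ball_finite) auto
    then show ?thesis
    proof (rule AE_mp, intro AE_I2 impI)
      fix x :: "nat \<Rightarrow> real^'d"
      assume x: "x \<in> space (config (Suc m))"
        and eq: "\<forall>j\<in>{..<Suc m}. contract m g \<phi> (x \<circ> \<pi> \<circ> exchange m j) = contract m g \<phi> (x \<circ> exchange m (\<pi> j))"
      have "number_op (Suc m) f g \<phi> (x \<circ> \<pi>) = (\<Sum>j<Suc m. hop m f g \<phi> (x \<circ> \<pi> \<circ> exchange m j))"
        by (rule number_op_Suc) (rule comp_permutes_space[OF \<pi> x])
      also have "\<dots> = (\<Sum>j<Suc m. hop m f g \<phi> (x \<circ> exchange m (\<pi> j)))"
        using eq by (intro sum.cong refl) (simp add: hop_def)
      also have "\<dots> = (\<Sum>j<Suc m. hop m f g \<phi> (x \<circ> exchange m j))"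
        using sum.permute[OF \<pi>, of "\<lambda>j. hop m f g \<phi> (x \<circ> exchange m j)"] by (simp only: comp_def)
      finally show "number_op (Suc m) f g \<phi> (x \<circ> \<pi>) = number_op (Suc m) f g \<phi> x"
        by (simp only: number_op_Suc[OF x])
    qed
  qed
  then show ?thesis using L2_number_op[OF f g, of \<phi> n] \<phi> Suc by (auto simp: sym_L2_def)
qed

text \<open>An exchange may be moved from the operator to \<phi>, where symmetry absorbs it. All
  \<open>Suc m\<close> summands therefore equal the one for the last particle.\<close>

lemma inner_number_op_Suc:
  fixes f g :: "real^'d::finite \<Rightarrow> complex"
  assumes f: "f \<in> L2_space lborel" and g: "g \<in> L2_space lborel"
    and \<phi>: "\<phi> \<in> sym_L2 (Suc m)" and \<psi>: "\<psi> \<in> sym_L2 (Suc m)"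
  shows "L2_inner (config (Suc m)) \<phi> (number_op (Suc m) f g \<psi>) =
    of_nat (Suc m) * L2_inner (config m) (contract m f \<phi>) (contract m g \<psi>)"
proof -
  have L: "\<phi> \<in> L2_space (config (Suc m))" "\<psi> \<in> L2_space (config (Suc m))" using \<phi> \<psi> sym_L2_subset by blast+
  have hop: "hop m f g \<psi> \<in> L2_space (config (Suc m))" by (rule L2_hop[OF f g L(2)])
  have hop': "(\<lambda>x. hop m f g \<psi> (x \<circ> exchange m j)) \<in> L2_space (config (Suc m))" if "j < Suc m" for j
    by (rule L2_comp_permutes[OF exchange_permutes[OF that] hop])
  have "L2_inner (config (Suc m)) \<phi> (number_op (Suc m) f g \<psi>) =
      L2_inner (config (Suc m)) \<phi> (\<lambda>x. \<Sum>j<Suc m. 1 * hop m f g \<psi> (x \<circ> exchange m j))"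
    by (rule L2_inner_cong) (simp_all add: number_op_Suc)
  also have "\<dots> = (\<Sum>j<Suc m. 1 * L2_inner (config (Suc m)) \<phi> (\<lambda>x. hop m f g \<psi> (x \<circ> exchange m j)))"
    using hop' by (intro positive_form.sum_right[OF L2_positive_form] L) auto
  also have "\<dots> = (\<Sum>j<Suc m. L2_inner (config (Suc m)) \<phi> (hop m f g \<psi>))"
  proof (intro sum.cong refl)
    fix j assume "j \<in> {..<Suc m}"
    then have j: "exchange m j permutes {..<Suc m}" "j < Suc m" by (auto intro: exchange_permutes)
    have "L2_inner (config (Suc m)) \<phi> (\<lambda>x. hop m f g \<psi> (x \<circ> exchange m j)) =
        L2_inner (config (Suc m)) (\<lambda>x. \<phi> (x \<circ> exchange m j)) (\<lambda>x. hop m f g \<psi> (x \<circ> exchange m j))"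
    proof (rule L2_inner_AE_cong)
      show "AE x in config (Suc m). \<phi> x = \<phi> (x \<circ> exchange m j)"
        using sym_L2_D[OF \<phi> j(1)] by eventually_elim simp
    qed (auto intro: L L2_comp_permutes[OF j(1)] hop'[OF j(2)])
    also have "\<dots> = L2_inner (config (Suc m)) \<phi> (hop m f g \<psi>)"
      by (rule L2_inner_comp_permutes[OF j(1) L(1) hop])
    finally show "1 * L2_inner (config (Suc m)) \<phi> (\<lambda>x. hop m f g \<psi> (x \<circ> exchange m j)) =
        L2_inner (config (Suc m)) \<phi> (hop m f g \<psi>)" by simp
  qed
  also have "\<dots> = of_nat (Suc m) * L2_inner (config m) (contract m f \<phi>) (contract m g \<psi>)"
    by (simp add: inner_hop[OF f g L])
  finally show ?thesis .
qed

lemma number_op_lin: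
  fixes f g h :: "real^'d::finite \<Rightarrow> complex"
  assumes g: "g \<in> L2_space lborel" and h: "h \<in> L2_space lborel" and \<phi>: "\<phi> \<in> L2_space (config n)"
  shows "AE x in config n. number_op n f (\<lambda>y. g y + c * h y) \<phi> x = number_op n f g \<phi> x + cnj c * number_op n f h \<phi> x"
proof (cases n)
  case 0
  then show ?thesis by (simp add: number_op_0)
next
  case (Suc m)
  show ?thesis unfolding Suc
    using contract_AE_exchange[where P = "\<lambda>a b d. a = b + cnj c * d", OF contract_lin_left[OF g h \<phi>[unfolded Suc]]]
  proof (rule AE_mp, intro AE_I2 impI)
    fix x :: "nat \<Rightarrow> real^'d"
    assume "x \<in> space (config (Suc m))"
      and "\<forall>j\<in>{..<Suc m}. contract m (\<lambda>y. g y + c * h y) \<phi> (x \<circ> exchange m j) =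
        contract m g \<phi> (x \<circ> exchange m j) + cnj c * contract m h \<phi> (x \<circ> exchange m j)"
    then show "number_op (Suc m) f (\<lambda>y. g y + c * h y) \<phi> x = number_op (Suc m) f g \<phi> x + cnj c * number_op (Suc m) f h \<phi> x"
      by (simp add: number_op_Suc hop_def sum.distrib sum_distrib_left algebra_simps)
  qed
qed

lemma creation_lin:
  "creation (\<lambda>y. f y + c * h y) \<Psi> = (\<lambda>n x. creation f \<Psi> n x + c * creation h \<Psi> n x)"
  unfolding creation_def by (simp add: fun_eq_iff sum.distrib sum_distrib_left algebra_simps add_divide_distrib)

text \<open>On n particles the form is \<open>n\<close> times the scalar product of contractions
  with \<open>f\<close>, which gives positivity and the bound. The constant is written as the square
  of \<open>sqrt n\<close> times the norm of \<open>f\<close> to match \<open>C\<close> in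
  \<open>trace_product_nonneg\<close>. With \<open>n = 0\<close> there is nothing to contract and
  the form is zero.\<close>

lemma number_form:
  fixes f :: "real^'d::finite \<Rightarrow> complex"
  assumes f: "f \<in> L2_space lborel"
  shows "positive_form (sym_L2 n) (\<lambda>\<phi> \<psi>. L2_inner (config n) \<phi> (number_op n f f \<psi>))"
    and "\<phi> \<in> sym_L2 n \<Longrightarrow> Re (L2_inner (config n) \<phi> (number_op n f f \<phi>))
       \<le> (sqrt (real n) * L2_norm lborel f)\<^sup>2 * (L2_norm (config n) \<phi>)\<^sup>2"
proof -
  have contract: "contract m f \<phi> \<in> L2_space (config m)" if "\<phi> \<in> sym_L2 (Suc m)" for \<phi> m
    using that sym_L2_subset by (intro L2_contract f) auto
  show "positive_form (sym_L2 n) (\<lambda>\<phi> \<psi>. L2_inner (config n) \<phi> (number_op n f f \<psi>))"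
  proof (cases n)
    case 0
    show ?thesis unfolding 0 number_op_0
      by unfold_locales (auto simp: zero_sym_L2 lin_sym_L2 L2_inner_def)
  next
    case (Suc m)
    show ?thesis unfolding Suc
    proof
      fix \<phi> \<psi> \<eta> :: "(nat \<Rightarrow> real^'d) \<Rightarrow> complex" and c
      assume v: "\<phi> \<in> sym_L2 (Suc m)" "\<psi> \<in> sym_L2 (Suc m)" "\<eta> \<in> sym_L2 (Suc m)"
      have "L2_inner (config m) (contract m f \<phi>) (contract m f (\<lambda>x. \<psi> x + c * \<eta> x)) =
          L2_inner (config m) (contract m f \<phi>) (\<lambda>x. contract m f \<psi> x + c * contract m f \<eta> x)"
      proof (rule L2_inner_AE_cong)
        show "AE x in config m. contract m f (\<lambda>x. \<psi> x + c * \<eta> x) x = contract m f \<psi> x + c * contract m f \<eta> x"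
          using v sym_L2_subset by (intro contract_lin_right f) auto
      qed (use v in \<open>auto intro!: contract lin_sym_L2 L2_lin_mem\<close>)
      also have "\<dots> = L2_inner (config m) (contract m f \<phi>) (contract m f \<psi>) + c * L2_inner (config m) (contract m f \<phi>) (contract m f \<eta>)"
        by (intro positive_form.lin_right[OF L2_positive_form] contract v)
      finally show "L2_inner (config (Suc m)) \<phi> (number_op (Suc m) f f (\<lambda>x. \<psi> x + c * \<eta> x)) =
        L2_inner (config (Suc m)) \<phi> (number_op (Suc m) f f \<psi>) + c * L2_inner (config (Suc m)) \<phi> (number_op (Suc m) f f \<eta>)"
        by (simp add: inner_number_op_Suc[OF f f] v lin_sym_L2 algebra_simps del: of_nat_Suc)
    next
      fix \<phi> \<psi> :: "(nat \<Rightarrow> real^'d) \<Rightarrow> complex"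
      assume v: "\<phi> \<in> sym_L2 (Suc m)" "\<psi> \<in> sym_L2 (Suc m)"
      show "L2_inner (config (Suc m)) \<psi> (number_op (Suc m) f f \<phi>) = cnj (L2_inner (config (Suc m)) \<phi> (number_op (Suc m) f f \<psi>))"
        unfolding inner_number_op_Suc[OF f f v] inner_number_op_Suc[OF f f v(2,1)]
        by (simp only: complex_cnj_mult complex_cnj_of_nat L2_inner_cnj[symmetric])
    next
      fix \<phi> :: "(nat \<Rightarrow> real^'d) \<Rightarrow> complex" assume "\<phi> \<in> sym_L2 (Suc m)"
      then show "0 \<le> Re (L2_inner (config (Suc m)) \<phi> (number_op (Suc m) f f \<phi>))"
        by (simp add: inner_number_op_Suc[OF f f] L2_inner_self flip: of_real_power)
    qed (auto simp: zero_sym_L2 lin_sym_L2)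
  qed
  show "Re (L2_inner (config n) \<phi> (number_op n f f \<phi>)) \<le> (sqrt (real n) * L2_norm lborel f)\<^sup>2 * (L2_norm (config n) \<phi>)\<^sup>2"
    if \<phi>: "\<phi> \<in> sym_L2 n"
  proof (cases n)
    case 0
    then show ?thesis by (simp add: number_op_0 L2_inner_def)
  next
    case (Suc m)
    have "Re (L2_inner (config n) \<phi> (number_op n f f \<phi>)) = real n * (L2_norm (config m) (contract m f \<phi>))\<^sup>2"
      using \<phi> unfolding Suc by (simp add: inner_number_op_Suc[OF f f] L2_inner_self flip: of_real_power)
    also have "\<dots> \<le> real n * ((L2_norm lborel f)\<^sup>2 * (L2_norm (config n) \<phi>)\<^sup>2)"
      using \<phi> sym_L2_subset unfolding Suc by (intro mult_left_mono L2_contract(2) f) auto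
    finally show ?thesis by (simp add: power_mult_distrib)
  qed
qed

section \<open>The one-particle density matrix of a Fock state\<close>

lemma fock_space_component: "\<Psi> \<in> fock_space \<Longrightarrow> \<Psi> n \<in> sym_L2 n"
  by (simp add: fock_space_def sym_L2_def)

lemma embed_fock_space:
  assumes "\<phi> \<in> sym_L2 n"
  shows "embed n \<phi> \<in> fock_space"
proof -
  have k: "embed n \<phi> k \<in> sym_L2 k" for k
    using assms by (cases "k = n") (simp_all add: embed_def zero_sym_L2)
  have "(\<lambda>k. (L2_norm (config k) (embed n \<phi> k))\<^sup>2) = (\<lambda>k. if k = n then (L2_norm (config n) \<phi>)\<^sup>2 else 0)"
    by (auto simp: embed_def L2_norm_def)
  then have "summable (\<lambda>k. (L2_norm (config k) (embed n \<phi> k))\<^sup>2)"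
    by (simp only:) (rule summable_single)
  with k show ?thesis unfolding fock_space_def sym_L2_def by blast
qed

lemma embed_fock_sector: "\<phi> \<in> sym_L2 n \<Longrightarrow> embed n \<phi> \<in> fock_sector n"
  by (simp add: fock_sector_def embed_fock_space) (simp add: embed_def)

lemma fock_sector_eq_embed: "\<Psi> \<in> fock_sector n \<Longrightarrow> \<Psi> = embed n (\<Psi> n)"
  by (auto simp: fock_sector_def embed_def fun_eq_iff)

lemma fock_sector_component: "\<Psi> \<in> fock_sector n \<Longrightarrow> \<Psi> n \<in> sym_L2 n"
  by (simp add: fock_sector_def fock_space_component)

lemma fock_inner_embed: "fock_inner (embed n \<phi>) \<Psi> = L2_inner (config n) \<phi> (\<Psi> n)"
proof -
  have "(\<lambda>k. L2_inner (config k) (embed n \<phi> k) (\<Psi> k)) = (\<lambda>k. if k = n then L2_inner (config n) \<phi> (\<Psi> n) else 0)"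
    by (auto simp: embed_def L2_inner_def)
  then show ?thesis
    unfolding fock_inner_def using sums_unique[OF sums_single[of n "\<lambda>_. L2_inner (config n) \<phi> (\<Psi> n)"]] by simp
qed

lemma fock_inner_sector: "\<Phi> \<in> fock_sector n \<Longrightarrow> fock_inner \<Phi> \<Psi> = L2_inner (config n) (\<Phi> n) (\<Psi> n)"
  using fock_inner_embed[of n "\<Phi> n" \<Psi>] fock_sector_eq_embed by metis

lemma fock_eq_zero_sector:
  assumes "\<Psi> \<in> fock_sector n"
  shows "fock_eq \<Psi> (\<lambda>_ _. 0) \<longleftrightarrow> L2_norm (config n) (\<Psi> n) = 0"
proof -
  have L: "\<Psi> n \<in> L2_space (config n)" using fock_sector_component[OF assms] sym_L2_subset by blast
  have "AE x in config k. \<Psi> k x = 0" if "k \<noteq> n" for k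
    using assms that by (simp add: fock_sector_def)
  then have "fock_eq \<Psi> (\<lambda>_ _. 0) \<longleftrightarrow> (AE x in config n. \<Psi> n x = 0)"
    unfolding fock_eq_def by metis
  then show ?thesis by (simp add: L2_norm_eq_0_iff[OF L])
qed

text \<open>A maximal orthonormal family, provided by Zorn's lemma, is total: a non-null vector
  orthogonal to it could be normalised and added. This justifies the choice operator in
  \<open>fock_basis\<close>.\<close>

lemma sector_basis_exists: "\<exists>B. sector_basis n (B :: 'd::finite fock set)"
proof -
  define \<A> where "\<A> = {B :: 'd fock set. B \<subseteq> fock_sector n \<and>
    (\<forall>e\<in>B. \<forall>e'\<in>B. fock_inner e e' = (if e = e' then 1 else 0))}"
  have "\<exists>B\<in>\<A>. \<forall>X\<in>\<A>. B \<subseteq> X \<longrightarrow> X = B"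
  proof (rule subset_Zorn')
    fix C assume C: "subset.chain \<A> C"
    then have CA: "C \<subseteq> \<A>" and total: "\<And>X Y. X \<in> C \<Longrightarrow> Y \<in> C \<Longrightarrow> X \<subseteq> Y \<or> Y \<subseteq> X"
      by (auto simp: subset_chain_def)
    show "\<Union>C \<in> \<A>"
      unfolding \<A>_def
    proof (intro CollectI conjI ballI)
      show "\<Union>C \<subseteq> fock_sector n" using CA by (auto simp: \<A>_def)
      fix e e' assume "e \<in> \<Union>C" "e' \<in> \<Union>C"
      then obtain X Y where "X \<in> C" "e \<in> X" "Y \<in> C" "e' \<in> Y" by blast
      then obtain Z where "Z \<in> C" "e \<in> Z" "e' \<in> Z" using total[of X Y] by blast
      then show "fock_inner e e' = (if e = e' then 1 else 0)" using CA unfolding \<A>_def by blast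
    qed
  qed
  then obtain B where B: "B \<in> \<A>" and maximal: "\<And>X. X \<in> \<A> \<Longrightarrow> B \<subseteq> X \<Longrightarrow> X = B" by blast
  have Bs: "B \<subseteq> fock_sector n" and Bo: "\<And>e e'. e \<in> B \<Longrightarrow> e' \<in> B \<Longrightarrow> fock_inner e e' = (if e = e' then 1 else 0)"
    using B by (auto simp: \<A>_def)
  have "fock_eq \<Psi> (\<lambda>_ _. 0)" if \<Psi>: "\<Psi> \<in> fock_sector n" and orth: "\<And>e. e \<in> B \<Longrightarrow> fock_inner e \<Psi> = 0" for \<Psi>
  proof (rule ccontr)
    interpret L: positive_form "sym_L2 n :: ((nat \<Rightarrow> real^'d) \<Rightarrow> complex) set" "L2_inner (config n)"
      using L2_positive_form sym_L2_subset zero_sym_L2 lin_sym_L2 by (rule positive_form.subset)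
    assume "\<not> fock_eq \<Psi> (\<lambda>_ _. 0)"
    then have N: "L2_norm (config n) (\<Psi> n) \<noteq> 0" using fock_eq_zero_sector[OF \<Psi>] by simp
    define c where "c = 1 / complex_of_real (L2_norm (config n) (\<Psi> n))"
    define u where "u = embed n (\<lambda>x. c * \<Psi> n x)"
    have \<Psi>n: "\<Psi> n \<in> sym_L2 n" by (rule fock_sector_component[OF \<Psi>])
    have u: "u \<in> fock_sector n" unfolding u_def by (intro embed_fock_sector L.scale_mem \<Psi>n)
    have en: "e n \<in> sym_L2 n" if "e \<in> fock_sector n" for e using that by (rule fock_sector_component)
    have eu: "fock_inner e u = c * fock_inner e \<Psi>" if "e \<in> fock_sector n" for e
      unfolding fock_inner_sector[OF that] u_def embed_same by (rule L.scale_right[OF en[OF that] \<Psi>n])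
    have u\<Psi>: "fock_inner u \<Psi> = complex_of_real (L2_norm (config n) (\<Psi> n))"
    proof -
      have "fock_inner u \<Psi> = cnj c * of_real ((L2_norm (config n) (\<Psi> n))\<^sup>2)"
        unfolding u_def fock_inner_embed using L.scale_left[OF \<Psi>n \<Psi>n, of c] by (simp only: L2_inner_self)
      then show ?thesis using N by (simp add: c_def power2_eq_square)
    qed
    have uu: "fock_inner u u = 1" using eu[OF u] u\<Psi> N by (simp add: c_def)
    have eu0: "fock_inner e u = 0" if "e \<in> B" for e using eu[of e] Bs orth[OF that] that by auto
    have ue0: "fock_inner u e = 0" if "e \<in> B" for e
    proof -
      have "e \<in> fock_sector n" using that Bs by blast
      then have "cnj (fock_inner e u) = cnj (L2_inner (config n) (e n) (u n))"
        by (simp only: fock_inner_sector)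
      also have "\<dots> = L2_inner (config n) (u n) (e n)" by (rule L2_inner_cnj[symmetric])
      also have "\<dots> = fock_inner u e" by (rule fock_inner_sector[OF u, symmetric])
      finally have "fock_inner u e = cnj (fock_inner e u)" by (rule sym)
      then show ?thesis using eu0[OF that] by simp
    qed
    \<comment> \<open>Otherwise \<open>u\<close> would be orthogonal to \<Psi>, while their scalar
      product is the nonzero norm of \<Psi>.\<close>
    have "u \<notin> B" using orth[of u] u\<Psi> N by auto
    then have "insert u B \<in> \<A>"
      unfolding \<A>_def using Bs u uu eu0 ue0 Bo by auto
    then have "insert u B = B" by (rule maximal) auto
    with \<open>u \<notin> B\<close> show False by blast
  qed
  then have "sector_basis n B" unfolding sector_basis_def using Bs Bo by blast
  then show ?thesis by blast
qed

lemma fock_basis: "sector_basis n (fock_basis n)"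
  unfolding fock_basis_def by (rule someI_ex[OF sector_basis_exists])

lemma fock_basis_sector: "e \<in> fock_basis n \<Longrightarrow> e \<in> fock_sector n"
  using fock_basis unfolding sector_basis_def by blast

text \<open>Members of \<open>fock_sector n\<close> vanish at every point of the other components,
  so no information is lost, and sums over \<open>fock_basis n\<close> can be reindexed to wave
  functions.\<close>

definition wave_basis :: "nat \<Rightarrow> ((nat \<Rightarrow> real^'d::finite) \<Rightarrow> complex) set" where
  "wave_basis n = (\<lambda>e. e n) ` fock_basis n"

lemma L2_basis_wave_basis: "L2_basis (config n) (sym_L2 n) (wave_basis n)"
proof
  fix f :: "(nat \<Rightarrow> real^'d::finite) \<Rightarrow> complex"
  assume f: "f \<in> sym_L2 n" and orth: "\<And>e. e \<in> wave_basis n \<Longrightarrow> L2_inner (config n) e f = 0"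
  have "fock_inner e (embed n f) = 0" if "e \<in> fock_basis n" for e
    using orth[of "e n"] that by (simp add: fock_inner_sector[OF fock_basis_sector[OF that]] wave_basis_def)
  then have "fock_eq (embed n f) (\<lambda>_ _. 0)"
    using fock_basis[of n] embed_fock_sector[OF f] unfolding sector_basis_def by blast
  then show "L2_norm (config n) f = 0"
    using fock_eq_zero_sector[OF embed_fock_sector[OF f]] by simp
next
  fix e e' :: "(nat \<Rightarrow> real^'d::finite) \<Rightarrow> complex"
  assume "e \<in> wave_basis n" "e' \<in> wave_basis n"
  then obtain \<Psi> \<Phi> where eq: "e = \<Psi> n" "e' = \<Phi> n" and b: "\<Psi> \<in> fock_basis n" "\<Phi> \<in> fock_basis n"
    by (auto simp: wave_basis_def)
  have "\<Psi> = \<Phi> \<longleftrightarrow> e = e'"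
    using fock_sector_eq_embed[OF fock_basis_sector[OF b(1)]] fock_sector_eq_embed[OF fock_basis_sector[OF b(2)]] eq by metis
  moreover have "fock_inner \<Psi> \<Phi> = (if \<Psi> = \<Phi> then 1 else 0)"
    using fock_basis[of n] b unfolding sector_basis_def by blast
  ultimately show "L2_inner (config n) e e' = (if e = e' then 1 else 0)"
    by (simp add: fock_inner_sector[OF fock_basis_sector[OF b(1)]] eq)
qed (auto simp: sym_L2_subset[THEN subsetD] zero_sym_L2 lin_sym_L2 sym_L2_closed wave_basis_def
      intro: fock_sector_component fock_basis_sector)

lemma has_sum_wave_basis:
  "((\<lambda>e. a (embed n e)) has_sum s) (wave_basis n) \<longleftrightarrow> (a has_sum s) (fock_basis n)"
proof -
  have eq: "embed n (e n) = e" if "e \<in> fock_basis n" for e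
    using fock_sector_eq_embed[OF fock_basis_sector[OF that]] by simp
  have "inj_on (\<lambda>e. e n) (fock_basis n)"
    by (rule inj_on_inverseI[where g = "embed n"]) (rule eq)
  then have "((\<lambda>e. a (embed n e)) has_sum s) (wave_basis n) \<longleftrightarrow> (((\<lambda>e. a (embed n e)) \<circ> (\<lambda>e. e n)) has_sum s) (fock_basis n)"
    unfolding wave_basis_def by (rule has_sum_reindex)
  also have "\<dots> \<longleftrightarrow> (a has_sum s) (fock_basis n)"
    by (rule has_sum_cong) (simp add: eq)
  finally show ?thesis .
qed

subsection \<open>Traces\<close>

text \<open>A trace given by its diagonal terms instead of an operator: linearity of the terms in
  \<open>f\<close> and \<open>g\<close> is available at basis vectors only, where it suffices for
  combining traces.\<close>

definition has_trace_terms :: "(nat \<Rightarrow> 'd::finite fock \<Rightarrow> complex) \<Rightarrow> complex \<Rightarrow> bool" where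
  "has_trace_terms a t \<longleftrightarrow> (\<exists>\<tau>. (\<forall>n. (a n has_sum \<tau> n) (fock_basis n)) \<and> \<tau> sums t)"

lemma has_fock_trace_iff: "has_fock_trace T t \<longleftrightarrow> has_trace_terms (\<lambda>n e. fock_inner e (T e)) t"
  by (simp add: has_fock_trace_def has_trace_terms_def)

lemma has_trace_terms_lin:
  assumes "has_trace_terms a t" "has_trace_terms b s"
  shows "has_trace_terms (\<lambda>n e. a n e + c * b n e) (t + c * s)"
proof -
  obtain \<tau> \<sigma> where "\<And>n. (a n has_sum \<tau> n) (fock_basis n)" "\<tau> sums t"
    "\<And>n. (b n has_sum \<sigma> n) (fock_basis n)" "\<sigma> sums s"
    using assms unfolding has_trace_terms_def by blast
  then show ?thesis unfolding has_trace_terms_def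
    by (intro exI[of _ "\<lambda>n. \<tau> n + c * \<sigma> n"] conjI allI has_sum_add has_sum_cmult_right sums_add sums_mult)
qed

lemma has_trace_terms_cong:
  assumes "\<And>n e. e \<in> fock_basis n \<Longrightarrow> a n e = b n e"
  shows "has_trace_terms a t \<longleftrightarrow> has_trace_terms b t"
proof -
  have "(a n has_sum s) (fock_basis n) \<longleftrightarrow> (b n has_sum s) (fock_basis n)" for n s
    using assms by (rule has_sum_cong)
  then show ?thesis unfolding has_trace_terms_def by simp
qed

section \<open>Density matrices on n-particle spaces\<close>

text \<open>A density matrix may mix particle numbers. Basis vectors have a definite number, so only
  the diagonal block from \<open>n\<close> to \<open>n\<close> particles enters the trace, and it
  inherits positivity.\<close>

lemma density_form:
  fixes \<rho> :: "'d::finite fock_operator"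
  assumes "density_matrix \<rho>"
  shows "positive_form (sym_L2 n) (\<lambda>\<phi> \<psi>. L2_inner (config n) \<phi> (\<rho> (embed n \<psi>) n))"
    and "\<psi> \<in> sym_L2 n \<Longrightarrow> \<rho> (embed n \<psi>) n \<in> sym_L2 n"
proof -
  have maps: "\<rho> \<Psi> \<in> fock_space" if "\<Psi> \<in> fock_space" for \<Psi>
    using assms that unfolding density_matrix_def by blast
  show mem: "\<rho> (embed n \<psi>) n \<in> sym_L2 n" if "\<psi> \<in> sym_L2 n" for \<psi>
    by (intro fock_space_component maps embed_fock_space that)
  have memL: "\<rho> (embed n \<psi>) n \<in> L2_space (config n)" if "\<psi> \<in> sym_L2 n" for \<psi>
    using mem[OF that] sym_L2_subset by blast
  show "positive_form (sym_L2 n) (\<lambda>\<phi> \<psi>. L2_inner (config n) \<phi> (\<rho> (embed n \<psi>) n))"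
  proof (rule positive_form_polarization)
    fix \<phi> \<psi> \<eta> :: "(nat \<Rightarrow> real^'d) \<Rightarrow> complex" and c
    assume v: "\<phi> \<in> sym_L2 n" "\<psi> \<in> sym_L2 n" "\<eta> \<in> sym_L2 n"
    then have vL: "\<phi> \<in> L2_space (config n)" "\<psi> \<in> L2_space (config n)" "\<eta> \<in> L2_space (config n)"
      using sym_L2_subset by blast+
    \<comment> \<open>Linearity of \<rho> is an identity almost everywhere and becomes an exact one
      only inside a scalar product.\<close>
    have "fock_eq (\<rho> (embed n (\<lambda>x. \<psi> x + c * \<eta> x))) (\<lambda>k x. \<rho> (embed n \<psi>) k x + c * \<rho> (embed n \<eta>) k x)"
      using assms embed_fock_space[OF v(2)] embed_fock_space[OF v(3)] unfolding density_matrix_def embed_lin by blast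
    then have AE: "AE x in config n. \<rho> (embed n (\<lambda>x. \<psi> x + c * \<eta> x)) n x = \<rho> (embed n \<psi>) n x + c * \<rho> (embed n \<eta>) n x"
      by (simp add: fock_eq_def)
    have "L2_inner (config n) \<phi> (\<rho> (embed n (\<lambda>x. \<psi> x + c * \<eta> x)) n) =
        L2_inner (config n) \<phi> (\<lambda>x. \<rho> (embed n \<psi>) n x + c * \<rho> (embed n \<eta>) n x)"
      by (intro L2_inner_AE_cong AE vL memL L2_lin_mem lin_sym_L2 v) simp
    also have "\<dots> = L2_inner (config n) \<phi> (\<rho> (embed n \<psi>) n) + c * L2_inner (config n) \<phi> (\<rho> (embed n \<eta>) n)"
      by (intro positive_form.lin_right[OF L2_positive_form] vL memL v)
    finally show "L2_inner (config n) \<phi> (\<rho> (embed n (\<lambda>x. \<psi> x + c * \<eta> x)) n) =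
        L2_inner (config n) \<phi> (\<rho> (embed n \<psi>) n) + c * L2_inner (config n) \<phi> (\<rho> (embed n \<eta>) n)" .
    show "L2_inner (config n) (\<lambda>x. \<psi> x + c * \<eta> x) (\<rho> (embed n \<phi>) n) =
        L2_inner (config n) \<psi> (\<rho> (embed n \<phi>) n) + cnj c * L2_inner (config n) \<eta> (\<rho> (embed n \<phi>) n)"
      by (intro positive_form.lin_left[OF L2_positive_form] vL memL v)
  next
    fix \<phi> :: "(nat \<Rightarrow> real^'d) \<Rightarrow> complex" assume "\<phi> \<in> sym_L2 n"
    then have "fock_inner (embed n \<phi>) (\<rho> (embed n \<phi>)) \<in> \<real>\<^sub>\<ge>\<^sub>0"
      using assms embed_fock_space unfolding density_matrix_def by blast
    then show "L2_inner (config n) \<phi> (\<rho> (embed n \<phi>) n) \<in> \<real>\<^sub>\<ge>\<^sub>0" by (simp only: fock_inner_embed)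
  qed (auto simp: zero_sym_L2 lin_sym_L2)
qed

text \<open>\<open>R\<close> acts on functions, and nothing is assumed about its values at functions
  that agree almost everywhere. The diagonal value at a null function is 0, and Cauchy-Schwarz
  spreads this to all \<phi>.\<close>

lemma positive_form_AE_zero:
  assumes q: "positive_form V (\<lambda>\<phi> \<psi>. L2_inner M \<phi> (R \<psi>))" and V: "V \<subseteq> L2_space M"
    and R: "R \<psi> \<in> L2_space M" and \<phi>: "\<phi> \<in> V" and \<psi>: "\<psi> \<in> V" and zero: "AE x in M. \<psi> x = 0"
  shows "L2_inner M \<phi> (R \<psi>) = 0"
proof -
  have "L2_inner M \<psi> (R \<psi>) = L2_inner M (\<lambda>_. 0) (R \<psi>)"
    using zero \<psi> V R by (intro L2_inner_AE_cong) (auto simp: L2_zero_mem)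
  also have "\<dots> = 0" by (simp add: L2_inner_def)
  finally show ?thesis
    using positive_form.Cauchy_Schwarz[OF q \<phi> \<psi>] by simp
qed

text \<open>\<open>creation\<close> is linear in its function at every point, whereas
  \<open>annihilation\<close> is antilinear only almost everywhere because of the integral.\<close>

lemma trace_term_lin:
  fixes \<rho> :: "'d::finite fock_operator"
  assumes \<rho>: "density_matrix \<rho>" and e: "e \<in> fock_basis n"
    and f: "f \<in> L2_space lborel" and g: "g \<in> L2_space lborel" and h: "h \<in> L2_space lborel"
  shows "fock_inner e ((\<rho> \<circ> (creation (\<lambda>y. g y + c * h y) \<circ> annihilation f)) e) =
      fock_inner e ((\<rho> \<circ> (creation g \<circ> annihilation f)) e) + c * fock_inner e ((\<rho> \<circ> (creation h \<circ> annihilation f)) e)"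
    and "fock_inner e ((\<rho> \<circ> (creation f \<circ> annihilation (\<lambda>y. g y + c * h y))) e) =
      fock_inner e ((\<rho> \<circ> (creation f \<circ> annihilation g)) e) + cnj c * fock_inner e ((\<rho> \<circ> (creation f \<circ> annihilation h)) e)"
proof -
  define b where "b = (\<lambda>\<phi> \<psi>. L2_inner (config n) \<phi> (\<rho> (embed n \<psi>) n))"
  interpret b: positive_form "sym_L2 n" b unfolding b_def by (rule density_form(1)[OF \<rho>])
  have es: "e \<in> fock_sector n" using e by (rule fock_basis_sector)
  have en: "e n \<in> sym_L2 n" using es by (rule fock_sector_component)
  have enL: "e n \<in> L2_space (config n)" using en sym_L2_subset by blast
  have expand: "fock_inner e ((\<rho> \<circ> (creation k \<circ> annihilation l)) e) = b (e n) (number_op n k l (e n))" for k l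
  proof -
    have "creation k (annihilation l e) = embed n (number_op n k l (e n))"
      using creation_annihilation_embed[of k l n "e n"] fock_sector_eq_embed[OF es] by simp
    then show ?thesis by (simp add: b_def fock_inner_sector[OF es])
  qed
  have gh: "(\<lambda>y. g y + c * h y) \<in> L2_space lborel" by (intro L2_lin_mem g h)
  have mem: "number_op n k l (e n) \<in> sym_L2 n" if "k \<in> L2_space lborel" "l \<in> L2_space lborel" for k l
    using that en by (rule sym_L2_number_op)
  have "number_op n (\<lambda>y. g y + c * h y) f (e n) = (\<lambda>x. number_op n g f (e n) x + c * number_op n h f (e n) x)"
    unfolding number_op_def creation_lin ..
  then show "fock_inner e ((\<rho> \<circ> (creation (\<lambda>y. g y + c * h y) \<circ> annihilation f)) e) =
      fock_inner e ((\<rho> \<circ> (creation g \<circ> annihilation f)) e) + c * fock_inner e ((\<rho> \<circ> (creation h \<circ> annihilation f)) e)"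
    unfolding expand by (simp add: b.lin_right en mem f g h)
  define l where "l = (\<lambda>x. number_op n f g (e n) x + cnj c * number_op n f h (e n) x)"
  \<comment> \<open>The defect of antilinearity is a null function, and the form of \<rho> does not
    see it.\<close>
  define d where "d = (\<lambda>x. number_op n f (\<lambda>y. g y + c * h y) (e n) x - l x)"
  have l: "l \<in> sym_L2 n" unfolding l_def by (intro lin_sym_L2 mem f g h)
  have d: "d \<in> sym_L2 n" unfolding d_def by (intro b.diff_mem mem f gh l)
  have "AE x in config n. number_op n f (\<lambda>y. g y + c * h y) (e n) x = l x"
    unfolding l_def by (rule number_op_lin[OF g h enL])
  then have "AE x in config n. d x = 0" unfolding d_def by eventually_elim simp
  then have "b (e n) d = 0"
    unfolding b_def using density_form(2)[OF \<rho> d] sym_L2_subset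
    by (intro positive_form_AE_zero[OF b.positive_form_axioms[unfolded b_def] sym_L2_subset _ en d]) auto
  then have "b (e n) (number_op n f (\<lambda>y. g y + c * h y) (e n)) = b (e n) l"
    unfolding d_def by (simp add: b.diff_right en mem f gh l)
  also have "\<dots> = b (e n) (number_op n f g (e n)) + cnj c * b (e n) (number_op n f h (e n))"
    unfolding l_def by (intro b.lin_right en mem f g h)
  finally show "fock_inner e ((\<rho> \<circ> (creation f \<circ> annihilation (\<lambda>y. g y + c * h y))) e) =
      fock_inner e ((\<rho> \<circ> (creation f \<circ> annihilation g)) e) + cnj c * fock_inner e ((\<rho> \<circ> (creation f \<circ> annihilation h)) e)"
    unfolding expand .
qed

text \<open>\<open>trace_product_nonneg\<close> applies in each sector, where the number operator is
  bounded with a constant depending on \<open>n\<close>; only the nonnegative sector traces are then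
  summed over \<open>n\<close>.\<close>

lemma trace_number_nonneg:
  fixes \<rho> :: "'d::finite fock_operator"
  assumes \<rho>: "density_matrix \<rho>" and f: "f \<in> L2_space lborel"
    and trace: "has_fock_trace (\<rho> \<circ> (creation f \<circ> annihilation f)) t"
  shows "t \<in> \<real>\<^sub>\<ge>\<^sub>0"
proof -
  obtain \<tau> where \<tau>: "\<And>n. ((\<lambda>e. fock_inner e ((\<rho> \<circ> (creation f \<circ> annihilation f)) e)) has_sum \<tau> n) (fock_basis n)"
    and sums: "\<tau> sums t"
    using trace unfolding has_fock_trace_def by blast
  obtain \<sigma> where \<sigma>: "\<And>n. ((\<lambda>e. fock_inner e (\<rho> e)) has_sum \<sigma> n) (fock_basis n)"
    using \<rho> unfolding density_matrix_def has_fock_trace_def by blast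
  have "\<tau> n \<in> \<real>\<^sub>\<ge>\<^sub>0" for n
  proof -
    interpret L2_basis "config n" "sym_L2 n" "wave_basis n :: ((nat \<Rightarrow> real^'d) \<Rightarrow> complex) set"
      by (rule L2_basis_wave_basis)
    show ?thesis
    proof (rule trace_product_nonneg)
      show "positive_form (sym_L2 n) (\<lambda>\<phi> \<psi>. L2_inner (config n) \<phi> (\<rho> (embed n \<psi>) n))"
        by (rule density_form(1)[OF \<rho>])
      show "\<exists>r\<in>sym_L2 n. \<forall>x\<in>sym_L2 n. L2_inner (config n) x (\<rho> (embed n y) n) = L2_inner (config n) x r"
        if "y \<in> sym_L2 n" for y using density_form(2)[OF \<rho> that] by blast
      show "((\<lambda>e. L2_inner (config n) e (\<rho> (embed n e) n)) has_sum \<sigma> n) (wave_basis n)"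
        using \<sigma>[of n] unfolding has_sum_wave_basis[symmetric] fock_inner_embed .
      show "positive_form (sym_L2 n) (\<lambda>\<phi> \<psi>. L2_inner (config n) \<phi> (number_op n f f \<psi>))"
        by (rule number_form(1)[OF f])
      show "number_op n f f y \<in> sym_L2 n" if "y \<in> sym_L2 n" for y
        using f f that by (rule sym_L2_number_op)
      show "Re (L2_inner (config n) x (number_op n f f x)) \<le> (sqrt (real n) * L2_norm lborel f)\<^sup>2 * (L2_norm (config n) x)\<^sup>2"
        if "x \<in> sym_L2 n" for x using f that by (rule number_form(2))
      show "((\<lambda>e. L2_inner (config n) e (\<rho> (embed n (number_op n f f e)) n)) has_sum \<tau> n) (wave_basis n)"
        using \<tau>[of n] unfolding has_sum_wave_basis[symmetric] fock_inner_embed comp_def creation_annihilation_embed .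
    qed simp
  qed
  then have "(\<Sum>n<N. \<tau> n) \<in> \<real>\<^sub>\<ge>\<^sub>0" for N by (induction N) (auto intro: nonneg_Reals_add_I)
  then show ?thesis
    using sums unfolding sums_def by (intro Lim_in_closed_set[OF closed_nonneg_Reals_complex]) auto
qed

text \<open>The arguments are swapped because \<open>one_particle\<close> is linear in its first
  entry, while \<open>positive_form\<close> is antilinear there. Traces for different functions are
  obtained from the diagonal ones by polarization at the level of trace terms.\<close>

theorem one_particle_form:
  fixes \<omega> :: "'d::finite fock_operator \<Rightarrow> complex"
  assumes "fock_state \<omega>"
  shows "positive_form (L2_space lborel) (\<lambda>f g. one_particle \<omega> g f)"
proof -
  obtain \<rho> where \<rho>: "density_matrix \<rho>"
    and \<omega>: "\<And>A t. has_fock_trace (\<rho> \<circ> A) t \<Longrightarrow> \<omega> A = t"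
    and diag: "\<And>f. f \<in> L2_space lborel \<Longrightarrow> \<exists>t. has_fock_trace (\<rho> \<circ> (creation f \<circ> annihilation f)) t"
    using assms unfolding fock_state_def by blast
  define a where "a f g n e = fock_inner e ((\<rho> \<circ> (creation f \<circ> annihilation g)) e)" for f g and n :: nat and e
  have trace_a: "has_fock_trace (\<rho> \<circ> (creation f \<circ> annihilation g)) t \<longleftrightarrow> has_trace_terms (a f g) t" for f g t
    unfolding a_def by (rule has_fock_trace_iff)
  have left: "a (\<lambda>y. g y + c * h y) f n e = a g f n e + c * a h f n e"
    and right: "a f (\<lambda>y. g y + c * h y) n e = a f g n e + cnj c * a f h n e"
    if "f \<in> L2_space lborel" "g \<in> L2_space lborel" "h \<in> L2_space lborel" "e \<in> fock_basis n" for f g h c n e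
    unfolding a_def using trace_term_lin[OF \<rho> that(4) that(1-3)] by auto
  have "\<exists>t. has_trace_terms (a f g) t" if f: "f \<in> L2_space lborel" and g: "g \<in> L2_space lborel" for f g
  proof -
    define k where "k c = (\<lambda>y. f y + c * g y)" for c
    have k: "k c \<in> L2_space lborel" for c unfolding k_def by (intro L2_lin_mem f g)
    have ex: "\<exists>t. has_trace_terms (a l l) t" if "l \<in> L2_space lborel" for l
      using diag[OF that] by (simp only: trace_a)
    obtain s1 s2 s3 s4 where s: "has_trace_terms (a (k 1) (k 1)) s1" "has_trace_terms (a (k \<i>) (k \<i>)) s2"
      "has_trace_terms (a f f) s3" "has_trace_terms (a g g) s4"
      using ex[OF k] ex[OF f] ex[OF g] by blast
    have zero: "has_trace_terms (\<lambda>_ _. 0 :: complex) 0"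
      unfolding has_trace_terms_def by (intro exI[of _ "\<lambda>_. 0"] conjI allI has_sum_0 sums_zero) simp
    \<comment> \<open>Two vectors suffice for this polarization: 1/2 of the terms at
      \<open>f + g\<close> plus \<i>/2 of those at \<open>f + \<i> g\<close> cancels
      \<open>a g f\<close>, keeps \<open>a f g\<close> once, and leaves (1 + \<i>)/2 of each
      diagonal term to subtract.\<close>
    note has_trace_terms_lin[OF has_trace_terms_lin[OF has_trace_terms_lin[OF has_trace_terms_lin[OF
        zero s(1), of "1/2"] s(2), of "\<i>/2"] s(3), of "- (1 + \<i>) / 2"] s(4), of "- (1 + \<i>) / 2"]
    moreover have "((0 + (1/2) * a (k 1) (k 1) n e) + (\<i>/2) * a (k \<i>) (k \<i>) n e)
        + (- (1 + \<i>) / 2) * a f f n e + (- (1 + \<i>) / 2) * a g g n e = a f g n e"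
      if e: "e \<in> fock_basis n" for n e
    proof -
      have "a (k c) (k c) n e = a f f n e + cnj c * a f g n e + c * (a g f n e + cnj c * a g g n e)" for c
        using left[OF k f g e, of c c] right[OF f f g e, of c] right[OF g f g e, of c] by (simp add: k_def)
      from this[of 1] this[of \<i>] show ?thesis by (simp add: complex_eq_iff field_simps)
    qed
    ultimately show ?thesis using has_trace_terms_cong by (metis (no_types, lifting))
  qed
  then have trace: "has_trace_terms (a f g) (one_particle \<omega> f g)"
    if "f \<in> L2_space lborel" "g \<in> L2_space lborel" for f g
    using that \<omega> trace_a unfolding one_particle_def by metis
  have val: "one_particle \<omega> f g = t" if "has_trace_terms (a f g) t" for f g t
    unfolding one_particle_def using that by (intro \<omega>) (simp only: trace_a)
  show ?thesis
  proof (rule positive_form_polarization)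
    fix f g h :: "real^'d \<Rightarrow> complex" and c
    assume v: "f \<in> L2_space lborel" "g \<in> L2_space lborel" "h \<in> L2_space lborel"
    show "one_particle \<omega> (\<lambda>x. g x + c * h x) f = one_particle \<omega> g f + c * one_particle \<omega> h f"
      using has_trace_terms_lin[OF trace[OF v(2,1)] trace[OF v(3,1)], of c]
      by (intro val) (subst has_trace_terms_cong[OF left[OF v]])
    show "one_particle \<omega> f (\<lambda>x. g x + c * h x) = one_particle \<omega> f g + cnj c * one_particle \<omega> f h"
      using has_trace_terms_lin[OF trace[OF v(1,2)] trace[OF v(1,3)], of "cnj c"]
      by (intro val) (subst has_trace_terms_cong[OF right[OF v]])
  next
    fix f :: "real^'d \<Rightarrow> complex" assume f: "f \<in> L2_space lborel"
    show "one_particle \<omega> f f \<in> \<real>\<^sub>\<ge>\<^sub>0"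
      by (rule trace_number_nonneg[OF \<rho> f]) (simp only: trace_a trace[OF f f])
  qed (auto simp: L2_zero_mem L2_lin_mem)
qed

section \<open>Condensates with zero momentum\<close>

subsection \<open>Wave functions on a region\<close>

lemma L2_on_subset: "L2_on \<O> \<subseteq> L2_space lborel"
  by (auto simp: L2_on_def)

lemma L2_on_mono: "A \<subseteq> B \<Longrightarrow> f \<in> L2_on A \<Longrightarrow> f \<in> L2_on B"
  unfolding L2_on_def by (auto elim: eventually_mono)

lemma zero_L2_on: "(\<lambda>_. 0) \<in> L2_on \<O>"
  by (simp add: L2_on_def L2_zero_mem)

lemma lin_L2_on: "f \<in> L2_on \<O> \<Longrightarrow> g \<in> L2_on \<O> \<Longrightarrow> (\<lambda>x. f x + c * g x) \<in> L2_on \<O>"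
  unfolding L2_on_def by (auto intro: L2_lin_mem elim: eventually_elim2)

lemma L2_on_form: "positive_form (L2_on \<O>) (L2_inner lborel)"
  using L2_positive_form L2_on_subset zero_L2_on lin_L2_on by (rule positive_form.subset)

text \<open>Outside \<O> the \<open>F k\<close> vanish, so the part of \<open>f\<close> there is
  bounded in norm by the distance of \<open>f\<close> to each of them.\<close>

lemma L2_on_closed:
  assumes "open (\<O> :: (real^'d::finite) set)"
  shows "L2_closed lborel (L2_on \<O>)"
  unfolding L2_closed_def
proof (intro allI impI)
  fix F :: "nat \<Rightarrow> real^'d \<Rightarrow> complex" and f
  assume F: "\<forall>k. F k \<in> L2_on \<O>" and f: "f \<in> L2_space lborel"
    and lim: "(\<lambda>k. L2_norm lborel (\<lambda>x. F k x - f x)) \<longlonglongrightarrow> 0"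
  have [measurable]: "\<O> \<in> sets lborel" using assms by simp
  have [measurable]: "f \<in> borel_measurable lborel" using f by (rule L2_space_measurable)
  let ?h = "\<lambda>x. indicator (- \<O>) x * f x"
  have h: "?h \<in> L2_space lborel"
    unfolding L2_space_def
  proof (intro CollectI conjI)
    show "integrable lborel (\<lambda>x. (cmod (?h x))\<^sup>2)"
      by (rule Bochner_Integration.integrable_bound[of _ "\<lambda>x. (cmod (f x))\<^sup>2"])
        (use f in \<open>auto simp: L2_space_def indicator_def\<close>)
  qed simp
  have "L2_norm lborel ?h \<le> L2_norm lborel (\<lambda>x. F k x - f x)" for k
  proof -
    have d: "(\<lambda>x. F k x - f x) \<in> L2_space lborel" using F L2_on_subset f by (intro L2_diff_mem) blast+
    have "AE x in lborel. x \<notin> \<O> \<longrightarrow> F k x = 0" using F by (simp add: L2_on_def)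
    then have "AE x in lborel. (cmod (?h x))\<^sup>2 \<le> (cmod (F k x - f x))\<^sup>2"
      by eventually_elim (simp add: indicator_def)
    then show ?thesis unfolding L2_norm_def
      using h d by (intro real_sqrt_le_mono integral_mono_AE) (auto simp: L2_space_def)
  qed
  with lim have "L2_norm lborel ?h \<le> 0" by (intro LIMSEQ_le_const[OF lim]) auto
  then have "L2_norm lborel ?h = 0" using L2_norm_nonneg[of lborel ?h] by simp
  then have "AE x in lborel. ?h x = 0" by (simp only: L2_norm_eq_0_iff[OF h])
  then have "AE x in lborel. x \<notin> \<O> \<longrightarrow> f x = 0" by eventually_elim (auto simp: indicator_def)
  with f show "f \<in> L2_on \<O>" by (simp add: L2_on_def)
qed

section \<open>Mean value and constant mode of a region\<close>

abbreviation unit_on :: "(real^'d) set \<Rightarrow> real^'d \<Rightarrow> complex" where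
  "unit_on \<O> \<equiv> \<lambda>x. complex_of_real (indicator \<O> x)"

locale region =
  fixes \<O> :: "(real^'d::finite) set"
  assumes open_region: "open \<O>" and bounded_region: "bounded \<O>" and nonempty_region: "\<O> \<noteq> {}"
begin

lemma measurable_region [measurable]: "\<O> \<in> sets borel"
  using open_region by simp

lemma emeasure_finite: "emeasure lborel \<O> < \<infinity>"
  using bounded_region by (rule emeasure_bounded_finite)

lemma volume_pos: "0 < measure lborel \<O>"
proof -
  obtain x where "x \<in> \<O>" using nonempty_region by blast
  then obtain r where r: "r > 0" "ball x r \<subseteq> \<O>" using open_region by (auto simp: open_contains_ball)
  have "0 < measure lborel (ball x r)" using r(1) by (rule content_ball_pos)
  also have "\<dots> \<le> measure lborel \<O>"
    using emeasure_finite by (intro measure_mono_fmeasurable r(2)) (auto simp: fmeasurable_def)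
  finally show ?thesis .
qed

lemma unit_on_mem: "unit_on \<O> \<in> L2_on \<O>"
proof -
  have "(\<lambda>x. (cmod (unit_on \<O> x))\<^sup>2) = indicator \<O>" by (auto simp: indicator_def)
  then show ?thesis
    using emeasure_finite by (auto simp: L2_on_def L2_space_def)
qed

lemma norm_unit_on: "(L2_norm lborel (unit_on \<O>))\<^sup>2 = measure lborel \<O>"
proof -
  have "(\<lambda>x. (cmod (unit_on \<O> x))\<^sup>2) = indicator \<O>" by (auto simp: indicator_def)
  then show ?thesis by (simp add: L2_norm_def)
qed

text \<open>The mean is the scalar product with the indicator function, which is square-integrable
  as the region is bounded. Functions of mean zero are thus an orthogonal complement.\<close>

lemma mean_eq_inner:
  assumes "f \<in> L2_on \<O>"
  shows "(LINT x|lborel. f x) = L2_inner lborel (unit_on \<O>) f"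
  unfolding L2_inner_def
proof (rule integral_cong_AE)
  have "AE x in lborel. x \<notin> \<O> \<longrightarrow> f x = 0" using assms by (simp add: L2_on_def)
  then show "AE x in lborel. f x = cnj (unit_on \<O> x) * f x" by eventually_elim (auto simp: indicator_def)
  have "f \<in> borel_measurable lborel" using assms by (auto simp: L2_on_def L2_space_def)
  then show "f \<in> borel_measurable lborel" "(\<lambda>x. cnj (unit_on \<O> x) * f x) \<in> borel_measurable lborel" by auto
qed

lemma L2_mean_zero_eq: "L2_mean_zero \<O> = {f \<in> L2_on \<O>. L2_inner lborel (unit_on \<O>) f = 0}"
  using mean_eq_inner by (auto simp: L2_mean_zero_def)

lemma L2_mean_zero_closed: "L2_closed lborel (L2_mean_zero \<O>)"
  unfolding L2_closed_def
proof (intro allI impI)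
  fix F :: "nat \<Rightarrow> real^'d \<Rightarrow> complex" and f
  assume F: "\<forall>k. F k \<in> L2_mean_zero \<O>" and f: "f \<in> L2_space lborel"
    and lim: "(\<lambda>k. L2_norm lborel (\<lambda>x. F k x - f x)) \<longlonglongrightarrow> 0"
  have FO: "F k \<in> L2_on \<O>" and F0: "L2_inner lborel (unit_on \<O>) (F k) = 0" for k using F by (auto simp: L2_mean_zero_eq)
  have fO: "f \<in> L2_on \<O>"
    using L2_on_closed[OF open_region] FO f lim unfolding L2_closed_def by blast
  have "cmod (L2_inner lborel (unit_on \<O>) f) \<le> L2_norm lborel (unit_on \<O>) * L2_norm lborel (\<lambda>x. F k x - f x)" for k
  proof -
    have "L2_inner lborel (unit_on \<O>) (\<lambda>x. F k x - f x) = - L2_inner lborel (unit_on \<O>) f"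
      using positive_form.diff_right[OF L2_on_form unit_on_mem FO fO] F0 by simp
    moreover have "cmod (L2_inner lborel (unit_on \<O>) (\<lambda>x. F k x - f x)) \<le> L2_norm lborel (unit_on \<O>) * L2_norm lborel (\<lambda>x. F k x - f x)"
      using unit_on_mem FO f L2_on_subset by (intro L2_Cauchy_Schwarz L2_diff_mem) blast+
    ultimately show ?thesis by simp
  qed
  moreover have "(\<lambda>k. L2_norm lborel (unit_on \<O>) * L2_norm lborel (\<lambda>x. F k x - f x)) \<longlonglongrightarrow> L2_norm lborel (unit_on \<O>) * 0"
    by (intro tendsto_intros lim)
  ultimately have "cmod (L2_inner lborel (unit_on \<O>) f) \<le> L2_norm lborel (unit_on \<O>) * 0"
    by (intro LIMSEQ_le_const) auto
  then show "f \<in> L2_mean_zero \<O>" using fO by (simp add: L2_mean_zero_eq)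
qed

text \<open>The only possible condensate wave function of zero momentum, up to phase and null sets,
  with the normalisation of \<open>has_momentum\<close>.\<close>

definition constant_mode :: "real^'d \<Rightarrow> complex" where
  "constant_mode = (\<lambda>x. complex_of_real (measure lborel \<O> powr (- 1 / 2)) * unit_on \<O> x)"

lemma constant_mode_mem: "constant_mode \<in> L2_on \<O>"
  unfolding constant_mode_def by (rule positive_form.scale_mem[OF L2_on_form unit_on_mem])

lemma constant_mode_norm: "L2_norm lborel constant_mode = 1"
proof -
  have "(L2_norm lborel constant_mode)\<^sup>2 = (measure lborel \<O> powr (- 1 / 2))\<^sup>2 * measure lborel \<O>"
    unfolding constant_mode_def
    using positive_form.scale_self[OF L2_on_form unit_on_mem, of "complex_of_real (measure lborel \<O> powr (- 1 / 2))"]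
    by (simp add: Re_L2_inner_self norm_unit_on)
  also have "(measure lborel \<O> powr (- 1 / 2))\<^sup>2 = measure lborel \<O> powr (- 1 / 2 + - 1 / 2)"
    by (simp only: powr_add power2_eq_square)
  also have "\<dots> = 1 / measure lborel \<O>"
    using volume_pos by (simp add: powr_neg_one)
  also have "1 / measure lborel \<O> * measure lborel \<O> = 1" using volume_pos by simp
  finally show ?thesis using L2_norm_nonneg[of lborel constant_mode] by (simp add: power2_eq_1_iff)
qed

lemma inner_constant_mode:
  assumes "f \<in> L2_on \<O>"
  shows "L2_inner lborel constant_mode f = complex_of_real (measure lborel \<O> powr (- 1 / 2)) * (LINT x|lborel. f x)"
  unfolding constant_mode_def mean_eq_inner[OF assms]
  using positive_form.scale_left[OF L2_on_form assms unit_on_mem] by simp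

lemma mean_zero_iff:
  "f \<in> L2_mean_zero \<O> \<longleftrightarrow> f \<in> L2_on \<O> \<and> L2_inner lborel constant_mode f = 0"
  using volume_pos by (auto simp: L2_mean_zero_def inner_constant_mode)

lemma diff_constant_mode:
  assumes "f \<in> L2_on \<O>"
  shows "(\<lambda>x. f x - L2_inner lborel constant_mode f * constant_mode x) \<in> L2_mean_zero \<O>"
proof -
  interpret L: positive_form "L2_on \<O>" "L2_inner lborel" by (rule L2_on_form)
  let ?c = "L2_inner lborel constant_mode f"
  have "L2_inner lborel constant_mode (\<lambda>x. f x - ?c * constant_mode x) = ?c - ?c * L2_inner lborel constant_mode constant_mode"
    using assms constant_mode_mem by (simp add: L.diff_right L.scale_right L.scale_mem)
  then show ?thesis
    using assms constant_mode_mem by (simp add: mean_zero_iff L.diff_mem L.scale_mem L2_inner_self constant_mode_norm)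
qed

end

subsection \<open>Translations\<close>

lemma translate_L2_on:
  assumes f: "f \<in> L2_on A" and AB: "(\<lambda>z. z + x) ` A \<subseteq> B"
  shows "translate x f \<in> L2_on (B :: (real^'d::finite) set)"
proof -
  have m: "(\<lambda>z. z - x) \<in> measurable lborel lborel" by simp
  have d: "distr lborel lborel (\<lambda>z. z - x) = (lborel :: (real^'d) measure)"
  proof -
    have "distr lborel lborel (\<lambda>z. z - x) = distr lborel borel ((+) (- x))"
      by (rule distr_cong) auto
    then show ?thesis by (simp only: lborel_distr_plus)
  qed
  have fm: "f \<in> borel_measurable lborel" and fi: "integrable lborel (\<lambda>x. (cmod (f x))\<^sup>2)"
    and f0: "AE z in lborel. z \<notin> A \<longrightarrow> f z = 0"
    using f by (auto simp: L2_on_def L2_space_def)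
  have "(\<lambda>z. f (z - x)) \<in> borel_measurable lborel" by (rule measurable_compose[OF m fm])
  moreover have "integrable lborel (\<lambda>z. (cmod (f (z - x)))\<^sup>2)"
    using fi by (intro integrable_distr[OF m]) (simp only: d)
  moreover have "AE z in lborel. z \<notin> B \<longrightarrow> f (z - x) = 0"
  proof -
    have "AE z in lborel. z - x \<notin> A \<longrightarrow> f (z - x) = 0"
      by (rule AE_distrD[OF m]) (simp only: d f0)
    then show ?thesis
    proof eventually_elim
      case (elim z)
      show ?case
      proof
        assume "z \<notin> B"
        then have "z - x \<notin> A" using AB by (metis diff_add_cancel image_eqI subsetD)
        with elim show "f (z - x) = 0" by simp
      qed
    qed
  qed
  ultimately show ?thesis by (simp add: L2_on_def L2_space_def translate_def[abs_def])
qed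

lemma integral_translate:
  assumes "f \<in> borel_measurable lborel"
  shows "(LINT z|lborel. translate x f z) = (LINT z|lborel. f (z :: real^'d::finite))"
proof -
  have "(LINT z|distr lborel borel ((+) (- x)). f z) = (LINT z|lborel. f (- x + z))"
    using assms by (intro integral_distr) auto
  then show ?thesis by (simp add: translate_def lborel_distr_plus)
qed

subsection \<open>Regular functions and condensates\<close>

text \<open>Eventual bounds combine under sums and Cauchy-Schwarz without arithmetic on extended
  reals.\<close>

lemma limsup_occupation_finite_iff:
  "limsup_occupation \<omega> f < \<infinity> \<longleftrightarrow> (\<exists>C. eventually (\<lambda>\<sigma>. occupation (\<omega> \<sigma>) f \<le> C) at_top)"
proof
  assume "limsup_occupation \<omega> f < \<infinity>"
  then obtain C where "limsup_occupation \<omega> f < ereal C" using ereal_dense2 by blast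
  then have "eventually (\<lambda>\<sigma>. ereal (occupation (\<omega> \<sigma>) f) < ereal C) at_top"
    unfolding limsup_occupation_def by (rule Limsup_lessD)
  then have "eventually (\<lambda>\<sigma>. occupation (\<omega> \<sigma>) f \<le> C) at_top" by eventually_elim simp
  then show "\<exists>C. eventually (\<lambda>\<sigma>. occupation (\<omega> \<sigma>) f \<le> C) at_top" ..
next
  assume "\<exists>C. eventually (\<lambda>\<sigma>. occupation (\<omega> \<sigma>) f \<le> C) at_top"
  then obtain C where "eventually (\<lambda>\<sigma>. occupation (\<omega> \<sigma>) f \<le> C) at_top" ..
  then have "limsup_occupation \<omega> f \<le> ereal C"
    unfolding limsup_occupation_def by (intro Limsup_bounded) simp
  then show "limsup_occupation \<omega> f < \<infinity>" by (rule le_less_trans) simp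
qed

locale region_states = region \<O> for \<O> :: "(real^'d::finite) set" +
  fixes \<omega> :: "'d states"
  assumes states: "\<And>\<sigma>. \<sigma> > 0 \<Longrightarrow> fock_state (\<omega> \<sigma>)"
begin

lemma form: "\<sigma> > 0 \<Longrightarrow> positive_form (L2_space lborel) (\<lambda>f g. one_particle (\<omega> \<sigma>) g f)"
  by (rule one_particle_form[OF states])

abbreviation "R \<equiv> regular_subspace \<omega> \<O>"

lemma regular_iff: "f \<in> R \<longleftrightarrow> f \<in> L2_on \<O> \<and> (\<exists>C. eventually (\<lambda>\<sigma>. occupation (\<omega> \<sigma>) f \<le> C) at_top)"
  by (simp only: regular_subspace_def limsup_occupation_finite_iff mem_Collect_eq)

lemma zero_regular: "(\<lambda>_. 0) \<in> R"
proof -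
  have "eventually (\<lambda>\<sigma>. occupation (\<omega> \<sigma>) (\<lambda>_. 0) \<le> 0) at_top"
    \<comment> \<open>Only positive \<sigma> belong to Fock states, so the form is positive only
      there.\<close>
    using eventually_gt_at_top[of "0::real"]
  proof eventually_elim
    case (elim \<sigma>)
    then show ?case
      using positive_form.zero_right[OF form[OF elim] L2_zero_mem] by (simp add: occupation_def)
  qed
  then show ?thesis by (auto simp: regular_iff zero_L2_on)
qed

lemma lin_regular:
  assumes "f \<in> R" "g \<in> R"
  shows "(\<lambda>x. f x + c * g x) \<in> R"
proof -
  have fg: "f \<in> L2_on \<O>" "g \<in> L2_on \<O>" using assms by (auto simp: regular_iff)
  then have fgL: "f \<in> L2_space lborel" "g \<in> L2_space lborel" using L2_on_subset by blast+
  obtain C D where "eventually (\<lambda>\<sigma>. occupation (\<omega> \<sigma>) f \<le> C) at_top" "eventually (\<lambda>\<sigma>. occupation (\<omega> \<sigma>) g \<le> D) at_top"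
    using assms by (auto simp: regular_iff)
  then have "eventually (\<lambda>\<sigma>. occupation (\<omega> \<sigma>) (\<lambda>x. f x + c * g x) \<le> 2 * C + 2 * (cmod c)\<^sup>2 * D) at_top"
    using eventually_gt_at_top[of "0::real"]
  proof eventually_elim
    case (elim \<sigma>)
    have "occupation (\<omega> \<sigma>) (\<lambda>x. f x + c * g x) \<le> 2 * occupation (\<omega> \<sigma>) f + 2 * (cmod c)\<^sup>2 * occupation (\<omega> \<sigma>) g"
      unfolding occupation_def using positive_form.lin_self_le[OF form[OF elim(3)] fgL, of c] .
    also have "\<dots> \<le> 2 * C + 2 * (cmod c)\<^sup>2 * D"
      using elim by (intro add_mono mult_left_mono) auto
    finally show ?case .
  qed
  then show ?thesis using fg by (auto simp: regular_iff lin_L2_on)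
qed

lemma singular_iff: "f \<in> L2_on \<O> \<Longrightarrow> limsup_occupation \<omega> f = \<infinity> \<longleftrightarrow> f \<notin> R"
  by (simp add: regular_subspace_def less_top)

text \<open>\<open>s\<close> is a phase times \<open>constant_mode\<close>, so regular functions
  have mean zero. Conversely the residual of a mean zero \<open>f\<close> after projection to the
  closed subspace \<open>R\<close> is a multiple of \<open>s\<close>, yet \<open>f\<close> and its
  projection are both orthogonal to \<open>s\<close>.\<close>

lemma condensate_imp:
  assumes s: "proper_condensate_wrt \<omega> \<O> s" and p: "has_momentum \<O> s 0"
  shows "L2_mean_zero \<O> \<subseteq> R" and "\<And>g. g \<in> R \<Longrightarrow> (LINT x|lborel. g x) = 0"
proof -
  interpret L: positive_form "L2_on \<O>" "L2_inner lborel" by (rule L2_on_form)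
  have closed: "L2_closed lborel R" and sO: "s \<in> L2_on \<O>"
    and compl: "orth_complement_on \<O> R = {h \<in> L2_on \<O>. \<exists>c. AE x in lborel. h x = c * s x}"
    using s by (auto simp: proper_condensate_wrt_def)
  obtain c where c: "cmod c = 1"
    and s_in: "AE x in lborel. x \<in> \<O> \<longrightarrow> s x = c * complex_of_real (measure lborel \<O> powr (- 1 / 2)) * cis (x \<bullet> 0)"
    using p unfolding has_momentum_def by blast
  have s_out: "AE x in lborel. x \<notin> \<O> \<longrightarrow> s x = 0" using sO by (simp add: L2_on_def)
  have AE: "AE x in lborel. s x = c * constant_mode x"
    using s_in s_out by eventually_elim (auto simp: constant_mode_def indicator_def)
  have inner_s: "L2_inner lborel s f = cnj c * L2_inner lborel constant_mode f" if "f \<in> L2_on \<O>" for f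
  proof -
    have "L2_inner lborel s f = L2_inner lborel (\<lambda>x. c * constant_mode x) f"
      using that sO constant_mode_mem L.scale_mem L2_on_subset AE by (intro L2_inner_AE_cong) blast+
    then show ?thesis using L.scale_left[OF that constant_mode_mem] by simp
  qed
  have "AE x in lborel. s x = 1 * s x" by simp
  then have "s \<in> orth_complement_on \<O> R" unfolding compl using sO by blast
  then have s_orth: "L2_inner lborel s g = 0" if "g \<in> R" for g
    using that L2_inner_cnj[of lborel s g] by (simp add: orth_complement_on_def)
  show "(LINT x|lborel. g x) = 0" if g: "g \<in> R" for g
  proof -
    have gO: "g \<in> L2_on \<O>" using g by (simp add: regular_iff)
    have "cnj c * L2_inner lborel constant_mode g = 0" using inner_s[OF gO] s_orth[OF g] by simp
    then show ?thesis using c volume_pos by (auto simp: inner_constant_mode[OF gO])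
  qed
  show "L2_mean_zero \<O> \<subseteq> R"
  proof
    fix f assume f: "f \<in> L2_mean_zero \<O>"
    then have fO: "f \<in> L2_on \<O>" and f0: "L2_inner lborel constant_mode f = 0" by (auto simp: mean_zero_iff)
    have fL: "f \<in> L2_space lborel" using fO L2_on_subset by blast
    have RO: "R \<subseteq> L2_on \<O>" by (auto simp: regular_iff)
    obtain F h where F: "\<And>k::nat. F k \<in> R" and h: "h \<in> L2_space lborel"
      and lim: "(\<lambda>k. L2_norm lborel (\<lambda>x. F k x - h x)) \<longlonglongrightarrow> 0"
      and orth: "\<And>g. g \<in> R \<Longrightarrow> L2_inner lborel g (\<lambda>x. f x - h x) = 0"
      by (rule L2_projection[OF order_trans[OF RO L2_on_subset] zero_regular _ fL]) (erule (1) lin_regular, blast)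
    have hR: "h \<in> R" using closed F h lim unfolding L2_closed_def by blast
    have hO: "h \<in> L2_on \<O>" using hR RO by blast
    let ?d = "\<lambda>x. f x - h x"
    have dO: "?d \<in> L2_on \<O>" by (intro L.diff_mem fO hO)
    have dL: "?d \<in> L2_space lborel" using dO L2_on_subset by blast
    have "?d \<in> orth_complement_on \<O> R" using dO orth by (simp add: orth_complement_on_def)
    then obtain a where a: "AE x in lborel. ?d x = a * s x" unfolding compl by blast
    have "L2_inner lborel ?d ?d = L2_inner lborel (\<lambda>x. a * s x) ?d"
      using dL sO L.scale_mem L2_on_subset a by (intro L2_inner_AE_cong) blast+
    also have "\<dots> = cnj a * (L2_inner lborel s f - L2_inner lborel s h)"
      by (simp only: L.scale_left[OF dO sO] L.diff_right[OF sO fO hO])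
    also have "\<dots> = 0" by (simp add: inner_s[OF fO] f0 s_orth[OF hR])
    finally have "L2_norm lborel ?d = 0" by (simp add: L2_inner_self)
    then have "L2_norm lborel (\<lambda>x. h x - f x) = 0" by (subst L2_norm_diff_commute)
    \<comment> \<open>\<open>f\<close> agrees with the regular \<open>h\<close> only almost
      everywhere. Closedness applied to the constant sequence \<open>h\<close> shows that such an
      \<open>f\<close> is regular, too.\<close>
    then have "(\<lambda>k::nat. L2_norm lborel (\<lambda>x. h x - f x)) \<longlonglongrightarrow> 0" by simp
    then show "f \<in> R"
      using closed[unfolded L2_closed_def, rule_format, of "\<lambda>_. h" f] hR fL by blast
  qed
qed

text \<open>A regular \<open>g\<close> of nonzero mean would allow \<open>s\<close> to be written as
  a mean zero function plus a multiple of \<open>g\<close>, making \<open>s\<close> regular. This is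
  why one singular function of nonzero mean implies that all are singular.\<close>

lemma regular_eq_mean_zero:
  assumes regular: "L2_mean_zero \<O> \<subseteq> R"
    and s: "s \<in> L2_on \<O>" "(LINT x|lborel. s x) \<noteq> 0" "s \<notin> R"
  shows "R = L2_mean_zero \<O>"
proof (rule antisym[OF _ regular], rule subsetI, rule ccontr)
  interpret L: positive_form "L2_on \<O>" "L2_inner lborel" by (rule L2_on_form)
  fix g assume g: "g \<in> R" "g \<notin> L2_mean_zero \<O>"
  have gO: "g \<in> L2_on \<O>" using g(1) by (simp add: regular_iff)
  let ?u = "L2_inner lborel (unit_on \<O>)"
  have g0: "?u g \<noteq> 0" using g(2) gO by (simp add: L2_mean_zero_eq)
  define h where "h = (\<lambda>x. s x - (?u s / ?u g) * g x)"
  have "?u h = ?u s - (?u s / ?u g) * ?u g"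
    by (simp only: h_def L.diff_right[OF unit_on_mem s(1) L.scale_mem[OF gO]] L.scale_right[OF unit_on_mem gO])
  then have "?u h = 0" using g0 by simp
  moreover have "h \<in> L2_on \<O>" unfolding h_def by (intro L.diff_mem L.scale_mem s(1) gO)
  ultimately have "h \<in> R" using regular by (auto simp: L2_mean_zero_eq)
  then have "(\<lambda>x. h x + (?u s / ?u g) * g x) \<in> R" using g(1) by (rule lin_regular)
  then show False using s(3) by (simp add: h_def)
qed

text \<open>For \<open>h\<close> orthogonal to \<open>R\<close>, subtracting its component along
  \<open>constant_mode\<close> leaves a mean zero function that is orthogonal to both
  \<open>h\<close> and \<open>constant_mode\<close>, hence to itself.\<close>

lemma proper_condensate:
  assumes R: "R = L2_mean_zero \<O>"
  shows "proper_condensate_wrt \<omega> \<O> constant_mode"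
  unfolding proper_condensate_wrt_def
proof (intro conjI)
  interpret L: positive_form "L2_on \<O>" "L2_inner lborel" by (rule L2_on_form)
  show "L2_closed lborel R" unfolding R by (rule L2_mean_zero_closed)
  show "constant_mode \<in> L2_on \<O> - R"
    unfolding R by (simp add: mean_zero_iff constant_mode_mem L2_inner_self constant_mode_norm)
  show "L2_norm lborel constant_mode = 1" by (rule constant_mode_norm)
  show "orth_complement_on \<O> R = {h \<in> L2_on \<O>. \<exists>c. AE x in lborel. h x = c * constant_mode x}"
  proof (intro set_eqI iffI)
    fix h assume "h \<in> orth_complement_on \<O> R"
    then have h: "h \<in> L2_on \<O>" and orth: "\<And>f. f \<in> L2_mean_zero \<O> \<Longrightarrow> L2_inner lborel f h = 0"
      by (auto simp: orth_complement_on_def R)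
    let ?c = "L2_inner lborel constant_mode h"
    let ?f = "\<lambda>x. h x - ?c * constant_mode x"
    have f: "?f \<in> L2_mean_zero \<O>" by (rule diff_constant_mode[OF h])
    then have fO: "?f \<in> L2_on \<O>" and f0: "L2_inner lborel constant_mode ?f = 0" by (auto simp: mean_zero_iff)
    have "L2_inner lborel ?f ?f = L2_inner lborel ?f h - ?c * L2_inner lborel ?f constant_mode"
      using L.diff_right[OF fO h L.scale_mem[OF constant_mode_mem], of ?c]
      by (simp only: L.scale_right[OF fO constant_mode_mem])
    also have "\<dots> = 0" using orth[OF f] f0 L2_inner_cnj[of lborel ?f constant_mode] by simp
    finally have "L2_norm lborel ?f = 0" by (simp add: L2_inner_self)
    then have "AE x in lborel. ?f x = 0"
      using fO L2_on_subset by (subst (asm) L2_norm_eq_0_iff) blast+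
    then have "AE x in lborel. h x = ?c * constant_mode x" by eventually_elim simp
    with h show "h \<in> {h \<in> L2_on \<O>. \<exists>c. AE x in lborel. h x = c * constant_mode x}" by blast
  next
    fix h assume "h \<in> {h \<in> L2_on \<O>. \<exists>c. AE x in lborel. h x = c * constant_mode x}"
    then obtain c where h: "h \<in> L2_on \<O>" and c: "AE x in lborel. h x = c * constant_mode x" by blast
    have "L2_inner lborel f h = 0" if f: "f \<in> L2_mean_zero \<O>" for f
    proof -
      have fO: "f \<in> L2_on \<O>" and f0: "L2_inner lborel constant_mode f = 0" using f by (auto simp: mean_zero_iff)
      have "L2_inner lborel f h = L2_inner lborel f (\<lambda>x. c * constant_mode x)"
        using fO h L.scale_mem[OF constant_mode_mem] L2_on_subset c by (intro L2_inner_AE_cong) blast+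
      also have "\<dots> = c * L2_inner lborel f constant_mode" by (rule L.scale_right[OF fO constant_mode_mem])
      also have "\<dots> = 0" using f0 L2_inner_cnj[of lborel f constant_mode] by simp
      finally show ?thesis .
    qed
    with h show "h \<in> orth_complement_on \<O> R" by (simp add: orth_complement_on_def R)
  qed
qed

text \<open>Only the components of \<open>f\<close> and \<open>g\<close> along the condensate grow like its occupation \<open>n\<close>; by
  Cauchy-Schwarz the mixed terms are of order \<open>sqrt n\<close>.\<close>

lemma condensate_lim_constant_mode:
  assumes regular: "L2_mean_zero \<O> \<subseteq> R" and f: "f \<in> L2_on \<O>" and g: "g \<in> L2_on \<O>"
  shows "condensate_lim \<omega> constant_mode
    (\<lambda>\<sigma>. one_particle (\<omega> \<sigma>) f g / complex_of_real (occupation (\<omega> \<sigma>) constant_mode))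
    (L2_inner lborel constant_mode f * L2_inner lborel g constant_mode)"
  unfolding condensate_lim_def
proof (intro allI impI)
  fix \<sigma> :: "nat \<Rightarrow> real"
  assume pos: "\<forall>j. \<sigma> j > 0" and top: "filterlim \<sigma> at_top sequentially"
    and n_top: "filterlim (\<lambda>j. occupation (\<omega> (\<sigma> j)) constant_mode) at_top sequentially"
  define \<alpha> \<beta> where "\<alpha> = L2_inner lborel constant_mode f" and "\<beta> = L2_inner lborel constant_mode g"
  \<comment> \<open>These remainders have mean zero, so they are regular and their occupations stay
    bounded.\<close>
  define f1 g1 where "f1 = (\<lambda>x. f x - \<alpha> * constant_mode x)" and "g1 = (\<lambda>x. g x - \<beta> * constant_mode x)"
  let ?n = "\<lambda>j. occupation (\<omega> (\<sigma> j)) constant_mode"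
  have "f1 \<in> R" "g1 \<in> R"
    using regular diff_constant_mode[OF f] diff_constant_mode[OF g] by (auto simp: f1_def g1_def \<alpha>_def \<beta>_def)
  then obtain C D where C: "eventually (\<lambda>\<sigma>. occupation (\<omega> \<sigma>) f1 \<le> C) at_top"
    and D: "eventually (\<lambda>\<sigma>. occupation (\<omega> \<sigma>) g1 \<le> D) at_top"
    and f1g1: "f1 \<in> L2_on \<O>" "g1 \<in> L2_on \<O>"
    by (auto simp: regular_iff)
  define K where "K = max C D"
  \<comment> \<open>The first summand controls the term between the two remainders, the second the
    two mixed terms after division by the occupation.\<close>
  let ?bound = "\<lambda>j. K / ?n j + (cmod \<alpha> + cmod \<beta>) * sqrt K / sqrt (?n j)"
  have mem: "f1 \<in> L2_space lborel" "g1 \<in> L2_space lborel" "constant_mode \<in> L2_space lborel"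
    using f1g1 constant_mode_mem L2_on_subset by blast+
  have "eventually (\<lambda>j. norm (one_particle (\<omega> (\<sigma> j)) f g / complex_of_real (?n j) - \<alpha> * cnj \<beta>) \<le> ?bound j) sequentially"
    using eventually_compose_filterlim[OF C top] eventually_compose_filterlim[OF D top]
      \<comment> \<open>Divergence of the occupation makes it eventually positive, so division by it
        is harmless.\<close>
      filterlim_at_top_dense[THEN iffD1, OF n_top, rule_format, of 0]
  proof eventually_elim
    case (elim j)
    define q where "q f g = one_particle (\<omega> (\<sigma> j)) g f" for f g
    interpret q: positive_form "L2_space lborel" q
      unfolding q_def[abs_def] using form pos by blast
    let ?s = constant_mode and ?N = "?n j"
    have n: "?N > 0" "Re (q ?s ?s) = ?N" using elim(3) by (simp_all add: q_def occupation_def)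
    have occ: "Re (q f1 f1) \<le> K" "Re (q g1 g1) \<le> K"
      using elim(1,2) by (auto simp: q_def occupation_def K_def)
    have K: "K \<ge> 0" using q.nonneg[OF mem(1)] occ(1) by simp
    have "f = (\<lambda>x. f1 x + \<alpha> * ?s x)" "g = (\<lambda>x. g1 x + \<beta> * ?s x)" by (auto simp: f1_def g1_def)
    then have "q g f = q (\<lambda>x. g1 x + \<beta> * ?s x) (\<lambda>x. f1 x + \<alpha> * ?s x)" by simp
    also have "\<dots> = q g1 f1 + \<alpha> * q g1 ?s + cnj \<beta> * (q ?s f1 + \<alpha> * q ?s ?s)"
      using mem by (simp add: q.lin_left q.lin_right L2_lin_mem)
    finally have "q g f = q g1 f1 + \<alpha> * q g1 ?s + cnj \<beta> * (q ?s f1 + \<alpha> * complex_of_real ?N)"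
      using q.self_real[OF mem(3)] n(2) by simp
    then have "q g f / complex_of_real ?N - \<alpha> * cnj \<beta> = (q g1 f1 + \<alpha> * q g1 ?s + cnj \<beta> * q ?s f1) / complex_of_real ?N"
      using n(1) by (simp add: field_simps)
    then have "cmod (q g f / complex_of_real ?N - \<alpha> * cnj \<beta>) = cmod (q g1 f1 + \<alpha> * q g1 ?s + cnj \<beta> * q ?s f1) / ?N"
      using n(1) by (simp add: norm_divide)
    also have "\<dots> \<le> (K + cmod \<alpha> * (sqrt K * sqrt ?N) + cmod \<beta> * (sqrt ?N * sqrt K)) / ?N"
    proof (rule divide_right_mono)
      have "cmod (q g1 f1) \<le> sqrt (Re (q g1 g1)) * sqrt (Re (q f1 f1))" by (rule q.Cauchy_Schwarz_sqrt[OF mem(2,1)])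
      also have "\<dots> \<le> sqrt K * sqrt K" using occ K q.nonneg[OF mem(1)] by (intro mult_mono) auto
      finally have 1: "cmod (q g1 f1) \<le> K" using K by simp
      have "cmod (q g1 ?s) \<le> sqrt (Re (q g1 g1)) * sqrt (Re (q ?s ?s))" by (rule q.Cauchy_Schwarz_sqrt[OF mem(2,3)])
      also have "\<dots> \<le> sqrt K * sqrt ?N" unfolding n(2) using occ n(1) by (intro mult_right_mono) auto
      finally have 2: "cmod (\<alpha> * q g1 ?s) \<le> cmod \<alpha> * (sqrt K * sqrt ?N)" by (simp add: norm_mult mult_left_mono)
      have "cmod (q ?s f1) \<le> sqrt (Re (q ?s ?s)) * sqrt (Re (q f1 f1))" by (rule q.Cauchy_Schwarz_sqrt[OF mem(3,1)])
      also have "\<dots> \<le> sqrt ?N * sqrt K" unfolding n(2) using occ n(1) by (intro mult_left_mono) auto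
      finally have 3: "cmod (cnj \<beta> * q ?s f1) \<le> cmod \<beta> * (sqrt ?N * sqrt K)" by (simp add: norm_mult mult_left_mono)
      show "cmod (q g1 f1 + \<alpha> * q g1 ?s + cnj \<beta> * q ?s f1) \<le> K + cmod \<alpha> * (sqrt K * sqrt ?N) + cmod \<beta> * (sqrt ?N * sqrt K)"
        using 1 2 3 by (intro norm_triangle_le add_mono) auto
    qed (use n(1) in simp)
    also have "\<dots> = K / ?N + (cmod \<alpha> + cmod \<beta>) * sqrt K * (sqrt ?N / ?N)"
      by (simp add: add_divide_distrib algebra_simps)
    also have "sqrt ?N / ?N = 1 / sqrt ?N" using n(1) by (simp add: real_div_sqrt field_simps)
    finally show ?case by (simp add: q_def)
  qed
  moreover have "?bound \<longlonglongrightarrow> 0 + 0"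
    by (intro tendsto_add tendsto_divide_0[OF tendsto_const] filterlim_at_top_imp_at_infinity n_top
        filterlim_compose[OF sqrt_at_top n_top])
  ultimately have "(\<lambda>j. one_particle (\<omega> (\<sigma> j)) f g / complex_of_real (?n j) - \<alpha> * cnj \<beta>) \<longlonglongrightarrow> 0"
    unfolding add_0 by (rule Lim_null_comparison)
  then have "(\<lambda>j. one_particle (\<omega> (\<sigma> j)) f g / complex_of_real (?n j)) \<longlonglongrightarrow> \<alpha> * cnj \<beta>"
    by (simp only: LIM_zero_iff)
  then show "(\<lambda>j. one_particle (\<omega> (\<sigma> j)) f g / complex_of_real (?n j)) \<longlonglongrightarrow>
      L2_inner lborel constant_mode f * L2_inner lborel g constant_mode"
    by (simp only: \<alpha>_def \<beta>_def L2_inner_cnj[of lborel g constant_mode])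
qed

text \<open>The limit formula holds for all functions on \<O>, in particular for the translated
  ones. Its right side involves only their integrals, and these do not change under
  translation.\<close>

lemma homogeneous_condensate:
  assumes R: "R = L2_mean_zero \<O>"
  shows "homogeneous_condensate_wrt \<omega> \<O> constant_mode"
  unfolding homogeneous_condensate_wrt_def
proof (intro conjI allI ballI impI proper_condensate R)
  fix \<O>\<^sub>0 :: "(real^'d) set" and x f g
  assume f: "f \<in> L2_on \<O>\<^sub>0" and g: "g \<in> L2_on \<O>\<^sub>0" and "\<O>\<^sub>0 \<Subset> \<O>" and "(\<lambda>z. z + x) ` \<O>\<^sub>0 \<Subset> \<O>"
  then have sub: "\<O>\<^sub>0 \<subseteq> \<O>" "(\<lambda>z. z + x) ` \<O>\<^sub>0 \<subseteq> \<O>"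
    unfolding inside_def by (meson closure_subset subset_trans)+
  have inner: "translate x h \<in> L2_on \<O>" "L2_inner lborel constant_mode (translate x h) = L2_inner lborel constant_mode h"
    if h: "h \<in> L2_on \<O>\<^sub>0" for h
  proof -
    show t: "translate x h \<in> L2_on \<O>" using h sub(2) by (rule translate_L2_on)
    have hO: "h \<in> L2_on \<O>" using sub(1) h by (rule L2_on_mono)
    have "h \<in> borel_measurable lborel" using h by (auto simp: L2_on_def L2_space_def)
    then show "L2_inner lborel constant_mode (translate x h) = L2_inner lborel constant_mode h"
      by (simp only: inner_constant_mode[OF t] inner_constant_mode[OF hO] integral_translate)
  qed
  show "condensate_lim \<omega> constant_mode
      (\<lambda>\<sigma>. one_particle (\<omega> \<sigma>) (translate x f) (translate x g) / complex_of_real (occupation (\<omega> \<sigma>) constant_mode))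
      (L2_inner lborel constant_mode f * L2_inner lborel g constant_mode)"
    using condensate_lim_constant_mode[OF _ inner(1)[OF f] inner(1)[OF g]] R
    by (simp add: inner(2)[OF f] inner(2)[OF g] L2_inner_cnj[of lborel "translate x g" constant_mode] L2_inner_cnj[of lborel g constant_mode])
qed

lemma constant_mode_momentum: "has_momentum \<O> constant_mode 0"
  unfolding has_momentum_def by (intro exI[of _ 1] conjI AE_I2) (auto simp: constant_mode_def)

end

text \<open>The two equivalences express that the singular function may be any one of nonzero mean.
  They follow from a cycle: the condensate gives the universal condition, this gives the existential
  one, and that gives back the condensate.\<close>

theorem mainTheorem2:
  fixes \<omega> :: "real \<Rightarrow> ('d::finite) fock_operator \<Rightarrow> complex"
    and \<O> :: "(real^'d) set"
  assumes states: "\<And>\<sigma>. \<sigma> > 0 \<Longrightarrow> fock_state (\<omega> \<sigma>)"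
    and region: "open \<O>" "bounded \<O>" "\<O> \<noteq> {}"
  shows "(homogeneous_condensate_with_momentum \<omega> \<O> 0 \<longleftrightarrow>
           (\<forall>f\<in>L2_mean_zero \<O>. limsup_occupation \<omega> f < \<infinity>) \<and>
           (\<exists>s\<in>L2_on \<O>. (LINT x|lborel. s x) \<noteq> 0 \<and> limsup_occupation \<omega> s = \<infinity>)) \<and>
         (homogeneous_condensate_with_momentum \<omega> \<O> 0 \<longleftrightarrow>
           (\<forall>f\<in>L2_mean_zero \<O>. limsup_occupation \<omega> f < \<infinity>) \<and>
           (\<forall>s\<in>L2_on \<O>. (LINT x|lborel. s x) \<noteq> 0 \<longrightarrow> limsup_occupation \<omega> s = \<infinity>))"
proof -
  interpret region_states \<O> \<omega> by unfold_locales (use states region in auto)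
  let ?P = "homogeneous_condensate_with_momentum \<omega> \<O> 0"
  let ?Q = "\<forall>f\<in>L2_mean_zero \<O>. limsup_occupation \<omega> f < \<infinity>"
  let ?E = "\<exists>s\<in>L2_on \<O>. (LINT x|lborel. s x) \<noteq> 0 \<and> limsup_occupation \<omega> s = \<infinity>"
  let ?A = "\<forall>s\<in>L2_on \<O>. (LINT x|lborel. s x) \<noteq> 0 \<longrightarrow> limsup_occupation \<omega> s = \<infinity>"
  have Q: "?Q \<longleftrightarrow> L2_mean_zero \<O> \<subseteq> R"
    by (auto simp: regular_subspace_def L2_mean_zero_def)
  have PQA: "?Q \<and> ?A" if ?P
  proof -
    obtain s where s: "proper_condensate_wrt \<omega> \<O> s" "has_momentum \<O> s 0"
      using \<open>?P\<close> unfolding homogeneous_condensate_with_momentum_def homogeneous_condensate_wrt_def by blast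
    show ?thesis using condensate_imp[OF s] singular_iff unfolding Q by blast
  qed
  have AE: ?E if ?A
  proof -
    \<comment> \<open>The indicator of the nonempty open region has nonzero mean, so the universal
      condition is not vacuous.\<close>
    have "(LINT x|lborel. unit_on \<O> x) = of_real ((L2_norm lborel (unit_on \<O>))\<^sup>2)"
      using mean_eq_inner[OF unit_on_mem] L2_inner_self[of lborel "unit_on \<O>"] by (rule trans)
    also have "\<dots> \<noteq> 0" unfolding norm_unit_on using volume_pos by simp
    finally show ?thesis using \<open>?A\<close> unit_on_mem by blast
  qed
  have QEP: ?P if ?Q ?E
  proof -
    have "R = L2_mean_zero \<O>"
      using \<open>?E\<close> \<open>?Q\<close> singular_iff regular_eq_mean_zero unfolding Q by blast
    then show ?thesis
      unfolding homogeneous_condensate_with_momentum_def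
      using homogeneous_condensate constant_mode_momentum by blast
  qed
  show ?thesis using PQA AE QEP by blast
qed

end
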